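(* Let $A$ and $B$ be finite square $\{0,1\}$-matrices (possibly of different sizes) with no zero rows and no zero columns. The following are equivalent. (i) The one-sided shifts $(\mathsf{X}_A,\sigma_A)$ and $(\mathsf{X}_B,\sigma_B)$ are one-sided conjugate, i.e. there is a homeomorphism $h\colon\mathsf{X}_A\to\mathsf{X}_B$ with $h\circ\sigma_A=\sigma_B\circ h$. (ii) There is an isomorphism of topological groupoids $\Phi\colon\mathcal{G}_A\to\mathcal{G}_B$ satisfying $\Phi\circ\epsilon_A=\epsilon_B\circ\Phi$. (iii) There is a $*$-isomorphism $\Psi\colon\mathcal{O}_A\to\mathcal{O}_B$ satisfying $\Psi(\mathcal{D}_A)=\mathcal{D}_B$ and $\Psi\circ\tau_A=\tau_B\circ\Psi$.
   Context: Let $\mathbb{N}=\{0,1,2,\dots\}$. Let $A$ be an $N\times N$ matrix with entries in $\{0,1\}$ and no zero rows and no zero columns. Shift space. $\mathsf{X}_A=\{x=(x_n)_{n\in\mathbb{N}}\in\{1,\dots,N\}^{\mathbb{N}} : A(x_n,x_{n+1})=1 \text{ for all } n\in\mathbb{N}\}$ with the subspace topology of the product topology, and $\sigma_A\colon\mathsf{X}_A\to\mathsf{X}_A$ is the shift $(\sigma_A(x))_n=x_{n+1}$. A word is a finite string $\alpha=\alpha_0\cdots\alpha_{n-1}$ of symbols with $A(\alpha_{i-1},\alpha_i)=1$ for $1\le i\le n-1$. Groupoid. $\mathcal{G}_A=\{(x,n,y)\in\mathsf{X}_A\times\mathbb{Z}\times\mathsf{X}_A : \exists k,l\in\mathbb{N},\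 n=k-l,\ \sigma_A^k(x)=\sigma_A^l(y)\}$, with product $(x,n,y)(y,n',y')=(x,n+n',y')$, inverse $(x,n,y)^{-1}=(y,-n,x)$, range $r(x,n,y)=(x,0,x)$, source $s(x,n,y)=(y,0,y)$ and unit space $\mathcal{G}_A^{(0)}=\{(x,0,x):x\in\mathsf{X}_A\}$. Its topology has as basis the sets $Z(U,k,l,V)=\{(x,k-l,y)\in\mathcal{G}_A : x\in U,\ y\in V,\ \sigma_A^k(x)=\sigma_A^l(y)\}$, where $k,l\in\mathbb{N}$ and $U,V\subseteq\mathsf{X}_A$ are open such that $\sigma_A^k|_U$ and $\sigma_A^l|_V$ are injective and $\sigma_A^k(U)=\sigma_A^l(V)$. The map $\epsilon_A\colon\mathcal{G}_A\to\mathcal{G}_A$ is the continuous groupoid homomorphism $\epsilon_A(x,n,y)=(\sigma_A(x),n,\sigma_A(y))$. An isomorphism of topological groupoids is an algebraic isomorphism that is a homeomorphism. Cuntz–Krieger algebra. $\mathcal{O}_A$ is the universal unital $C^*$-algebra generated (as a $C^*$-algebra, so that $\sum_i s_is_i^*=1$) by partial isometries $s_1,\dots,s_N$ subject to $s_i^*s_j=0$ for $i\ne j$ and $s_i^*s_i=\sum_{j=1}^N A(i,j)s_js_j^*$. For a word $\alpha$, $s_\alpha=s_{\alpha_0}\cdots s_{\alpha_{n-1}}$. The diagonal $\mathcal{D}_A$ is the abelian $C^*$-subalgebra generated by the projections $s_\alpha s_\alpha^*$. The completely positive map $\tau_A\colon\mathcal{O}_A\to\mathcal{O}_A$ is $\tau_A(y)=sys^*=\sum_{i,j=1}^N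 s_jys_i^*$, where $s=\sum_{i=1}^N s_i$. The same notation is used with $B$ in place of $A$. *)

theory Defs
  imports
    "HOL-Analysis.Analysis"
    "HOL-Algebra.Module"
    "HOL-Algebra.QuotRing"
    "HOL-Library.Poly_Mapping"
begin

section \<open>Matrices and one-sided shifts of finite type\<close>

text \<open>The alphabet \<open>{1,\<dots>,N}\<close> is the index type of the matrix.\<close>

definition ck_matrix :: "int ^ 'n ^ 'n \<Rightarrow> bool" where
  "ck_matrix A \<longleftrightarrow>
     (\<forall>i j. A $ i $ j \<in> {0, 1}) \<and>
     (\<forall>i. \<exists>j. A $ i $ j \<noteq> 0) \<and>
     (\<forall>j. \<exists>i. A $ i $ j \<noteq> 0)"

definition shift_space :: "int ^ 'n ^ 'n \<Rightarrow> (nat \<Rightarrow> 'n) set" where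
  "shift_space A = {x. \<forall>n. A $ x n $ x (Suc n) = 1}"

definition shift_topology :: "int ^ 'n ^ 'n \<Rightarrow> (nat \<Rightarrow> 'n) topology" where
  "shift_topology A =
     subtopology (product_topology (\<lambda>_. discrete_topology UNIV) UNIV) (shift_space A)"

definition shift :: "(nat \<Rightarrow> 'n) \<Rightarrow> nat \<Rightarrow> 'n" where
  "shift x = (\<lambda>n. x (Suc n))"

definition one_sided_conjugacy ::
  "int ^ 'm ^ 'm \<Rightarrow> int ^ 'n ^ 'n \<Rightarrow> ((nat \<Rightarrow> 'm) \<Rightarrow> nat \<Rightarrow> 'n) \<Rightarrow> bool" where
  "one_sided_conjugacy A B h \<longleftrightarrow>
     homeomorphic_map (shift_topology A) (shift_topology B) h \<and>
     (\<forall>x\<in>shift_space A. h (shift x) = shift (h x))"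

definition admissible_word :: "int ^ 'n ^ 'n \<Rightarrow> 'n list \<Rightarrow> bool" where
  "admissible_word A \<alpha> \<longleftrightarrow> (\<forall>i. Suc i < length \<alpha> \<longrightarrow> A $ (\<alpha> ! i) $ (\<alpha> ! Suc i) = 1)"


section \<open>Topological groupoids\<close>

text \<open>A groupoid is given by its arrows; units are particular arrows, and \<open>g\<close>, \<open>h\<close> are
  composable when \<open>src g = rng h\<close>.\<close>

record 'g groupoid =
  arrows :: "'g set"
  src :: "'g \<Rightarrow> 'g"
  rng :: "'g \<Rightarrow> 'g"
  gmul :: "'g \<Rightarrow> 'g \<Rightarrow> 'g"
  ginv :: "'g \<Rightarrow> 'g"

record 'g top_groupoid = "'g groupoid" +
  gtop :: "'g topology"

definition groupoid_hom ::
  "('g, 'x) groupoid_scheme \<Rightarrow> ('h, 'y) groupoid_scheme \<Rightarrow> ('g \<Rightarrow> 'h) \<Rightarrow> bool" where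
  "groupoid_hom G H \<Phi> \<longleftrightarrow>
     \<Phi> \<in> arrows G \<rightarrow> arrows H \<and>
     (\<forall>g\<in>arrows G. \<forall>h\<in>arrows G. src G g = rng G h \<longrightarrow>
        src H (\<Phi> g) = rng H (\<Phi> h) \<and> \<Phi> (gmul G g h) = gmul H (\<Phi> g) (\<Phi> h)) \<and>
     (\<forall>g\<in>arrows G. \<Phi> (ginv G g) = ginv H (\<Phi> g))"

definition groupoid_iso ::
  "('g, 'x) groupoid_scheme \<Rightarrow> ('h, 'y) groupoid_scheme \<Rightarrow> ('g \<Rightarrow> 'h) \<Rightarrow> bool" where
  "groupoid_iso G H \<Phi> \<longleftrightarrow>
     bij_betw \<Phi> (arrows G) (arrows H) \<and>
     groupoid_hom G H \<Phi> \<and> groupoid_hom H G (inv_into (arrows G) \<Phi>)"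

definition top_groupoid_iso ::
  "('g, 'x) top_groupoid_scheme \<Rightarrow> ('h, 'y) top_groupoid_scheme \<Rightarrow> ('g \<Rightarrow> 'h) \<Rightarrow> bool" where
  "top_groupoid_iso G H \<Phi> \<longleftrightarrow>
     groupoid_iso G H \<Phi> \<and> homeomorphic_map (gtop G) (gtop H) \<Phi>"


section \<open>The groupoid of a one-sided shift\<close>

type_synonym 'n arrow = "(nat \<Rightarrow> 'n) \<times> int \<times> (nat \<Rightarrow> 'n)"

definition shift_arrows :: "int ^ 'n ^ 'n \<Rightarrow> 'n arrow set" where
  "shift_arrows A = {(x, n, y). x \<in> shift_space A \<and> y \<in> shift_space A \<and>
     (\<exists>k l. n = int k - int l \<and> (shift ^^ k) x = (shift ^^ l) y)}"

definition Zset ::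
  "int ^ 'n ^ 'n \<Rightarrow> (nat \<Rightarrow> 'n) set \<Rightarrow> nat \<Rightarrow> nat \<Rightarrow> (nat \<Rightarrow> 'n) set \<Rightarrow> 'n arrow set" where
  "Zset A U k l V = {(x, n, y). (x, n, y) \<in> shift_arrows A \<and> n = int k - int l \<and>
     x \<in> U \<and> y \<in> V \<and> (shift ^^ k) x = (shift ^^ l) y}"

definition Zbasis :: "int ^ 'n ^ 'n \<Rightarrow> 'n arrow set set" where
  "Zbasis A = {Zset A U k l V | U k l V.
     openin (shift_topology A) U \<and> openin (shift_topology A) V \<and>
     inj_on (shift ^^ k) U \<and> inj_on (shift ^^ l) V \<and>
     (shift ^^ k) ` U = (shift ^^ l) ` V}"

definition shift_groupoid :: "int ^ 'n ^ 'n \<Rightarrow> 'n arrow top_groupoid" where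
  "shift_groupoid A = \<lparr>
     arrows = shift_arrows A,
     src = (\<lambda>(x, n, y). (y, 0, y)),
     rng = (\<lambda>(x, n, y). (x, 0, x)),
     gmul = (\<lambda>(x, n, y) (y', n', z). (x, n + n', z)),
     ginv = (\<lambda>(x, n, y). (y, - n, x)),
     gtop = topology_generated_by (Zbasis A)\<rparr>"

definition eps :: "'n arrow \<Rightarrow> 'n arrow" where
  "eps = (\<lambda>(x, n, y). (shift x, n, shift y))"


section \<open>Unital C*-algebras\<close>

definition complex_ring :: "complex ring" where
  "complex_ring = \<lparr>carrier = UNIV, mult = (*), one = 1, zero = 0, add = (+)\<rparr>"

record 'a cstar = "(complex, 'a) module" +
  star :: "'a \<Rightarrow> 'a"
  nrm :: "'a \<Rightarrow> real"

text \<open>The zero algebra is not excluded.\<close>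

locale cstar_algebra = ring \<AA> + scalars: module complex_ring \<AA>
  for \<AA> :: "('a, 'x) cstar_scheme" (structure) +
  assumes smult_mult_left:
      "x \<in> carrier \<AA> \<Longrightarrow> y \<in> carrier \<AA> \<Longrightarrow> (c \<odot> x) \<otimes> y = c \<odot> (x \<otimes> y)"
    and smult_mult_right:
      "x \<in> carrier \<AA> \<Longrightarrow> y \<in> carrier \<AA> \<Longrightarrow> x \<otimes> (c \<odot> y) = c \<odot> (x \<otimes> y)"
    and star_closed: "x \<in> carrier \<AA> \<Longrightarrow> star \<AA> x \<in> carrier \<AA>"
    and star_star: "x \<in> carrier \<AA> \<Longrightarrow> star \<AA> (star \<AA> x) = x"
    and star_add: "x \<in> carrier \<AA> \<Longrightarrow> y \<in> carrier \<AA> \<Longrightarrow>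
      star \<AA> (x \<oplus> y) = star \<AA> x \<oplus> star \<AA> y"
    and star_smult: "x \<in> carrier \<AA> \<Longrightarrow> star \<AA> (c \<odot> x) = cnj c \<odot> star \<AA> x"
    and star_mult: "x \<in> carrier \<AA> \<Longrightarrow> y \<in> carrier \<AA> \<Longrightarrow>
      star \<AA> (x \<otimes> y) = star \<AA> y \<otimes> star \<AA> x"
    and nrm_nonneg: "x \<in> carrier \<AA> \<Longrightarrow> 0 \<le> nrm \<AA> x"
    and nrm_eq_0: "x \<in> carrier \<AA> \<Longrightarrow> nrm \<AA> x = 0 \<longleftrightarrow> x = \<zero>"
    and nrm_triangle: "x \<in> carrier \<AA> \<Longrightarrow> y \<in> carrier \<AA> \<Longrightarrow>
      nrm \<AA> (x \<oplus> y) \<le> nrm \<AA> x + nrm \<AA> y"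
    and nrm_smult: "x \<in> carrier \<AA> \<Longrightarrow> nrm \<AA> (c \<odot> x) = cmod c * nrm \<AA> x"
    and nrm_mult: "x \<in> carrier \<AA> \<Longrightarrow> y \<in> carrier \<AA> \<Longrightarrow>
      nrm \<AA> (x \<otimes> y) \<le> nrm \<AA> x * nrm \<AA> y"
    and cstar_identity: "x \<in> carrier \<AA> \<Longrightarrow> nrm \<AA> (star \<AA> x \<otimes> x) = (nrm \<AA> x)\<^sup>2"
    and complete: "(\<And>n. u n \<in> carrier \<AA>) \<Longrightarrow>
      (\<And>e. e > 0 \<Longrightarrow> \<exists>M. \<forall>m\<ge>M. \<forall>n\<ge>M. nrm \<AA> (u m \<ominus> u n) < e) \<Longrightarrow>
      \<exists>x\<in>carrier \<AA>. (\<lambda>n. nrm \<AA> (u n \<ominus> x)) \<longlonglongrightarrow> 0"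

definition star_hom ::
  "('a, 'x) cstar_scheme \<Rightarrow> ('b, 'y) cstar_scheme \<Rightarrow> ('a \<Rightarrow> 'b) \<Rightarrow> bool" where
  "star_hom \<AA> \<BB> \<Psi> \<longleftrightarrow>
     \<Psi> \<in> ring_hom \<AA> \<BB> \<and>
     (\<forall>c. \<forall>x\<in>carrier \<AA>. \<Psi> (c \<odot>\<^bsub>\<AA>\<^esub> x) = c \<odot>\<^bsub>\<BB>\<^esub> \<Psi> x) \<and>
     (\<forall>x\<in>carrier \<AA>. \<Psi> (star \<AA> x) = star \<BB> (\<Psi> x))"

definition star_iso ::
  "('a, 'x) cstar_scheme \<Rightarrow> ('b, 'y) cstar_scheme \<Rightarrow> ('a \<Rightarrow> 'b) \<Rightarrow> bool" where
  "star_iso \<AA> \<BB> \<Psi> \<longleftrightarrow> star_hom \<AA> \<BB> \<Psi> \<and> bij_betw \<Psi> (carrier \<AA>) (carrier \<BB>)"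

definition cstar_subalgebra :: "('a, 'x) cstar_scheme \<Rightarrow> 'a set \<Rightarrow> bool" where
  "cstar_subalgebra \<AA> S \<longleftrightarrow>
     S \<subseteq> carrier \<AA> \<and> \<zero>\<^bsub>\<AA>\<^esub> \<in> S \<and>
     (\<forall>x\<in>S. \<forall>y\<in>S. x \<oplus>\<^bsub>\<AA>\<^esub> y \<in> S \<and> x \<otimes>\<^bsub>\<AA>\<^esub> y \<in> S) \<and>
     (\<forall>c. \<forall>x\<in>S. c \<odot>\<^bsub>\<AA>\<^esub> x \<in> S) \<and>
     (\<forall>x\<in>S. star \<AA> x \<in> S) \<and>
     (\<forall>u. \<forall>x\<in>carrier \<AA>. (\<forall>n::nat. u n \<in> S) \<and>
        (\<lambda>n. nrm \<AA> (u n \<ominus>\<^bsub>\<AA>\<^esub> x)) \<longlonglongrightarrow> 0 \<longrightarrow> x \<in> S)"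

definition cstar_generated :: "('a, 'x) cstar_scheme \<Rightarrow> 'a set \<Rightarrow> 'a set" where
  "cstar_generated \<AA> X = \<Inter> {S. cstar_subalgebra \<AA> S \<and> X \<subseteq> S}"

definition partial_isometry :: "('a, 'x) cstar_scheme \<Rightarrow> 'a \<Rightarrow> bool" where
  "partial_isometry \<AA> x \<longleftrightarrow> x \<in> carrier \<AA> \<and> x \<otimes>\<^bsub>\<AA>\<^esub> star \<AA> x \<otimes>\<^bsub>\<AA>\<^esub> x = x"

definition ck_family :: "int ^ 'n ^ 'n \<Rightarrow> ('a, 'x) cstar_scheme \<Rightarrow> ('n \<Rightarrow> 'a) \<Rightarrow> bool" where
  "ck_family A \<AA> t \<longleftrightarrow>
     (\<forall>i. partial_isometry \<AA> (t i)) \<and>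
     (\<forall>i j. i \<noteq> j \<longrightarrow> star \<AA> (t i) \<otimes>\<^bsub>\<AA>\<^esub> t j = \<zero>\<^bsub>\<AA>\<^esub>) \<and>
     (\<forall>i. star \<AA> (t i) \<otimes>\<^bsub>\<AA>\<^esub> t i =
        (\<Oplus>\<^bsub>\<AA>\<^esub>j\<in>UNIV. of_int (A $ i $ j) \<odot>\<^bsub>\<AA>\<^esub> (t j \<otimes>\<^bsub>\<AA>\<^esub> star \<AA> (t j)))) \<and>
     (\<Oplus>\<^bsub>\<AA>\<^esub>i\<in>UNIV. t i \<otimes>\<^bsub>\<AA>\<^esub> star \<AA> (t i)) = \<one>\<^bsub>\<AA>\<^esub>"


section \<open>The free unital *-algebra\<close>

text \<open>Complex polynomials in the non-commuting variables \<open>s\<^sub>i\<close> and \<open>s\<^sub>i\<^sup>*\<close>, as the monoid algebra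
  over \<open>\<complex>\<close> of the free monoid on these letters; the monoid is written additively because
  multiplication in \<^typ>\<open>'a \<Rightarrow>\<^sub>0 'b\<close> is convolution along \<open>+\<close>.\<close>

datatype 'n letter = Gen 'n | Adj 'n

datatype 'n monomial = Monomial (letters: "'n letter list")

instantiation monomial :: (type) monoid_add
begin
definition "0 = Monomial []"
definition "v + w = Monomial (letters v @ letters w)"
instance
  by standard (simp_all add: zero_monomial_def plus_monomial_def)
end

type_synonym 'n free_alg = "'n monomial \<Rightarrow>\<^sub>0 complex"

fun letter_star :: "'n letter \<Rightarrow> 'n letter" where
  "letter_star (Gen i) = Adj i"
| "letter_star (Adj i) = Gen i"

definition monomial_star :: "'n monomial \<Rightarrow> 'n monomial" where
  "monomial_star w = Monomial (rev (map letter_star (letters w)))"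

definition free_star :: "'n free_alg \<Rightarrow> 'n free_alg" where
  "free_star a = Poly_Mapping.map_key monomial_star (Poly_Mapping.map cnj a)"

definition free_scale :: "complex \<Rightarrow> 'n free_alg \<Rightarrow> 'n free_alg" where
  "free_scale c a = Poly_Mapping.single 0 c * a"

definition free_gen :: "'n \<Rightarrow> 'n free_alg" where
  "free_gen i = Poly_Mapping.single (Monomial [Gen i]) 1"


section \<open>The Cuntz--Krieger algebra\<close>

text \<open>The Cuntz--Krieger algebra is constructed in the standard way as the enveloping C*-algebra
  of the generators and relations: \<open>ck_norm\<close> is the largest C*-seminorm on the free *-algebra
  that vanishes on the relators, and the algebra is the (Hausdorff) completion, realised as
  Cauchy sequences modulo null sequences.\<close>

definition ck_relators :: "int ^ 'n ^ 'n \<Rightarrow> 'n free_alg set" where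
  "ck_relators A =
     {free_gen i * free_star (free_gen i) * free_gen i - free_gen i | i. True} \<union>
     {free_star (free_gen i) * free_gen j | i j. i \<noteq> j} \<union>
     {free_star (free_gen i) * free_gen i -
        (\<Sum>j\<in>UNIV. free_scale (of_int (A $ i $ j)) (free_gen j * free_star (free_gen j))) | i. True} \<union>
     {(\<Sum>i\<in>UNIV. free_gen i * free_star (free_gen i)) - 1}"

definition cstar_seminorm :: "('n free_alg \<Rightarrow> real) \<Rightarrow> bool" where
  "cstar_seminorm p \<longleftrightarrow>
     (\<forall>a b. p (a + b) \<le> p a + p b) \<and>
     (\<forall>c a. p (free_scale c a) = cmod c * p a) \<and>
     (\<forall>a b. p (a * b) \<le> p a * p b) \<and>
     (\<forall>a. p (free_star a * a) = (p a)\<^sup>2)"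

definition ck_seminorms :: "int ^ 'n ^ 'n \<Rightarrow> ('n free_alg \<Rightarrow> real) set" where
  "ck_seminorms A = {p. cstar_seminorm p \<and> (\<forall>a\<in>ck_relators A. p a = 0)}"

definition ck_norm :: "int ^ 'n ^ 'n \<Rightarrow> 'n free_alg \<Rightarrow> real" where
  "ck_norm A a = (SUP p\<in>ck_seminorms A. p a)"

definition ck_cauchy :: "int ^ 'n ^ 'n \<Rightarrow> (nat \<Rightarrow> 'n free_alg) set" where
  "ck_cauchy A = {u. \<forall>e>0. \<exists>M. \<forall>m\<ge>M. \<forall>n\<ge>M. ck_norm A (u m - u n) < e}"

definition ck_rel :: "int ^ 'n ^ 'n \<Rightarrow> ((nat \<Rightarrow> 'n free_alg) \<times> (nat \<Rightarrow> 'n free_alg)) set" where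
  "ck_rel A = {(u, v). u \<in> ck_cauchy A \<and> v \<in> ck_cauchy A \<and>
     (\<lambda>n. ck_norm A (u n - v n)) \<longlonglongrightarrow> 0}"

definition ck_class :: "int ^ 'n ^ 'n \<Rightarrow> (nat \<Rightarrow> 'n free_alg) \<Rightarrow> (nat \<Rightarrow> 'n free_alg) set" where
  "ck_class A u = ck_rel A `` {u}"

definition ck_rep :: "(nat \<Rightarrow> 'n free_alg) set \<Rightarrow> nat \<Rightarrow> 'n free_alg" where
  "ck_rep X = (SOME u. u \<in> X)"

definition CK_algebra :: "int ^ 'n ^ 'n \<Rightarrow> (nat \<Rightarrow> 'n free_alg) set cstar" where
  "CK_algebra A = \<lparr>
     carrier = ck_cauchy A // ck_rel A,
     mult = (\<lambda>X Y. ck_class A (\<lambda>n. ck_rep X n * ck_rep Y n)),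
     one = ck_class A (\<lambda>_. 1),
     zero = ck_class A (\<lambda>_. 0),
     add = (\<lambda>X Y. ck_class A (\<lambda>n. ck_rep X n + ck_rep Y n)),
     smult = (\<lambda>c X. ck_class A (\<lambda>n. free_scale c (ck_rep X n))),
     star = (\<lambda>X. ck_class A (\<lambda>n. free_star (ck_rep X n))),
     nrm = (\<lambda>X. lim (\<lambda>n. ck_norm A (ck_rep X n)))\<rparr>"

definition ck_gen :: "int ^ 'n ^ 'n \<Rightarrow> 'n \<Rightarrow> (nat \<Rightarrow> 'n free_alg) set" where
  "ck_gen A i = ck_class A (\<lambda>_. free_gen i)"

definition ck_word :: "int ^ 'n ^ 'n \<Rightarrow> 'n list \<Rightarrow> (nat \<Rightarrow> 'n free_alg) set" where
  "ck_word A \<alpha> = foldr (\<lambda>i x. ck_gen A i \<otimes>\<^bsub>CK_algebra A\<^esub> x) \<alpha> \<one>\<^bsub>CK_algebra A\<^esub>"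

definition CK_diagonal :: "int ^ 'n ^ 'n \<Rightarrow> (nat \<Rightarrow> 'n free_alg) set set" where
  "CK_diagonal A = cstar_generated (CK_algebra A)
     {ck_word A \<alpha> \<otimes>\<^bsub>CK_algebra A\<^esub> star (CK_algebra A) (ck_word A \<alpha>) | \<alpha>. admissible_word A \<alpha>}"

definition ck_sum :: "int ^ 'n ^ 'n \<Rightarrow> (nat \<Rightarrow> 'n free_alg) set" where
  "ck_sum A = (\<Oplus>\<^bsub>CK_algebra A\<^esub>i\<in>UNIV. ck_gen A i)"

definition CK_tau ::
  "int ^ 'n ^ 'n \<Rightarrow> (nat \<Rightarrow> 'n free_alg) set \<Rightarrow> (nat \<Rightarrow> 'n free_alg) set" where
  "CK_tau A y = ck_sum A \<otimes>\<^bsub>CK_algebra A\<^esub> y \<otimes>\<^bsub>CK_algebra A\<^esub> star (CK_algebra A) (ck_sum A)"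


section \<open>The sets \<open>Zset\<close> form a basis of the groupoid topology\<close>

lemma shift_funpow: "(shift ^^ k) x = (\<lambda>n. x (n + k))"
  by (induction k) (simp_all add: shift_def)

definition cylinder :: "int ^ 'n ^ 'n \<Rightarrow> (nat \<Rightarrow> 'n) \<Rightarrow> nat \<Rightarrow> (nat \<Rightarrow> 'n) set" where
  "cylinder A x m = {z \<in> shift_space A. \<forall>i<m. z i = x i}"

lemma openin_cylinder: "openin (shift_topology A) (cylinder A x m)"
proof -
  let ?X = "\<lambda>i. if i < m then {x i} else UNIV"
  have "openin (product_topology (\<lambda>_. discrete_topology UNIV) UNIV) (PiE UNIV ?X)"
    by (rule product_topology_basis) (auto intro: finite_subset[of _ "{..<m}"])
  moreover have "cylinder A x m = PiE UNIV ?X \<inter> shift_space A"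
    by (auto simp: cylinder_def PiE_iff split: if_splits)
  ultimately show ?thesis unfolding shift_topology_def openin_subtopology by blast
qed

lemma open_contains_cylinder:
  assumes "openin (shift_topology A) U" "x \<in> U"
  shows "\<exists>m. \<forall>m'\<ge>m. cylinder A x m' \<subseteq> U"
proof -
  obtain T where T: "openin (product_topology (\<lambda>_. discrete_topology UNIV) UNIV) T"
    "U = T \<inter> shift_space A"
    using assms(1) unfolding shift_topology_def openin_subtopology by blast
  then obtain X where X: "x \<in> PiE UNIV X" "finite {i. X i \<noteq> UNIV}" "PiE UNIV X \<subseteq> T"
    using product_topology_open_contains_basis[OF T(1), of x] assms(2) by auto
  obtain m where m: "\<And>i. X i \<noteq> UNIV \<Longrightarrow> i < m"
    using finite_nat_set_iff_bounded X(2) by auto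
  have "z \<in> U" if z: "z \<in> cylinder A x m'" "m' \<ge> m" for z m'
  proof -
    have "z i \<in> X i" for i
    proof (cases "X i = UNIV")
      case False
      then have "z i = x i" using m[of i] z by (simp add: cylinder_def)
      then show ?thesis using X(1) by (simp add: PiE_iff)
    qed simp
    then show ?thesis using X(3) T(2) z by (auto simp: cylinder_def PiE_iff)
  qed
  then show ?thesis by blast
qed

lemma cylinder_image:
  assumes "x \<in> shift_space A"
  shows "(shift ^^ k) ` cylinder A x (Suc k) = {z \<in> shift_space A. z 0 = x k}"
proof
  show "(shift ^^ k) ` cylinder A x (Suc k) \<subseteq> {z \<in> shift_space A. z 0 = x k}"
    by (auto simp: shift_funpow cylinder_def shift_space_def)
  show "{z \<in> shift_space A. z 0 = x k} \<subseteq> (shift ^^ k) ` cylinder A x (Suc k)"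
  proof
    fix z assume z: "z \<in> {z \<in> shift_space A. z 0 = x k}"
    define w where "w i = (if i < k then x i else z (i - k))" for i
    have "A $ w n $ w (Suc n) = 1" for n
    proof -
      consider "Suc n < k" | "Suc n = k" | "k \<le> n" by linarith
      then show ?thesis
      proof cases
        case 1 then show ?thesis using assms by (simp add: w_def shift_space_def)
      next
        case 2
        then have "w n = x n" "w (Suc n) = x (Suc n)" using z by (auto simp: w_def)
        then show ?thesis using assms by (simp add: shift_space_def)
      next
        case 3 then show ?thesis using z by (simp add: w_def shift_space_def Suc_diff_le)
      qed
    qed
    moreover have "w i = x i" if "i < Suc k" for i
      using that z by (cases "i = k") (auto simp: w_def)
    ultimately have "w \<in> cylinder A x (Suc k)" by (simp add: cylinder_def shift_space_def)
    moreover have "z = (shift ^^ k) w" by (simp add: shift_funpow w_def fun_eq_iff)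
    ultimately show "z \<in> (shift ^^ k) ` cylinder A x (Suc k)" by blast
  qed
qed

lemma inj_on_cylinder: "inj_on (shift ^^ k) (cylinder A x (Suc k))"
proof (rule inj_onI, rule ext)
  fix z w i
  assume "z \<in> cylinder A x (Suc k)" "w \<in> cylinder A x (Suc k)" "(shift ^^ k) z = (shift ^^ k) w"
  then show "z i = w i"
    by (cases "i < k") (auto simp: cylinder_def shift_funpow fun_eq_iff dest: spec[of _ "i - k"])
qed

definition Zcyl where
  "Zcyl A x k l y = Zset A (cylinder A x (Suc k)) k l (cylinder A y (Suc l))"

lemma Zcyl_in_Zbasis:
  assumes "x \<in> shift_space A" "y \<in> shift_space A" "(shift ^^ k) x = (shift ^^ l) y"
  shows "Zcyl A x k l y \<in> Zbasis A"
proof -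
  have "x k = y l" using assms(3) by (auto simp: shift_funpow fun_eq_iff dest: spec[of _ 0])
  then have "(shift ^^ k) ` cylinder A x (Suc k) = (shift ^^ l) ` cylinder A y (Suc l)"
    by (simp add: cylinder_image assms)
  then show ?thesis
    unfolding Zbasis_def Zcyl_def using openin_cylinder inj_on_cylinder by blast
qed

lemma Zset_contains_Zcyl:
  assumes "openin (shift_topology A) U" "openin (shift_topology A) V" "(x, n, y) \<in> Zset A U k l V"
  shows "\<exists>K. \<forall>k'\<ge>K. \<forall>l'. int k' - int l' = n \<longrightarrow> Zcyl A x k' l' y \<subseteq> Zset A U k l V"
proof -
  have g: "x \<in> U" "y \<in> V" "n = int k - int l" "(shift ^^ k) x = (shift ^^ l) y"
    using assms(3) by (auto simp: Zset_def)
  obtain m m' where m: "\<And>j. j \<ge> m \<Longrightarrow> cylinder A x j \<subseteq> U" "\<And>j. j \<ge> m' \<Longrightarrow> cylinder A y j \<subseteq> V"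
    using open_contains_cylinder[OF assms(1) g(1)] open_contains_cylinder[OF assms(2) g(2)] by blast
  have "Zcyl A x k' l' y \<subseteq> Zset A U k l V"
    if k': "k' \<ge> k + m + m'" "int k' - int l' = n" for k' l'
  proof
    fix g' assume g': "g' \<in> Zcyl A x k' l' y"
    obtain a b where ab: "g' = (a, n, b)" "g' \<in> shift_arrows A" "a \<in> cylinder A x (Suc k')"
      "b \<in> cylinder A y (Suc l')" "(shift ^^ k') a = (shift ^^ l') b"
      using g' k' by (auto simp: Zcyl_def Zset_def)
    have l': "l' = l + (k' - k)" using k' g(3) by linarith
    have "m \<le> Suc k'" "m' \<le> Suc l'" using k'(1) l' by linarith+
    then have "a \<in> U" "b \<in> V" using ab(3,4) m by blast+
    moreover have "a (i + k) = b (i + l)" for i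
    proof (cases "i + k < k'")
      case True
      then have "a (i + k) = x (i + k)" "b (i + l) = y (i + l)"
        using ab l' by (simp_all add: cylinder_def)
      then show ?thesis using g(4) by (simp add: shift_funpow fun_eq_iff)
    next
      case False
      then have "i + k = (i + k - k') + k'" "i + l = (i + k - k') + l'" using l' k' by simp_all
      then show ?thesis using ab(5) by (metis shift_funpow)
    qed
    ultimately show "g' \<in> Zset A U k l V"
      using ab g(3) by (simp add: Zset_def shift_funpow)
  qed
  then show ?thesis by blast
qed

lemma openin_shift_groupoid:
  "openin (gtop (shift_groupoid A)) W \<longleftrightarrow> (\<forall>g\<in>W. \<exists>Z\<in>Zbasis A. g \<in> Z \<and> Z \<subseteq> W)"
proof
  assume W: "\<forall>g\<in>W. \<exists>Z\<in>Zbasis A. g \<in> Z \<and> Z \<subseteq> W"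
  have "openin (topology_generated_by (Zbasis A)) (\<Union>{Z \<in> Zbasis A. Z \<subseteq> W})"
    by (rule openin_Union) (auto intro: topology_generated_by_Basis)
  moreover have "\<Union>{Z \<in> Zbasis A. Z \<subseteq> W} = W" using W by blast
  ultimately show "openin (gtop (shift_groupoid A)) W" by (simp add: shift_groupoid_def)
next
  let ?P = "\<lambda>W x n y. x \<in> shift_space A \<and> y \<in> shift_space A \<and> (x, n, y) \<in> shift_arrows A \<and>
    (\<exists>K. \<forall>k\<ge>K. \<forall>l. int k - int l = n \<longrightarrow> Zcyl A x k l y \<subseteq> W)"
  assume "openin (gtop (shift_groupoid A)) W"
  then have "generate_topology_on (Zbasis A) W"
    by (simp add: shift_groupoid_def openin_topology_generated_by_iff)
  then have P: "\<forall>x n y. (x, n, y) \<in> W \<longrightarrow> ?P W x n y"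
  proof (induction rule: generate_topology_on.induct)
    case Empty show ?case by simp
  next
    case (Int a b)
    show ?case
    proof (intro allI impI)
      fix x n y assume "(x, n, y) \<in> a \<inter> b"
      then have "?P a x n y" "?P b x n y" using Int by blast+
      then obtain K K' where
        K: "\<And>k l. k \<ge> K \<Longrightarrow> int k - int l = n \<Longrightarrow> Zcyl A x k l y \<subseteq> a"
          "\<And>k l. k \<ge> K' \<Longrightarrow> int k - int l = n \<Longrightarrow> Zcyl A x k l y \<subseteq> b" by blast
      have "\<forall>k\<ge>max K K'. \<forall>l. int k - int l = n \<longrightarrow> Zcyl A x k l y \<subseteq> a \<inter> b"
        using K by simp
      with \<open>?P a x n y\<close> show "?P (a \<inter> b) x n y" by blast
    qed
  next
    case (UN K)
    show ?case
    proof (intro allI impI)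
      fix x n y assume "(x, n, y) \<in> \<Union>K"
      then obtain k where "k \<in> K" "(x, n, y) \<in> k" by blast
      with UN have "?P k x n y" by blast
      with \<open>k \<in> K\<close> show "?P (\<Union>K) x n y" by blast
    qed
  next
    case (Basis s)
    then obtain U k l V where s: "s = Zset A U k l V" "openin (shift_topology A) U" "openin (shift_topology A) V"
      by (auto simp: Zbasis_def)
    show ?case
    proof (intro allI impI)
      fix x n y assume g: "(x, n, y) \<in> s"
      then have "(x, n, y) \<in> shift_arrows A" by (auto simp: s Zset_def)
      moreover from this have "x \<in> shift_space A" "y \<in> shift_space A" by (auto simp: shift_arrows_def)
      ultimately show "?P s x n y" using Zset_contains_Zcyl[OF s(2,3), of x n y k l] g s(1) by simp
    qed
  qed
  show "\<forall>g\<in>W. \<exists>Z\<in>Zbasis A. g \<in> Z \<and> Z \<subseteq> W"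
  proof
    fix g assume gW: "g \<in> W"
    obtain x n y where g: "g = (x, n, y)" by (cases g)
    then have Pg: "?P W x n y" using P gW by blast
    then obtain K where K: "\<And>k l. k \<ge> K \<Longrightarrow> int k - int l = n \<Longrightarrow> Zcyl A x k l y \<subseteq> W" by blast
    obtain k l where kl: "n = int k - int l" "(shift ^^ k) x = (shift ^^ l) y"
      using Pg by (auto simp: shift_arrows_def)
    have e: "(shift ^^ (k + K)) x = (shift ^^ (l + K)) y"
    proof
      fix i
      have "x ((i + K) + k) = y ((i + K) + l)" using kl(2) by (simp add: shift_funpow fun_eq_iff del: add.assoc)
      then show "(shift ^^ (k + K)) x i = (shift ^^ (l + K)) y i" by (simp add: shift_funpow add_ac)
    qed
    show "\<exists>Z\<in>Zbasis A. g \<in> Z \<and> Z \<subseteq> W"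
    proof (intro bexI conjI)
      show "Zcyl A x (k + K) (l + K) y \<in> Zbasis A" using Pg e by (intro Zcyl_in_Zbasis) auto
      show "Zcyl A x (k + K) (l + K) y \<subseteq> W" using kl by (intro K) auto
      show "g \<in> Zcyl A x (k + K) (l + K) y"
        using Pg e kl by (simp add: g Zcyl_def Zset_def cylinder_def)
    qed
  qed
qed

lemma topspace_shift_groupoid: "topspace (gtop (shift_groupoid A)) = arrows (shift_groupoid A)"
proof
  show "topspace (gtop (shift_groupoid A)) \<subseteq> arrows (shift_groupoid A)"
    by (auto simp: shift_groupoid_def Zbasis_def Zset_def)
  have "\<exists>Z\<in>Zbasis A. g \<in> Z" if "g \<in> shift_arrows A" for g
  proof -
    obtain x k l y where g: "g = (x, int k - int l, y)" "x \<in> shift_space A" "y \<in> shift_space A"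
      "(shift ^^ k) x = (shift ^^ l) y"
      using \<open>g \<in> shift_arrows A\<close> by (auto simp: shift_arrows_def)
    have "g \<in> Zcyl A x k l y" using g that by (simp add: Zcyl_def Zset_def cylinder_def)
    with g show ?thesis using Zcyl_in_Zbasis by blast
  qed
  then show "arrows (shift_groupoid A) \<subseteq> topspace (gtop (shift_groupoid A))"
    by (auto simp: shift_groupoid_def)
qed


section \<open>The enveloping seminorm\<close>

lemma monomial_star_invol [simp]: "monomial_star (monomial_star w) = w"
proof -
  have "letter_star (letter_star l) = l" for l :: "'a letter" by (cases l) auto
  then show ?thesis by (simp add: monomial_star_def rev_map comp_def)
qed

lemma inj_monomial_star: "inj monomial_star"
  by (metis injI monomial_star_invol)

lemma lookup_free_star [simp]: "Poly_Mapping.lookup (free_star a) w = cnj (Poly_Mapping.lookup a (monomial_star w))"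
  by (simp add: free_star_def Poly_Mapping.map_key.rep_eq[OF inj_monomial_star] Poly_Mapping.map.rep_eq when_def)

lemma monomial_star_add: "monomial_star (v + w) = monomial_star w + monomial_star v"
  by (simp add: monomial_star_def plus_monomial_def)

lemma monomial_star_0 [simp]: "monomial_star 0 = 0"
  by (simp add: monomial_star_def zero_monomial_def)

lemma free_star_single: "free_star (Poly_Mapping.single w c) = Poly_Mapping.single (monomial_star w) (cnj c)"
  by (rule poly_mapping_eqI) (auto simp: lookup_single when_def)

lemma free_star_add: "free_star (a + b) = free_star a + free_star b"
  by (rule poly_mapping_eqI) (simp add: lookup_add)

lemma free_star_uminus: "free_star (- a) = - free_star a"
  by (rule poly_mapping_eqI) simp

lemma free_star_diff: "free_star (a - b) = free_star a - free_star b"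
  by (rule poly_mapping_eqI) (simp add: lookup_minus)

lemma free_star_0 [simp]: "free_star 0 = 0"
  by (rule poly_mapping_eqI) simp

lemma free_star_1 [simp]: "free_star 1 = 1"
  using free_star_single[of 0 1] by simp

lemma free_star_star [simp]: "free_star (free_star a) = a"
  by (rule poly_mapping_eqI) simp

lemma poly_mapping_add_induct [case_names zero single add]:
  fixes a :: "'k \<Rightarrow>\<^sub>0 'c::comm_monoid_add"
  assumes "P 0" "\<And>w c. P (Poly_Mapping.single w c)" "\<And>a b. P a \<Longrightarrow> P b \<Longrightarrow> P (a + b)"
  shows "P a"
proof -
  have "P (\<Sum>w\<in>S. Poly_Mapping.single w (Poly_Mapping.lookup a w))" for S
    by (induction S rule: infinite_finite_induct) (auto simp: assms)
  moreover have "(\<Sum>w\<in>Poly_Mapping.keys a. Poly_Mapping.single w (Poly_Mapping.lookup a w)) = a"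
    by (rule poly_mapping_eqI) (auto simp: lookup_sum lookup_single when_def in_keys_iff)
  ultimately show ?thesis by metis
qed

lemma free_star_mult: "free_star (a * b) = free_star b * free_star a"
proof (induction a rule: poly_mapping_add_induct)
  case zero show ?case by simp
next
  case (add x y) then show ?case by (simp add: free_star_add algebra_simps)
next
  case (single w c)
  show ?case
  proof (induction b rule: poly_mapping_add_induct)
    case zero show ?case by simp
  next
    case (add x y) then show ?case by (simp add: free_star_add algebra_simps)
  next
    case (single v d) show ?case
      by (simp add: mult_single free_star_single monomial_star_add mult.commute)
  qed
qed

lemma single0_comm: "Poly_Mapping.single 0 c * a = a * Poly_Mapping.single (0::'n monomial) (c::complex)"
  by (induction a rule: poly_mapping_add_induct) (simp_all add: mult_single algebra_simps)

lemma free_scale_mult_left: "free_scale c a * b = free_scale c (a * b)"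
  by (simp add: free_scale_def mult.assoc)

lemma free_scale_mult_right: "a * free_scale c b = free_scale c (a * b)"
  by (simp add: free_scale_def single0_comm mult.assoc)

lemma free_scale_add: "free_scale c (a + b) = free_scale c a + free_scale c b"
  by (simp add: free_scale_def algebra_simps)

lemma free_scale_diff: "free_scale c (a - b) = free_scale c a - free_scale c b"
  by (simp add: free_scale_def algebra_simps)

lemma free_scale_add_left: "free_scale (c + d) a = free_scale c a + free_scale d a"
  by (simp add: free_scale_def algebra_simps single_add)

lemma free_scale_scale: "free_scale c (free_scale d a) = free_scale (c * d) a"
  by (simp add: free_scale_def mult.assoc[symmetric] mult_single)

lemma free_scale_1 [simp]: "free_scale 1 a = a"
  by (simp add: free_scale_def)

lemma free_scale_0 [simp]: "free_scale 0 a = 0"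
  by (simp add: free_scale_def)

lemma free_scale_minus1: "free_scale (- 1) a = - a"
  using free_scale_add_left[of "-1" 1 a] by (simp add: eq_neg_iff_add_eq_0)

lemma free_star_scale: "free_star (free_scale c a) = free_scale (cnj c) (free_star a)"
  by (simp add: free_scale_def free_star_mult free_star_single single0_comm)

lemma free_scale_single: "free_scale c (Poly_Mapping.single w d) = Poly_Mapping.single w (c * d)"
  by (simp add: free_scale_def mult_single)

context
  fixes p :: "'n free_alg \<Rightarrow> real"
  assumes p: "cstar_seminorm p"
begin

lemma seminorm_add: "p (a + b) \<le> p a + p b"
  and seminorm_scale: "p (free_scale c a) = cmod c * p a"
  and seminorm_mult: "p (a * b) \<le> p a * p b"
  and seminorm_cstar: "p (free_star a * a) = (p a)\<^sup>2"
  using p by (auto simp: cstar_seminorm_def)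

lemma seminorm_0 [simp]: "p 0 = 0"
  using seminorm_scale[of 0 0] by simp

lemma seminorm_uminus [simp]: "p (- a) = p a"
  using seminorm_scale[of "-1" a] by (simp add: free_scale_minus1)

lemma seminorm_nonneg: "0 \<le> p a"
  using seminorm_add[of a "- a"] by simp

lemma seminorm_diff: "p (a - b) \<le> p a + p b"
  using seminorm_add[of a "- b"] by simp

lemma seminorm_minus_commute: "p (a - b) = p (b - a)"
  using seminorm_uminus[of "a - b"] by simp

lemma seminorm_triangle: "p (a - c) \<le> p (a - b) + p (b - c)"
  using seminorm_add[of "a - b" "b - c"] by simp

lemma seminorm_abs_diff: "\<bar>p a - p b\<bar> \<le> p (a - b)"
  using seminorm_add[of "a - b" b] seminorm_add[of "b - a" a] seminorm_minus_commute[of a b] by simp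

lemma seminorm_star: "p (free_star a) = p a"
proof -
  have *: "p a \<le> p (free_star a)" for a
  proof (cases "p a = 0")
    case False
    have "p a * p a \<le> p (free_star a) * p a"
      using seminorm_cstar[of a] seminorm_mult[of "free_star a" a] by (simp add: power2_eq_square)
    with False seminorm_nonneg[of a] show ?thesis by auto
  qed (simp add: seminorm_nonneg)
  from *[of a] *[of "free_star a"] show ?thesis by simp
qed

lemma seminorm_1_le: "p 1 \<le> 1"
proof -
  have "p 1 = p 1 * p 1" using seminorm_cstar[of 1] by (simp add: power2_eq_square)
  then show ?thesis by (metis mult_cancel_left1 order_refl zero_le_one)
qed

end

lemma zero_in_ck_seminorms: "(\<lambda>_. 0) \<in> ck_seminorms A"
  by (simp add: ck_seminorms_def cstar_seminorm_def)

lemma ck_seminorms_cstar: "p \<in> ck_seminorms A \<Longrightarrow> cstar_seminorm p"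
  by (simp add: ck_seminorms_def)

lemma ck_relatorsI:
  "free_gen i * free_star (free_gen i) * free_gen i - free_gen i \<in> ck_relators A"
  "i \<noteq> j \<Longrightarrow> free_star (free_gen i) * free_gen j \<in> ck_relators A"
  "free_star (free_gen i) * free_gen i -
     (\<Sum>j\<in>UNIV. free_scale (of_int (A $ i $ j)) (free_gen j * free_star (free_gen j))) \<in> ck_relators A"
  "(\<Sum>i\<in>UNIV. free_gen i * free_star (free_gen i)) - 1 \<in> ck_relators A"
  unfolding ck_relators_def by (simp_all only: Un_iff mem_Collect_eq insert_iff) fast+

lemma ck_seminorm_gen_le:
  assumes "p \<in> ck_seminorms A" shows "p (free_gen i) \<le> 1"
proof -
  note p = ck_seminorms_cstar[OF assms]
  let ?s = "free_gen i" and ?t = "free_star (free_gen i)"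
  have r: "p (?s * ?t * ?s - ?s) = 0"
    using assms ck_relatorsI(1)[of i A] by (simp add: ck_seminorms_def)
  have "p ((?t * ?s) * (?t * ?s) - ?t * ?s) \<le> p ?t * p (?s * ?t * ?s - ?s)"
    using seminorm_mult[OF p, of ?t "?s * ?t * ?s - ?s"] by (simp add: algebra_simps)
  with r have "p ((?t * ?s) * (?t * ?s) - ?t * ?s) = 0"
    using seminorm_nonneg[OF p] by (metis mult_zero_right order_antisym)
  then have "p ((?t * ?s) * (?t * ?s)) = p (?t * ?s)"
    using seminorm_abs_diff[OF p, of "(?t * ?s) * (?t * ?s)" "?t * ?s"] by simp
  moreover have "p ((?t * ?s) * (?t * ?s)) = (p (?t * ?s))\<^sup>2"
    using seminorm_cstar[OF p, of "?t * ?s"] by (simp add: free_star_mult)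
  ultimately have "(p (?t * ?s))\<^sup>2 = p (?t * ?s)" by simp
  then have "p (?t * ?s) \<le> 1"
    by (metis mult_cancel_left1 order_refl power2_eq_square zero_le_one)
  then have "(p ?s)\<^sup>2 \<le> 1" using seminorm_cstar[OF p, of ?s] by simp
  then show ?thesis by (simp add: power2_le_iff_abs_le abs_le_square_iff power_le_one_iff seminorm_nonneg[OF p])
qed

lemma ck_seminorm_monomial_le:
  assumes "p \<in> ck_seminorms A" shows "p (Poly_Mapping.single w 1) \<le> 1"
proof -
  note p = ck_seminorms_cstar[OF assms]
  have l: "p (Poly_Mapping.single (Monomial [l]) 1) \<le> 1" for l
  proof (cases l)
    case (Gen i) then show ?thesis using ck_seminorm_gen_le[OF assms] by (simp add: free_gen_def)
  next
    case (Adj i)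
    then have "Poly_Mapping.single (Monomial [l]) 1 = free_star (free_gen i)"
      by (simp add: free_gen_def free_star_single monomial_star_def)
    then show ?thesis using ck_seminorm_gen_le[OF assms] by (simp add: seminorm_star[OF p])
  qed
  have "p (Poly_Mapping.single (Monomial ls) 1) \<le> 1" for ls
  proof (induction ls)
    case Nil then show ?case using seminorm_1_le[OF p] by (simp flip: zero_monomial_def)
  next
    case (Cons l ls)
    have "Poly_Mapping.single (Monomial (l # ls)) 1 =
        Poly_Mapping.single (Monomial [l]) 1 * (Poly_Mapping.single (Monomial ls) (1::complex))"
      by (simp add: mult_single plus_monomial_def)
    then have "p (Poly_Mapping.single (Monomial (l # ls)) 1) \<le>
        p (Poly_Mapping.single (Monomial [l]) 1) * p (Poly_Mapping.single (Monomial ls) 1)"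
      using seminorm_mult[OF p] by metis
    also have "\<dots> \<le> 1" using Cons l seminorm_nonneg[OF p] by (simp add: mult_le_one)
    finally show ?case .
  qed
  then show ?thesis by (cases w) simp
qed

lemma ck_seminorms_bounded: "\<exists>K. \<forall>p\<in>ck_seminorms A. p a \<le> K"
proof (induction a rule: poly_mapping_add_induct)
  case zero
  then show ?case using seminorm_0 ck_seminorms_cstar by (metis order_refl)
next
  case (single w c)
  have "p (Poly_Mapping.single w c) \<le> cmod c" if "p \<in> ck_seminorms A" for p
    using seminorm_scale[OF ck_seminorms_cstar[OF that], of c "Poly_Mapping.single w 1"]
      ck_seminorm_monomial_le[OF that, of w]
    by (simp add: free_scale_single mult_left_le)
  then show ?case by blast
next
  case (add a b)
  then obtain K L where "\<forall>p\<in>ck_seminorms A. p a \<le> K" "\<forall>p\<in>ck_seminorms A. p b \<le> L" by blast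
  then have "\<forall>p\<in>ck_seminorms A. p (a + b) \<le> K + L"
    by (meson seminorm_add[OF ck_seminorms_cstar] add_mono order_trans)
  then show ?case by blast
qed

lemma ck_norm_upper: "p \<in> ck_seminorms A \<Longrightarrow> p a \<le> ck_norm A a"
proof -
  assume p: "p \<in> ck_seminorms A"
  obtain K where "\<And>q. q \<in> ck_seminorms A \<Longrightarrow> q a \<le> K"
    using ck_seminorms_bounded by blast
  then have "bdd_above ((\<lambda>q. q a) ` ck_seminorms A)"
    by (rule bdd_aboveI2)
  with p show ?thesis unfolding ck_norm_def by (rule cSUP_upper)
qed

lemma ck_norm_least: "(\<And>p. p \<in> ck_seminorms A \<Longrightarrow> p a \<le> K) \<Longrightarrow> ck_norm A a \<le> K"
proof -
  assume "\<And>p. p \<in> ck_seminorms A \<Longrightarrow> p a \<le> K"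
  moreover have "ck_seminorms A \<noteq> {}" using zero_in_ck_seminorms by blast
  ultimately show ?thesis unfolding ck_norm_def by (intro cSUP_least)
qed

lemma ck_norm_ge0: "0 \<le> ck_norm A a"
  using ck_norm_upper[OF zero_in_ck_seminorms] .

lemma ck_norm_cstar: "cstar_seminorm (ck_norm A)"
  unfolding cstar_seminorm_def
proof (intro conjI allI)
  note c = ck_seminorms_cstar
  fix a b :: "'a free_alg" and k :: complex
  show "ck_norm A (a + b) \<le> ck_norm A a + ck_norm A b"
  proof (rule ck_norm_least)
    fix p assume p: "p \<in> ck_seminorms A"
    show "p (a + b) \<le> ck_norm A a + ck_norm A b"
      using seminorm_add[OF c[OF p], of a b] ck_norm_upper[OF p, of a] ck_norm_upper[OF p, of b]
      by linarith
  qed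
  show "ck_norm A (a * b) \<le> ck_norm A a * ck_norm A b"
  proof (rule ck_norm_least)
    fix p assume p: "p \<in> ck_seminorms A"
    have "p (a * b) \<le> p a * p b" by (rule seminorm_mult[OF c[OF p]])
    also have "\<dots> \<le> ck_norm A a * ck_norm A b"
      by (intro mult_mono ck_norm_upper p ck_norm_ge0 seminorm_nonneg[OF c[OF p]])
    finally show "p (a * b) \<le> ck_norm A a * ck_norm A b" .
  qed
  have le: "ck_norm A (free_scale k a) \<le> cmod k * ck_norm A a" for k a
    by (rule ck_norm_least) (simp add: seminorm_scale[OF c] ck_norm_upper mult_left_mono)
  show "ck_norm A (free_scale k a) = cmod k * ck_norm A a"
  proof (cases "k = 0")
    case True then show ?thesis
      using le[of k a] ck_norm_ge0[of A "free_scale k a"] by simp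
  next
    case False
    have "cmod k * ck_norm A a \<le> cmod k * (cmod (inverse k) * ck_norm A (free_scale k a))"
      using le[of "inverse k" "free_scale k a"] False
      by (intro mult_left_mono) (auto simp: free_scale_scale)
    also have "\<dots> = ck_norm A (free_scale k a)"
      using False by (simp add: norm_inverse)
    finally show ?thesis using le[of k a] by simp
  qed
  show "ck_norm A (free_star a * a) = (ck_norm A a)\<^sup>2"
  proof (rule antisym)
    show "ck_norm A (free_star a * a) \<le> (ck_norm A a)\<^sup>2"
      by (rule ck_norm_least)
        (simp add: seminorm_cstar[OF c] power_mono seminorm_nonneg[OF c] ck_norm_upper)
    have "ck_norm A a \<le> sqrt (ck_norm A (free_star a * a))"
    proof (rule ck_norm_least)
      fix p assume "p \<in> ck_seminorms A"
      then show "p a \<le> sqrt (ck_norm A (free_star a * a))"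
        using ck_norm_upper[of p A "free_star a * a"] seminorm_cstar[OF c, of p A a]
        by (simp add: real_le_rsqrt)
    qed
    then show "(ck_norm A a)\<^sup>2 \<le> ck_norm A (free_star a * a)"
      using ck_norm_ge0[of A a] ck_norm_ge0[of A "free_star a * a"]
      by (metis power_mono real_sqrt_pow2)
  qed
qed

lemma ck_norm_in_seminorms: "ck_norm A \<in> ck_seminorms A"
proof -
  have "ck_norm A a = 0" if "a \<in> ck_relators A" for a
  proof (rule antisym)
    show "ck_norm A a \<le> 0"
      by (rule ck_norm_least) (use that in \<open>simp add: ck_seminorms_def\<close>)
  qed (rule ck_norm_ge0)
  then show ?thesis by (simp add: ck_seminorms_def ck_norm_cstar)
qed


section \<open>The completion is a C*-algebra\<close>

lemma tendsto_0_sandwich: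
  fixes f g :: "nat \<Rightarrow> real"
  assumes "g \<longlonglongrightarrow> 0" "\<And>n. 0 \<le> f n" "\<And>n. f n \<le> g n"
  shows "f \<longlonglongrightarrow> 0"
  by (rule tendsto_sandwich[of "\<lambda>_. 0" _ _ g]) (use assms in auto)

context
  fixes A :: "int ^ 'n ^ 'n"
begin

private abbreviation (input) "N \<equiv> ck_norm A"
private abbreviation (input) "C \<equiv> ck_cauchy A"

private lemmas N = ck_norm_cstar[of A]
private lemmas N_add = seminorm_add[OF N] and N_mult = seminorm_mult[OF N]
  and N_scale = seminorm_scale[OF N] and N_star = seminorm_star[OF N]
  and N_minus = seminorm_minus_commute[OF N] and N_tri = seminorm_triangle[OF N]
  and N_abs = seminorm_abs_diff[OF N] and N_0 = seminorm_0[OF N]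
  and N_cstar = seminorm_cstar[OF N]

lemma ck_cauchyD: "u \<in> C \<Longrightarrow> e > 0 \<Longrightarrow> \<exists>M. \<forall>m\<ge>M. \<forall>n\<ge>M. N (u m - u n) < e"
  by (simp add: ck_cauchy_def)

lemma ck_cauchy_const [simp]: "(\<lambda>_. a) \<in> C"
  by (auto simp: ck_cauchy_def N_0)

lemma ck_cauchy_dominated:
  assumes "u \<in> C" "K \<ge> 0" "\<And>m n. N (v m - v n) \<le> K * N (u m - u n)"
  shows "v \<in> C"
  unfolding ck_cauchy_def mem_Collect_eq
proof (intro allI impI)
  fix e :: real assume "e > 0"
  then obtain M where M: "\<forall>m\<ge>M. \<forall>n\<ge>M. N (u m - u n) < e / (K + 1)"
    using ck_cauchyD[OF assms(1), of "e / (K + 1)"] assms(2) by auto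
  have "N (v m - v n) < e" if "m \<ge> M" "n \<ge> M" for m n
  proof -
    have "N (u m - u n) < e / (K + 1)" using M that by blast
    then have "(K + 1) * N (u m - u n) < e"
      using assms(2) by (simp add: field_simps)
    moreover have "K * N (u m - u n) \<le> (K + 1) * N (u m - u n)"
      using ck_norm_ge0[of A "u m - u n"] by (intro mult_right_mono) auto
    ultimately show ?thesis using assms(3)[of m n] by linarith
  qed
  then show "\<exists>M. \<forall>m\<ge>M. \<forall>n\<ge>M. N (v m - v n) < e" by blast
qed

lemma ck_cauchy_add: assumes "u \<in> C" "v \<in> C" shows "(\<lambda>n. u n + v n) \<in> C"
  unfolding ck_cauchy_def mem_Collect_eq
proof (intro allI impI)
  fix e :: real assume "e > 0"
  then obtain M M' where "\<forall>m\<ge>M. \<forall>n\<ge>M. N (u m - u n) < e / 2"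
    "\<forall>m\<ge>M'. \<forall>n\<ge>M'. N (v m - v n) < e / 2"
    using ck_cauchyD[of _ "e / 2"] assms half_gt_zero by metis
  then have M: "N (u m - u n) < e / 2" "N (v m - v n) < e / 2"
    if "m \<ge> max M M'" "n \<ge> max M M'" for m n
    using that by auto
  have "N (u m + v m - (u n + v n)) < e" if "m \<ge> max M M'" "n \<ge> max M M'" for m n
    using M[OF that] N_add[of "u m - u n" "v m - v n"] by (simp add: algebra_simps)
  then show "\<exists>M. \<forall>m\<ge>M. \<forall>n\<ge>M. N (u m + v m - (u n + v n)) < e" by blast
qed

lemma ck_cauchy_bounded: assumes "u \<in> C" shows "\<exists>K>0. \<forall>n. N (u n) \<le> K"
proof -
  obtain M where M: "\<forall>m\<ge>M. \<forall>n\<ge>M. N (u m - u n) < 1"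
    using ck_cauchyD[OF assms, of 1] by auto
  define K where "K = 1 + N (u M) + (\<Sum>n<M. N (u n))"
  have S0: "0 \<le> (\<Sum>n<M. N (u n))" by (intro sum_nonneg ck_norm_ge0)
  have "N (u n) \<le> K" for n
  proof (cases "n < M")
    case True
    then have "N (u n) \<le> (\<Sum>n<M. N (u n))"
      by (intro member_le_sum) (auto simp: ck_norm_ge0)
    then show ?thesis using ck_norm_ge0[of A "u M"] by (simp add: K_def)
  next
    case False
    then have "N (u n - u M) < 1" using M by simp
    then have "N (u n) \<le> 1 + N (u M)" using N_abs[of "u n" "u M"] by linarith
    then show ?thesis using S0 by (simp add: K_def)
  qed
  moreover have "K > 0"
    using S0 ck_norm_ge0[of A "u M"] by (simp add: K_def)
  ultimately show ?thesis by blast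
qed

lemma N_mult_diff: "N (a * b - a' * b') \<le> N a * N (b - b') + N (a - a') * N b'"
proof -
  have "a * b - a' * b' = a * (b - b') + (a - a') * b'" by (simp add: algebra_simps)
  then show ?thesis using N_add[of "a * (b - b')" "(a - a') * b'"]
      N_mult[of a "b - b'"] N_mult[of "a - a'" b'] by simp
qed

lemma ck_cauchy_mult: assumes "u \<in> C" "v \<in> C" shows "(\<lambda>n. u n * v n) \<in> C"
  unfolding ck_cauchy_def mem_Collect_eq
proof (intro allI impI)
  fix e :: real assume "e > 0"
  obtain K L where K: "K > 0" "\<And>n. N (u n) \<le> K" and L: "L > 0" "\<And>n. N (v n) \<le> L"
    using ck_cauchy_bounded assms by meson
  obtain M M' where "\<forall>m\<ge>M. \<forall>n\<ge>M. N (u m - u n) < e / (2 * L)"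
    "\<forall>m\<ge>M'. \<forall>n\<ge>M'. N (v m - v n) < e / (2 * K)"
    using ck_cauchyD[OF assms(1), of "e / (2 * L)"] ck_cauchyD[OF assms(2), of "e / (2 * K)"]
      K L \<open>e > 0\<close> by auto
  then have M: "N (u m - u n) < e / (2 * L)" "N (v m - v n) < e / (2 * K)"
    if "m \<ge> max M M'" "n \<ge> max M M'" for m n
    using that by auto
  have "N (u m * v m - u n * v n) < e" if mn: "m \<ge> max M M'" "n \<ge> max M M'" for m n
  proof -
    have "N (u m * v m - u n * v n) \<le> N (u m) * N (v m - v n) + N (u m - u n) * N (v n)"
      by (rule N_mult_diff)
    also have "\<dots> \<le> K * N (v m - v n) + N (u m - u n) * L"
      by (intro add_mono mult_mono) (use K L ck_norm_ge0 in \<open>auto simp: less_imp_le\<close>)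
    also have "\<dots> < K * (e / (2 * K)) + e / (2 * L) * L"
      by (intro add_strict_mono mult_strict_left_mono mult_strict_right_mono M K L mn)
    also have "\<dots> = e" using K L by (simp add: field_simps)
    finally show ?thesis .
  qed
  then show "\<exists>M. \<forall>m\<ge>M. \<forall>n\<ge>M. N (u m * v m - u n * v n) < e" by blast
qed

lemma ck_cauchy_scale: "u \<in> C \<Longrightarrow> (\<lambda>n. free_scale c (u n)) \<in> C"
  by (erule ck_cauchy_dominated[where K = "cmod c"]) (simp_all flip: free_scale_diff add: N_scale)

lemma ck_cauchy_star: "u \<in> C \<Longrightarrow> (\<lambda>n. free_star (u n)) \<in> C"
  by (erule ck_cauchy_dominated[where K = 1]) (simp_all flip: free_star_diff add: N_star)

lemma ck_cauchy_uminus: "u \<in> C \<Longrightarrow> (\<lambda>n. - u n) \<in> C"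
  using ck_cauchy_scale[of u "-1"] by (simp add: free_scale_minus1)

lemma ck_cauchy_diff: "u \<in> C \<Longrightarrow> v \<in> C \<Longrightarrow> (\<lambda>n. u n - v n) \<in> C"
  using ck_cauchy_add[OF _ ck_cauchy_uminus, of u v] by simp

lemma ck_cauchy_norm_tendsto: assumes "u \<in> C" shows "(\<lambda>n. N (u n)) \<longlonglongrightarrow> lim (\<lambda>n. N (u n))"
proof -
  have "Cauchy (\<lambda>n. N (u n))"
  proof (rule metric_CauchyI)
    fix e :: real assume "e > 0"
    then obtain M where "\<forall>m\<ge>M. \<forall>n\<ge>M. N (u m - u n) < e" using ck_cauchyD[OF assms] by blast
    then show "\<exists>M. \<forall>m\<ge>M. \<forall>n\<ge>M. dist (N (u m)) (N (u n)) < e"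
      unfolding dist_real_def using N_abs by (meson le_less_trans)
  qed
  then show ?thesis by (simp add: Cauchy_convergent_iff convergent_LIMSEQ_iff)
qed

lemma ck_rel_iff: "(u, v) \<in> ck_rel A \<longleftrightarrow> u \<in> C \<and> v \<in> C \<and> (\<lambda>n. N (u n - v n)) \<longlonglongrightarrow> 0"
  by (simp add: ck_rel_def)

lemma equiv_ck_rel: "equiv C (ck_rel A)"
proof (rule equivI)
  show "ck_rel A \<subseteq> C \<times> C" by (auto simp: ck_rel_def)
  show "refl_on C (ck_rel A)" by (auto simp: refl_on_def ck_rel_def N_0)
  show "sym (ck_rel A)" by (auto simp: sym_def ck_rel_def N_minus)
  show "trans (ck_rel A)"
  proof (rule transI)
    fix u v w assume *: "(u, v) \<in> ck_rel A" "(v, w) \<in> ck_rel A"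
    have "(\<lambda>n. N (u n - v n) + N (v n - w n)) \<longlonglongrightarrow> 0"
      using tendsto_add[of "\<lambda>n. N (u n - v n)" 0 _ "\<lambda>n. N (v n - w n)" 0] * by (simp add: ck_rel_iff)
    then have "(\<lambda>n. N (u n - w n)) \<longlonglongrightarrow> 0"
      by (rule tendsto_0_sandwich) (simp_all add: ck_norm_ge0 N_tri)
    with * show "(u, w) \<in> ck_rel A" by (simp add: ck_rel_iff)
  qed
qed

lemma ck_class_eq_iff: "u \<in> C \<Longrightarrow> v \<in> C \<Longrightarrow> ck_class A u = ck_class A v \<longleftrightarrow> (\<lambda>n. N (u n - v n)) \<longlonglongrightarrow> 0"
  unfolding ck_class_def using eq_equiv_class_iff[OF equiv_ck_rel] by (simp add: ck_rel_iff)

lemma ck_class_eqI: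
  assumes "u \<in> C" "v \<in> C" "g \<longlonglongrightarrow> 0" "\<And>n. N (u n - v n) \<le> g n"
  shows "ck_class A u = ck_class A v"
  using assms(1,2) tendsto_0_sandwich[OF assms(3) ck_norm_ge0 assms(4)] by (simp add: ck_class_eq_iff)

lemma CK_carrier: "carrier (CK_algebra A) = ck_class A ` C"
  by (auto simp: CK_algebra_def quotient_def ck_class_def)

lemma ck_class_in_carrier: "u \<in> C \<Longrightarrow> ck_class A u \<in> carrier (CK_algebra A)"
  by (simp add: CK_carrier)

lemma ck_rep_class: assumes "u \<in> C"
  shows "ck_rep (ck_class A u) \<in> C" "(\<lambda>n. N (ck_rep (ck_class A u) n - u n)) \<longlonglongrightarrow> 0"
proof -
  have "u \<in> ck_class A u" using assms equiv_class_self[OF equiv_ck_rel] by (simp add: ck_class_def)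
  then have "ck_rep (ck_class A u) \<in> ck_class A u" unfolding ck_rep_def by (rule someI[where P = "\<lambda>v. v \<in> ck_class A u"])
  then have "(u, ck_rep (ck_class A u)) \<in> ck_rel A" by (simp add: ck_class_def)
  then show "ck_rep (ck_class A u) \<in> C" "(\<lambda>n. N (ck_rep (ck_class A u) n - u n)) \<longlonglongrightarrow> 0"
    by (simp_all add: ck_rel_iff N_minus)
qed

lemma CK_add: assumes "u \<in> C" "v \<in> C"
  shows "ck_class A u \<oplus>\<^bsub>CK_algebra A\<^esub> ck_class A v = ck_class A (\<lambda>n. u n + v n)"
proof -
  let ?u = "ck_rep (ck_class A u)" and ?v = "ck_rep (ck_class A v)"
  have "ck_class A (\<lambda>n. ?u n + ?v n) = ck_class A (\<lambda>n. u n + v n)"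
  proof (rule ck_class_eqI)
    show "(\<lambda>n. N (?u n - u n) + N (?v n - v n)) \<longlonglongrightarrow> 0"
      using tendsto_add[OF ck_rep_class(2)[OF assms(1)] ck_rep_class(2)[OF assms(2)]] by simp
    show "N (?u n + ?v n - (u n + v n)) \<le> N (?u n - u n) + N (?v n - v n)" for n
      using N_add[of "?u n - u n" "?v n - v n"] by (simp add: algebra_simps)
  qed (intro ck_cauchy_add ck_rep_class assms)+
  then show ?thesis by (simp add: CK_algebra_def)
qed

lemma CK_mult: assumes "u \<in> C" "v \<in> C"
  shows "ck_class A u \<otimes>\<^bsub>CK_algebra A\<^esub> ck_class A v = ck_class A (\<lambda>n. u n * v n)"
proof -
  let ?u = "ck_rep (ck_class A u)" and ?v = "ck_rep (ck_class A v)"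
  obtain K L where K: "K > 0" "\<And>n. N (?u n) \<le> K" and L: "L > 0" "\<And>n. N (v n) \<le> L"
    using ck_cauchy_bounded ck_rep_class(1) assms by meson
  have "ck_class A (\<lambda>n. ?u n * ?v n) = ck_class A (\<lambda>n. u n * v n)"
  proof (rule ck_class_eqI)
    show "(\<lambda>n. K * N (?v n - v n) + N (?u n - u n) * L) \<longlonglongrightarrow> 0"
      using tendsto_add[OF tendsto_mult_left[OF ck_rep_class(2)[OF assms(2)], of K]
          tendsto_mult_right[OF ck_rep_class(2)[OF assms(1)], of L]] by simp
    show "N (?u n * ?v n - u n * v n) \<le> K * N (?v n - v n) + N (?u n - u n) * L" for n
      by (rule order_trans[OF N_mult_diff])
        (intro add_mono mult_mono; use K L ck_norm_ge0 in \<open>auto simp: less_imp_le\<close>)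
  qed (intro ck_cauchy_mult ck_rep_class assms)+
  then show ?thesis by (simp add: CK_algebra_def)
qed

lemma CK_smult: assumes "u \<in> C"
  shows "c \<odot>\<^bsub>CK_algebra A\<^esub> ck_class A u = ck_class A (\<lambda>n. free_scale c (u n))"
proof -
  let ?u = "ck_rep (ck_class A u)"
  have "ck_class A (\<lambda>n. free_scale c (?u n)) = ck_class A (\<lambda>n. free_scale c (u n))"
  proof (rule ck_class_eqI)
    show "(\<lambda>n. cmod c * N (?u n - u n)) \<longlonglongrightarrow> 0"
      using tendsto_mult_left[OF ck_rep_class(2)[OF assms], of "cmod c"] by simp
    show "N (free_scale c (?u n) - free_scale c (u n)) \<le> cmod c * N (?u n - u n)" for n
      by (simp flip: free_scale_diff add: N_scale)
  qed (intro ck_cauchy_scale ck_rep_class assms)+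
  then show ?thesis by (simp add: CK_algebra_def)
qed

lemma CK_star: assumes "u \<in> C"
  shows "star (CK_algebra A) (ck_class A u) = ck_class A (\<lambda>n. free_star (u n))"
proof -
  let ?u = "ck_rep (ck_class A u)"
  have "ck_class A (\<lambda>n. free_star (?u n)) = ck_class A (\<lambda>n. free_star (u n))"
  proof (rule ck_class_eqI[OF _ _ ck_rep_class(2)[OF assms]])
    show "N (free_star (?u n) - free_star (u n)) \<le> N (?u n - u n)" for n
      by (simp flip: free_star_diff add: N_star)
  qed (intro ck_cauchy_star ck_rep_class assms)+
  then show ?thesis by (simp add: CK_algebra_def)
qed

lemma CK_zero: "\<zero>\<^bsub>CK_algebra A\<^esub> = ck_class A (\<lambda>_. 0)"
  and CK_one: "\<one>\<^bsub>CK_algebra A\<^esub> = ck_class A (\<lambda>_. 1)"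
  by (simp_all add: CK_algebra_def)

lemma CK_nrm_tendsto: assumes "u \<in> C"
  shows "(\<lambda>n. N (u n)) \<longlonglongrightarrow> nrm (CK_algebra A) (ck_class A u)"
proof -
  let ?u = "ck_rep (ck_class A u)"
  have "(\<lambda>n. N (u n) - N (?u n)) \<longlonglongrightarrow> 0"
  proof (rule Lim_null_comparison[OF _ ck_rep_class(2)[OF assms]])
    show "\<forall>\<^sub>F n in sequentially. norm (N (u n) - N (?u n)) \<le> N (?u n - u n)"
      using N_abs N_minus by simp
  qed
  from tendsto_add[OF this ck_cauchy_norm_tendsto[OF ck_rep_class(1)[OF assms]]]
  show ?thesis by (simp add: CK_algebra_def)
qed

lemma CK_nrm_eqI: "u \<in> C \<Longrightarrow> (\<lambda>n. N (u n)) \<longlonglongrightarrow> l \<Longrightarrow> nrm (CK_algebra A) (ck_class A u) = l"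
  using CK_nrm_tendsto LIMSEQ_unique by blast

lemma CK_nrm_const: "nrm (CK_algebra A) (ck_class A (\<lambda>_. a)) = N a"
  by (rule CK_nrm_eqI) auto

lemma CK_carrierE: assumes "X \<in> carrier (CK_algebra A)" obtains u where "u \<in> C" "X = ck_class A u"
  using assms by (auto simp: CK_carrier)

lemmas ck_cauchy_intros = ck_cauchy_const ck_cauchy_add ck_cauchy_mult ck_cauchy_scale ck_cauchy_star
  ck_cauchy_uminus ck_cauchy_diff
lemmas CK_ops = CK_add CK_mult CK_smult CK_star CK_zero CK_one

lemma cring_complex_ring: "cring complex_ring"
proof (rule cringI)
  show "abelian_group complex_ring"
    by (rule abelian_groupI) (auto simp: complex_ring_def algebra_simps intro: exI[of _ "- _"])
  show "comm_monoid complex_ring"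
    by (rule comm_monoidI) (auto simp: complex_ring_def)
qed (auto simp: complex_ring_def algebra_simps)

lemma CK_abelian_group: "abelian_group (CK_algebra A)"
proof (rule abelian_groupI)
  fix X assume "X \<in> carrier (CK_algebra A)"
  then obtain u where u: "u \<in> C" "X = ck_class A u" by (rule CK_carrierE)
  show "\<exists>Y\<in>carrier (CK_algebra A). Y \<oplus>\<^bsub>CK_algebra A\<^esub> X = \<zero>\<^bsub>CK_algebra A\<^esub>"
    by (rule bexI[of _ "ck_class A (\<lambda>n. - u n)"])
      (simp_all add: u CK_ops ck_cauchy_intros ck_class_in_carrier)
qed (auto elim!: CK_carrierE simp: CK_ops ck_cauchy_intros ck_class_in_carrier add_ac)

lemma CK_ring: "ring (CK_algebra A)"
proof (rule ringI[OF CK_abelian_group])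
  show "monoid (CK_algebra A)"
    by (rule monoidI)
      (auto elim!: CK_carrierE simp: CK_ops ck_cauchy_intros ck_class_in_carrier mult.assoc)
qed (auto elim!: CK_carrierE simp: CK_ops ck_cauchy_intros ck_class_in_carrier algebra_simps)

lemma CK_minus: assumes "u \<in> C" "v \<in> C"
  shows "ck_class A u \<ominus>\<^bsub>CK_algebra A\<^esub> ck_class A v = ck_class A (\<lambda>n. u n - v n)"
proof -
  have "\<ominus>\<^bsub>CK_algebra A\<^esub> ck_class A v = ck_class A (\<lambda>n. - v n)"
    using abelian_group.minus_equality[OF CK_abelian_group, of "ck_class A (\<lambda>n. - v n)" "ck_class A v"]
      assms by (simp add: CK_ops ck_cauchy_intros ck_class_in_carrier)
  with assms show ?thesis by (simp add: a_minus_def CK_ops ck_cauchy_intros)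
qed

lemma CK_module: "module complex_ring (CK_algebra A)"
  by (rule moduleI[OF cring_complex_ring CK_abelian_group])
    (auto elim!: CK_carrierE simp: complex_ring_def CK_ops ck_cauchy_intros ck_class_in_carrier
      free_scale_add free_scale_add_left free_scale_scale)

lemma CK_dense:
  assumes "u \<in> C" "e > 0"
  shows "\<exists>M. \<forall>n\<ge>M. nrm (CK_algebra A) (ck_class A u \<ominus>\<^bsub>CK_algebra A\<^esub> ck_class A (\<lambda>_. u n)) \<le> e"
proof -
  obtain M where M: "\<forall>m\<ge>M. \<forall>n\<ge>M. N (u m - u n) < e" using ck_cauchyD[OF assms] by blast
  have "nrm (CK_algebra A) (ck_class A u \<ominus>\<^bsub>CK_algebra A\<^esub> ck_class A (\<lambda>_. u n)) \<le> e" if "n \<ge> M" for n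
  proof -
    have "(\<lambda>m. N (u m - u n)) \<longlonglongrightarrow> nrm (CK_algebra A) (ck_class A (\<lambda>m. u m - u n))"
      by (rule CK_nrm_tendsto) (intro ck_cauchy_intros assms)
    moreover have "\<exists>M. \<forall>m\<ge>M. N (u m - u n) \<le> e" using M that less_imp_le by blast
    ultimately have "nrm (CK_algebra A) (ck_class A (\<lambda>m. u m - u n)) \<le> e" by (rule LIMSEQ_le_const2)
    then show ?thesis by (simp add: CK_minus assms(1))
  qed
  then show ?thesis by blast
qed

theorem CK_cstar_algebra: "cstar_algebra (CK_algebra A)"
proof (intro cstar_algebra.intro cstar_algebra_axioms.intro CK_ring CK_module)
  let ?O = "CK_algebra A"
  fix X Y c assume X: "X \<in> carrier ?O"
  then obtain u where u: "u \<in> C" "X = ck_class A u" by (rule CK_carrierE)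
  note nu = CK_nrm_tendsto[OF u(1)]
  show "star ?O X \<in> carrier ?O" "star ?O (star ?O X) = X"
    "star ?O (c \<odot>\<^bsub>?O\<^esub> X) = cnj c \<odot>\<^bsub>?O\<^esub> star ?O X"
    using u by (simp_all add: CK_ops ck_cauchy_intros ck_class_in_carrier free_star_scale)
  show "0 \<le> nrm ?O X"
    using u LIMSEQ_le_const[OF nu] ck_norm_ge0 by blast
  show "(nrm ?O X = 0) = (X = \<zero>\<^bsub>?O\<^esub>)"
  proof -
    have "X = \<zero>\<^bsub>?O\<^esub> \<longleftrightarrow> (\<lambda>n. N (u n)) \<longlonglongrightarrow> 0"
      using ck_class_eq_iff[OF u(1) ck_cauchy_const[of 0]] by (simp add: u CK_zero)
    also have "\<dots> \<longleftrightarrow> nrm ?O X = 0"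
      unfolding u(2)
    proof
      assume "(\<lambda>n. N (u n)) \<longlonglongrightarrow> 0"
      then show "nrm ?O (ck_class A u) = 0" by (rule CK_nrm_eqI[OF u(1)])
    next
      assume "nrm ?O (ck_class A u) = 0"
      with nu show "(\<lambda>n. N (u n)) \<longlonglongrightarrow> 0" by simp
    qed
    finally show ?thesis by blast
  qed
  show "nrm ?O (c \<odot>\<^bsub>?O\<^esub> X) = cmod c * nrm ?O X"
    using u tendsto_mult_left[OF nu, of "cmod c"]
    by (simp add: CK_smult CK_nrm_eqI ck_cauchy_intros N_scale)
  show "nrm ?O (star ?O X \<otimes>\<^bsub>?O\<^esub> X) = (nrm ?O X)\<^sup>2"
    using u tendsto_power[OF nu, of 2]
    by (simp add: CK_ops CK_nrm_eqI ck_cauchy_intros N_cstar)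
  assume Y: "Y \<in> carrier ?O"
  then obtain v where v: "v \<in> C" "Y = ck_class A v" by (rule CK_carrierE)
  note nv = CK_nrm_tendsto[OF v(1)]
  show "(c \<odot>\<^bsub>?O\<^esub> X) \<otimes>\<^bsub>?O\<^esub> Y = c \<odot>\<^bsub>?O\<^esub> (X \<otimes>\<^bsub>?O\<^esub> Y)"
    "X \<otimes>\<^bsub>?O\<^esub> (c \<odot>\<^bsub>?O\<^esub> Y) = c \<odot>\<^bsub>?O\<^esub> (X \<otimes>\<^bsub>?O\<^esub> Y)"
    "star ?O (X \<oplus>\<^bsub>?O\<^esub> Y) = star ?O X \<oplus>\<^bsub>?O\<^esub> star ?O Y"
    "star ?O (X \<otimes>\<^bsub>?O\<^esub> Y) = star ?O Y \<otimes>\<^bsub>?O\<^esub> star ?O X"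
    using u v by (simp_all add: CK_ops ck_cauchy_intros free_scale_mult_left free_scale_mult_right
        free_star_add free_star_mult)
  show "nrm ?O (X \<oplus>\<^bsub>?O\<^esub> Y) \<le> nrm ?O X + nrm ?O Y"
    using u v LIMSEQ_le[OF CK_nrm_tendsto[OF ck_cauchy_add[OF u(1) v(1)]] tendsto_add[OF nu nv]] N_add
    by (simp add: CK_add)
  show "nrm ?O (X \<otimes>\<^bsub>?O\<^esub> Y) \<le> nrm ?O X * nrm ?O Y"
    using u v LIMSEQ_le[OF CK_nrm_tendsto[OF ck_cauchy_mult[OF u(1) v(1)]] tendsto_mult[OF nu nv]] N_mult
    by (simp add: CK_mult)
next
  let ?O = "CK_algebra A"
  fix X :: "nat \<Rightarrow> (nat \<Rightarrow> 'n free_alg) set"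
  assume X: "\<And>k. X k \<in> carrier ?O"
    and cau: "\<And>e. e > 0 \<Longrightarrow> \<exists>M. \<forall>m\<ge>M. \<forall>n\<ge>M. nrm ?O (X m \<ominus>\<^bsub>?O\<^esub> X n) < e"
  let ?c = "\<lambda>a. ck_class A (\<lambda>_. a)"
  have tri: "nrm ?O (P \<ominus>\<^bsub>?O\<^esub> R) \<le> nrm ?O (P \<ominus>\<^bsub>?O\<^esub> Q) + nrm ?O (Q \<ominus>\<^bsub>?O\<^esub> R)"
    and sym: "nrm ?O (P \<ominus>\<^bsub>?O\<^esub> Q) = nrm ?O (Q \<ominus>\<^bsub>?O\<^esub> P)"
    if P: "P \<in> carrier ?O" and Q: "Q \<in> carrier ?O" and R: "R \<in> carrier ?O" for P Q R
  proof -
    obtain u v w where *: "u \<in> C" "P = ck_class A u" "v \<in> C" "Q = ck_class A v" "w \<in> C" "R = ck_class A w"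
      using P Q R CK_carrierE by metis
    show "nrm ?O (P \<ominus>\<^bsub>?O\<^esub> R) \<le> nrm ?O (P \<ominus>\<^bsub>?O\<^esub> Q) + nrm ?O (Q \<ominus>\<^bsub>?O\<^esub> R)"
      unfolding * CK_minus[OF *(1) *(5)] CK_minus[OF *(1) *(3)] CK_minus[OF *(3) *(5)]
      by (rule LIMSEQ_le[OF CK_nrm_tendsto tendsto_add[OF CK_nrm_tendsto CK_nrm_tendsto]])
        (use * N_tri in \<open>auto intro!: ck_cauchy_intros\<close>)
    show "nrm ?O (P \<ominus>\<^bsub>?O\<^esub> Q) = nrm ?O (Q \<ominus>\<^bsub>?O\<^esub> P)"
    proof -
      have e: "(\<lambda>n. N (v n - u n)) = (\<lambda>n. N (u n - v n))"
        by (rule ext) (rule N_minus)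
      show ?thesis
        unfolding * CK_minus[OF *(1) *(3)] CK_minus[OF *(3) *(1)]
        by (rule CK_nrm_eqI[OF ck_cauchy_diff[OF *(1) *(3)]])
          (use CK_nrm_tendsto[OF ck_cauchy_diff[OF *(3) *(1)]] in \<open>simp only: e\<close>)
    qed
  qed
  have "\<exists>a. nrm ?O (X k \<ominus>\<^bsub>?O\<^esub> ?c a) \<le> inverse (real (Suc k))" for k
  proof -
    obtain u where u: "u \<in> C" "X k = ck_class A u" using X CK_carrierE by metis
    then show ?thesis using CK_dense[OF u(1), of "inverse (real (Suc k))"] by auto
  qed
  then obtain a where a: "\<And>k. nrm ?O (X k \<ominus>\<^bsub>?O\<^esub> ?c (a k)) \<le> inverse (real (Suc k))" by metis
  have cc: "?c b \<in> carrier ?O" for b by (simp add: ck_class_in_carrier)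
  have Na: "N (a m - a n) \<le> inverse (real (Suc m)) + nrm ?O (X m \<ominus>\<^bsub>?O\<^esub> X n) + inverse (real (Suc n))" for m n
  proof -
    have "N (a m - a n) = nrm ?O (?c (a m) \<ominus>\<^bsub>?O\<^esub> ?c (a n))" by (simp add: CK_minus CK_nrm_const)
    then show ?thesis
      using tri[OF cc[of "a m"] X[of m] cc[of "a n"]] tri[OF X[of m] X[of n] cc[of "a n"]]
        sym[OF cc[of "a m"] X[of m] X[of m]] a[of m] a[of n] by linarith
  qed
  have aC: "a \<in> C"
    unfolding ck_cauchy_def mem_Collect_eq
  proof (intro allI impI)
    fix e :: real assume "e > 0"
    then obtain M where M: "\<forall>m\<ge>M. \<forall>n\<ge>M. nrm ?O (X m \<ominus>\<^bsub>?O\<^esub> X n) < e / 3" using cau[of "e / 3"] by auto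
    obtain K where K: "inverse (real (Suc K)) < e / 3" using reals_Archimedean[of "e / 3"] \<open>e > 0\<close> by auto
    have inv: "inverse (real (Suc m)) < e / 3" if "m \<ge> K" for m
      by (rule le_less_trans[OF _ K]) (use that in \<open>simp add: le_imp_inverse_le\<close>)
    have "N (a m - a n) < e" if mn: "m \<ge> max M K" "n \<ge> max M K" for m n
    proof -
      have "nrm ?O (X m \<ominus>\<^bsub>?O\<^esub> X n) < e / 3" using M mn by simp
      moreover have "inverse (real (Suc m)) < e / 3" "inverse (real (Suc n)) < e / 3" using inv mn by simp_all
      ultimately show ?thesis using Na[of m n] by linarith
    qed
    then show "\<exists>M. \<forall>m\<ge>M. \<forall>n\<ge>M. N (a m - a n) < e" by blast
  qed
  show "\<exists>Y\<in>carrier ?O. (\<lambda>n. nrm ?O (X n \<ominus>\<^bsub>?O\<^esub> Y)) \<longlonglongrightarrow> 0"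
  proof (rule bexI[OF _ ck_class_in_carrier[OF aC]], rule LIMSEQ_I)
    fix e :: real assume "e > 0"
    obtain K where K: "inverse (real (Suc K)) < e / 2" using reals_Archimedean[of "e / 2"] \<open>e > 0\<close> by auto
    have inv: "inverse (real (Suc m)) < e / 2" if "m \<ge> K" for m
      by (rule le_less_trans[OF _ K]) (use that in \<open>simp add: le_imp_inverse_le\<close>)
    obtain M where M: "\<forall>n\<ge>M. nrm ?O (ck_class A a \<ominus>\<^bsub>?O\<^esub> ?c (a n)) \<le> e / 2"
      using CK_dense[OF aC, of "e / 2"] \<open>e > 0\<close> by auto
    have "norm (nrm ?O (X n \<ominus>\<^bsub>?O\<^esub> ck_class A a) - 0) < e" if n: "n \<ge> max M K" for n
    proof -
      obtain u where u: "u \<in> C" "X n = ck_class A u" using X CK_carrierE by metis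
      have "0 \<le> nrm ?O (X n \<ominus>\<^bsub>?O\<^esub> ck_class A a)"
        unfolding u CK_minus[OF u(1) aC]
        by (rule LIMSEQ_le_const[OF CK_nrm_tendsto[OF ck_cauchy_diff[OF u(1) aC]]]) (simp add: ck_norm_ge0)
      moreover have "nrm ?O (X n \<ominus>\<^bsub>?O\<^esub> ck_class A a) < e"
      proof -
        have "nrm ?O (ck_class A a \<ominus>\<^bsub>?O\<^esub> ?c (a n)) \<le> e / 2" using M n by simp
        moreover have "inverse (real (Suc n)) < e / 2" using inv n by simp
        ultimately show ?thesis
          using tri[OF X[of n] cc[of "a n"] ck_class_in_carrier[OF aC]] a[of n]
            sym[OF cc[of "a n"] ck_class_in_carrier[OF aC] X[of n]] by linarith
      qed
      ultimately show ?thesis by simp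
    qed
    then show "\<exists>K. \<forall>n\<ge>K. norm (nrm ?O (X n \<ominus>\<^bsub>?O\<^esub> ck_class A a) - 0) < e" by blast
  qed
qed

end


section \<open>The universal property\<close>

text \<open>\<open>CK_gen_family\<close>, \<open>CK_generated\<close> and \<open>CK_universal\<close> say that \<^const>\<open>CK_algebra\<close> is generated as a C*-algebra
  by a Cuntz--Krieger family and that it maps to every unital C*-algebra (over any type) containing
  such a family.\<close>

context cstar_algebra
begin

lemma smult_in [simp]: "x \<in> carrier \<AA> \<Longrightarrow> k \<odot> x \<in> carrier \<AA>"
  using scalars.smult_closed[of k x] by (simp add: complex_ring_def)

lemma smult_add_left: "x \<in> carrier \<AA> \<Longrightarrow> (k + l) \<odot> x = k \<odot> x \<oplus> l \<odot> x"
  using scalars.smult_l_distr[of k l x] by (simp add: complex_ring_def)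

lemma smult_smult: "x \<in> carrier \<AA> \<Longrightarrow> k \<odot> (l \<odot> x) = (k * l) \<odot> x"
  using scalars.smult_assoc1[of k l x] by (simp add: complex_ring_def)

lemma smult_0: "x \<in> carrier \<AA> \<Longrightarrow> 0 \<odot> x = \<zero>"
  using scalars.smult_l_null[of x] by (simp add: complex_ring_def)

lemma smult_1: "x \<in> carrier \<AA> \<Longrightarrow> 1 \<odot> x = x"
  using scalars.smult_one[of x] by (simp add: complex_ring_def)

lemma smult_minus1: "x \<in> carrier \<AA> \<Longrightarrow> (- 1) \<odot> x = \<ominus> x"
  using smult_add_left[of x "-1" 1] minus_equality[of "(- 1) \<odot> x" x] by (simp add: smult_0 smult_1)

lemma smult_add_right: "x \<in> carrier \<AA> \<Longrightarrow> y \<in> carrier \<AA> \<Longrightarrow> k \<odot> (x \<oplus> y) = k \<odot> x \<oplus> k \<odot> y"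
  using scalars.smult_r_distr[of k x y] by (simp add: complex_ring_def)

lemma star_in [simp]: "x \<in> carrier \<AA> \<Longrightarrow> star \<AA> x \<in> carrier \<AA>"
  by (rule star_closed)

lemma star_one: "star \<AA> \<one> = \<one>"
  using star_mult[of "star \<AA> \<one>" \<one>] star_star[of \<one>] by simp

lemma star_zero: "star \<AA> \<zero> = \<zero>"
  using star_smult[of \<zero> 0] by (simp add: smult_0)

lemma star_minus: "x \<in> carrier \<AA> \<Longrightarrow> y \<in> carrier \<AA> \<Longrightarrow> star \<AA> (x \<ominus> y) = star \<AA> x \<ominus> star \<AA> y"
  using star_smult[of y "-1"] by (simp add: a_minus_def star_add smult_minus1)

lemma smult_minus: "x \<in> carrier \<AA> \<Longrightarrow> y \<in> carrier \<AA> \<Longrightarrow> k \<odot> (x \<ominus> y) = k \<odot> x \<ominus> k \<odot> y"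
  by (simp add: a_minus_def smult_add_right smult_smult flip: smult_minus1)

lemma nrm_zero: "nrm \<AA> \<zero> = 0"
  using nrm_eq_0[of \<zero>] by simp

lemma nrm_star: assumes "x \<in> carrier \<AA>" shows "nrm \<AA> (star \<AA> x) = nrm \<AA> x"
proof -
  have *: "nrm \<AA> x \<le> nrm \<AA> (star \<AA> x)" if "x \<in> carrier \<AA>" for x
  proof (cases "nrm \<AA> x = 0")
    case False
    have "nrm \<AA> x * nrm \<AA> x \<le> nrm \<AA> (star \<AA> x) * nrm \<AA> x"
      using cstar_identity[OF that] nrm_mult[of "star \<AA> x" x] that by (simp add: power2_eq_square)
    with False nrm_nonneg[OF that] show ?thesis by auto
  qed (simp add: nrm_nonneg that)
  from *[of x] *[of "star \<AA> x"] assms show ?thesis by (simp add: star_star)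
qed

lemma nrm_minus_commute: "x \<in> carrier \<AA> \<Longrightarrow> y \<in> carrier \<AA> \<Longrightarrow> nrm \<AA> (x \<ominus> y) = nrm \<AA> (y \<ominus> x)"
  using nrm_smult[of "x \<ominus> y" "-1"] by (simp add: smult_minus1 minus_add a_minus_def a_comm)

lemma nrm_minus_triangle:
  assumes [simp]: "x \<in> carrier \<AA>" "y \<in> carrier \<AA>" "z \<in> carrier \<AA>"
  shows "nrm \<AA> (x \<ominus> z) \<le> nrm \<AA> (x \<ominus> y) + nrm \<AA> (y \<ominus> z)"
proof -
  have "x \<ominus> z = (x \<ominus> y) \<oplus> (y \<ominus> z)"
    by (simp add: a_minus_def a_assoc r_neg1)
  then show ?thesis using nrm_triangle[of "x \<ominus> y" "y \<ominus> z"] by simp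
qed

definition tends :: "(nat \<Rightarrow> 'a) \<Rightarrow> 'a \<Rightarrow> bool" where
  "tends u x \<longleftrightarrow> (\<forall>n. u n \<in> carrier \<AA>) \<and> x \<in> carrier \<AA> \<and> (\<lambda>n. nrm \<AA> (u n \<ominus> x)) \<longlonglongrightarrow> 0"

lemma tendsI:
  assumes "\<And>n. u n \<in> carrier \<AA>" "x \<in> carrier \<AA>" "g \<longlonglongrightarrow> 0" "\<And>n. nrm \<AA> (u n \<ominus> x) \<le> g n"
  shows "tends u x"
  unfolding tends_def using assms tendsto_0_sandwich[OF assms(3) _ assms(4)]
  by (simp add: nrm_nonneg)

lemma tends_unique: assumes "tends u x" "tends u y" shows "x = y"
proof -
  have c [simp]: "\<And>n. u n \<in> carrier \<AA>" "x \<in> carrier \<AA>" "y \<in> carrier \<AA>"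
    using assms by (auto simp: tends_def)
  have l: "(\<lambda>n. nrm \<AA> (u n \<ominus> x) + nrm \<AA> (u n \<ominus> y)) \<longlonglongrightarrow> 0"
    using assms tendsto_add[of "\<lambda>n. nrm \<AA> (u n \<ominus> x)" 0 _ "\<lambda>n. nrm \<AA> (u n \<ominus> y)" 0]
    by (simp add: tends_def)
  have "nrm \<AA> (x \<ominus> y) \<le> nrm \<AA> (u n \<ominus> x) + nrm \<AA> (u n \<ominus> y)" for n
    using nrm_minus_triangle[of x "u n" y] nrm_minus_commute[of x "u n"] by simp
  then have "nrm \<AA> (x \<ominus> y) \<le> 0" using LIMSEQ_le_const[OF l] by blast
  then have "x \<ominus> y = \<zero>" using nrm_nonneg[of "x \<ominus> y"] nrm_eq_0[of "x \<ominus> y"] by simp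
  moreover have "x = (x \<ominus> y) \<oplus> y" by (simp add: a_minus_def a_assoc l_neg)
  ultimately show ?thesis by simp
qed

lemma tends_add: assumes "tends u x" "tends v y" shows "tends (\<lambda>n. u n \<oplus> v n) (x \<oplus> y)"
proof (rule tendsI)
  have c [simp]: "\<And>n. u n \<in> carrier \<AA>" "\<And>n. v n \<in> carrier \<AA>" "x \<in> carrier \<AA>" "y \<in> carrier \<AA>"
    using assms by (auto simp: tends_def)
  show "u n \<oplus> v n \<in> carrier \<AA>" "x \<oplus> y \<in> carrier \<AA>" for n by simp_all
  show "(\<lambda>n. nrm \<AA> (u n \<ominus> x) + nrm \<AA> (v n \<ominus> y)) \<longlonglongrightarrow> 0"
    using assms tendsto_add[of "\<lambda>n. nrm \<AA> (u n \<ominus> x)" 0 _ "\<lambda>n. nrm \<AA> (v n \<ominus> y)" 0]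
    by (simp add: tends_def)
  have "(u n \<oplus> v n) \<ominus> (x \<oplus> y) = (u n \<ominus> x) \<oplus> (v n \<ominus> y)" for n
    by (simp add: a_minus_def minus_add a_ac)
  then show "nrm \<AA> ((u n \<oplus> v n) \<ominus> (x \<oplus> y)) \<le> nrm \<AA> (u n \<ominus> x) + nrm \<AA> (v n \<ominus> y)" for n
    using nrm_triangle[of "u n \<ominus> x" "v n \<ominus> y"] by simp
qed

lemma tends_mult: assumes "tends u x" "tends v y" shows "tends (\<lambda>n. u n \<otimes> v n) (x \<otimes> y)"
proof (rule tendsI)
  have c [simp]: "\<And>n. u n \<in> carrier \<AA>" "\<And>n. v n \<in> carrier \<AA>" "x \<in> carrier \<AA>" "y \<in> carrier \<AA>"
    using assms by (auto simp: tends_def)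
  let ?d = "\<lambda>n. nrm \<AA> (u n \<ominus> x)" and ?e = "\<lambda>n. nrm \<AA> (v n \<ominus> y)"
  have d: "?d \<longlonglongrightarrow> 0" "?e \<longlonglongrightarrow> 0" using assms by (auto simp: tends_def)
  show "u n \<otimes> v n \<in> carrier \<AA>" "x \<otimes> y \<in> carrier \<AA>" for n by simp_all
  show "(\<lambda>n. (?d n + nrm \<AA> x) * ?e n + ?d n * nrm \<AA> y) \<longlonglongrightarrow> 0"
    by (rule tendsto_eq_intros d refl)+ simp
  fix n
  have "u n \<otimes> v n \<ominus> x \<otimes> y = u n \<otimes> (v n \<ominus> y) \<oplus> (u n \<ominus> x) \<otimes> y"
  proof -
    have "u n \<otimes> (v n \<ominus> y) \<oplus> (u n \<ominus> x) \<otimes> y =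
        u n \<otimes> v n \<oplus> (\<ominus> (u n \<otimes> y) \<oplus> (u n \<otimes> y \<oplus> \<ominus> (x \<otimes> y)))"
      by (simp add: a_minus_def r_distr l_distr r_minus l_minus a_assoc)
    then show ?thesis by (simp add: a_minus_def r_neg1)
  qed
  moreover have "nrm \<AA> (u n \<otimes> (v n \<ominus> y)) \<le> (?d n + nrm \<AA> x) * ?e n"
  proof -
    have "u n = (u n \<ominus> x) \<oplus> x" by (simp add: a_minus_def a_assoc l_neg)
    then have "nrm \<AA> (u n) \<le> ?d n + nrm \<AA> x" using nrm_triangle[of "u n \<ominus> x" x] by simp
    then have "nrm \<AA> (u n) * ?e n \<le> (?d n + nrm \<AA> x) * ?e n"
      by (intro mult_right_mono) (simp_all add: nrm_nonneg)
    then show ?thesis using nrm_mult[of "u n" "v n \<ominus> y"] by simp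
  qed
  moreover have "nrm \<AA> ((u n \<ominus> x) \<otimes> y) \<le> ?d n * nrm \<AA> y" by (simp add: nrm_mult)
  ultimately show "nrm \<AA> (u n \<otimes> v n \<ominus> x \<otimes> y) \<le> (?d n + nrm \<AA> x) * ?e n + ?d n * nrm \<AA> y"
    using nrm_triangle[of "u n \<otimes> (v n \<ominus> y)" "(u n \<ominus> x) \<otimes> y"] by simp
qed

lemma tends_smult: assumes "tends u x" shows "tends (\<lambda>n. k \<odot> u n) (k \<odot> x)"
proof (rule tendsI)
  have c [simp]: "\<And>n. u n \<in> carrier \<AA>" "x \<in> carrier \<AA>"
    using assms by (auto simp: tends_def)
  show "k \<odot> u n \<in> carrier \<AA>" "k \<odot> x \<in> carrier \<AA>" for n by simp_all
  show "(\<lambda>n. cmod k * nrm \<AA> (u n \<ominus> x)) \<longlonglongrightarrow> 0"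
    using tendsto_mult_left[of "\<lambda>n. nrm \<AA> (u n \<ominus> x)" 0 _ "cmod k"] assms by (simp add: tends_def)
  show "nrm \<AA> (k \<odot> u n \<ominus> k \<odot> x) \<le> cmod k * nrm \<AA> (u n \<ominus> x)" for n
    by (simp add: nrm_smult flip: smult_minus)
qed

lemma tends_star: assumes "tends u x" shows "tends (\<lambda>n. star \<AA> (u n)) (star \<AA> x)"
  using assms by (simp add: tends_def nrm_star flip: star_minus)

lemma tends_const: "x \<in> carrier \<AA> \<Longrightarrow> tends (\<lambda>_. x) x"
  by (simp add: tends_def a_minus_def r_neg nrm_zero)

fun letter_val :: "('i \<Rightarrow> 'a) \<Rightarrow> 'i letter \<Rightarrow> 'a" where
  "letter_val t (Gen i) = t i"
| "letter_val t (Adj i) = star \<AA> (t i)"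

definition word_val :: "('i \<Rightarrow> 'a) \<Rightarrow> 'i letter list \<Rightarrow> 'a" where
  "word_val t ls = foldr (\<lambda>l x. letter_val t l \<otimes> x) ls \<one>"

definition ev :: "('i \<Rightarrow> 'a) \<Rightarrow> 'i free_alg \<Rightarrow> 'a" where
  "ev t a = (\<Oplus>w\<in>Poly_Mapping.keys a. Poly_Mapping.lookup a w \<odot> word_val t (letters w))"

context
  fixes t :: "'i \<Rightarrow> 'a"
  assumes t: "\<And>i. t i \<in> carrier \<AA>"
begin

lemma letter_val_in: "letter_val t l \<in> carrier \<AA>"
  by (cases l) (simp_all add: t)

lemma word_val_in [simp]: "word_val t ls \<in> carrier \<AA>"
  by (induction ls) (simp_all add: word_val_def letter_val_in)

lemma word_val_append: "word_val t (ls @ ms) = word_val t ls \<otimes> word_val t ms"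
proof (induction ls)
  case Nil show ?case by (simp add: word_val_def[of t "[]"])
next
  case (Cons l ls)
  have step: "word_val t (l # ks) = letter_val t l \<otimes> word_val t ks" for ks by (simp add: word_val_def)
  from Cons show ?case by (simp add: step m_assoc letter_val_in)
qed

lemma word_val_star: "word_val t (rev (map letter_star ls)) = star \<AA> (word_val t ls)"
proof (induction ls)
  case Nil show ?case by (simp add: word_val_def star_one)
next
  case (Cons l ls)
  have "word_val t [letter_star l] = star \<AA> (letter_val t l)"
    by (cases l) (simp_all add: word_val_def t star_star)
  moreover have "word_val t (l # ls) = letter_val t l \<otimes> word_val t ls" by (simp add: word_val_def)
  ultimately show ?case using Cons by (simp add: word_val_append star_mult letter_val_in)
qed

lemma ev_superset:
  assumes "finite S" "Poly_Mapping.keys a \<subseteq> S"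
  shows "ev t a = (\<Oplus>w\<in>S. Poly_Mapping.lookup a w \<odot> word_val t (letters w))"
  unfolding ev_def
  by (rule add.finprod_mono_neutral_cong_left) (use assms in \<open>auto simp: in_keys_iff smult_0\<close>)

lemma ev_in [simp]: "ev t a \<in> carrier \<AA>"
  unfolding ev_def by (rule finsum_closed) auto

lemma ev_add: "ev t (a + b) = ev t a \<oplus> ev t b"
proof -
  let ?S = "Poly_Mapping.keys a \<union> Poly_Mapping.keys b"
  have "ev t (a + b) = (\<Oplus>w\<in>?S. Poly_Mapping.lookup (a + b) w \<odot> word_val t (letters w))"
    by (rule ev_superset) (auto simp: Poly_Mapping.keys_add)
  also have "\<dots> = (\<Oplus>w\<in>?S. Poly_Mapping.lookup a w \<odot> word_val t (letters w) \<oplus>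
      Poly_Mapping.lookup b w \<odot> word_val t (letters w))"
    by (simp add: lookup_add smult_add_left)
  also have "\<dots> = ev t a \<oplus> ev t b"
    by (subst finsum_addf) (auto simp: ev_superset[of ?S])
  finally show ?thesis .
qed

lemma ev_0 [simp]: "ev t 0 = \<zero>"
  by (simp add: ev_def)

lemma ev_single: "ev t (Poly_Mapping.single w k) = k \<odot> word_val t (letters w)"
  by (subst ev_superset[of "{w}"]) auto

lemma ev_mult: "ev t (a * b) = ev t a \<otimes> ev t b"
proof (induction a rule: poly_mapping_add_induct)
  case zero show ?case by simp
next
  case (add x y) then show ?case by (simp add: ev_add distrib_right l_distr)
next
  case (single w k)
  show ?case
  proof (induction b rule: poly_mapping_add_induct)
    case zero show ?case by simp
  next
    case (add x y) then show ?case by (simp add: ev_add distrib_left r_distr)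
  next
    case (single v l) show ?case
      by (simp add: mult_single ev_single plus_monomial_def word_val_append
          smult_mult_left smult_mult_right smult_smult mult.commute)
  qed
qed

lemma ev_star: "ev t (free_star a) = star \<AA> (ev t a)"
  by (induction a rule: poly_mapping_add_induct)
    (simp_all add: star_zero free_star_single ev_single monomial_star_def word_val_star
      star_smult free_star_add ev_add star_add)

lemma ev_scale: "ev t (free_scale k a) = k \<odot> ev t a"
  unfolding free_scale_def ev_mult
  by (simp add: ev_single zero_monomial_def word_val_def smult_mult_left)

lemma ev_1: "ev t 1 = \<one>"
proof -
  have "letters (0 :: 'i monomial) = []" by (simp add: zero_monomial_def)
  then show ?thesis using ev_single[of 0 1] by (simp add: word_val_def smult_1)
qed

lemma ev_gen: "ev t (free_gen i) = t i"
  by (simp add: free_gen_def ev_single word_val_def smult_1 t)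

lemma ev_minus: "ev t (a - b) = ev t a \<ominus> ev t b"
  using ev_add[of "a - b" b] by (simp add: a_minus_def a_assoc r_neg)

lemma ev_sum: "finite S \<Longrightarrow> ev t (\<Sum>i\<in>S. f i) = (\<Oplus>i\<in>S. ev t (f i))"
  by (induction S rule: finite_induct) (simp_all add: ev_add finsum_insert)

lemma cstar_seminorm_ev: "cstar_seminorm (\<lambda>a. nrm \<AA> (ev t a))"
  by (simp add: cstar_seminorm_def ev_add ev_scale ev_mult ev_star nrm_triangle nrm_smult nrm_mult
      cstar_identity)

end

lemma ev_in_ck_seminorms:
  fixes t :: "'i::finite \<Rightarrow> 'a"
  assumes "ck_family A \<AA> t"
  shows "(\<lambda>a. nrm \<AA> (ev t a)) \<in> ck_seminorms A"
proof -
  have t: "\<And>i. t i \<in> carrier \<AA>" using assms by (simp add: ck_family_def partial_isometry_def)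
  have "ev t a = \<zero>" if "a \<in> ck_relators A" for a
    using that assms
    by (auto simp: ck_relators_def ck_family_def partial_isometry_def ev_minus ev_mult ev_star ev_gen
        ev_sum ev_scale ev_1 t a_minus_def r_neg)
  then show ?thesis by (simp add: ck_seminorms_def cstar_seminorm_ev[OF t] nrm_zero)
qed



theorem CK_universal:
  fixes t :: "'i::finite \<Rightarrow> 'a"
  assumes fam: "ck_family A \<AA> t"
  shows "\<exists>\<pi>. star_hom (CK_algebra A) \<AA> \<pi> \<and> (\<forall>i. \<pi> (ck_gen A i) = t i)"
proof -
  have t: "\<And>i. t i \<in> carrier \<AA>" using fam by (simp add: ck_family_def partial_isometry_def)
  note ev = ev_in[OF t] ev_add[OF t] ev_mult[OF t] ev_scale[OF t] ev_star[OF t] ev_1[OF t] ev_gen[OF t]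
  have le: "nrm \<AA> (ev t a \<ominus> ev t b) \<le> ck_norm A (a - b)" for a b
    using ck_norm_upper[OF ev_in_ck_seminorms[OF fam], of "a - b"] by (simp add: ev_minus[OF t])
  have ex: "\<exists>y. tends (\<lambda>n. ev t (u n)) y" if u: "u \<in> ck_cauchy A" for u
  proof -
    have "\<exists>y\<in>carrier \<AA>. (\<lambda>n. nrm \<AA> (ev t (u n) \<ominus> y)) \<longlonglongrightarrow> 0"
    proof (rule complete)
      fix e :: real assume "e > 0"
      then obtain M where "\<forall>m\<ge>M. \<forall>n\<ge>M. ck_norm A (u m - u n) < e" using ck_cauchyD[OF u] by blast
      then show "\<exists>M. \<forall>m\<ge>M. \<forall>n\<ge>M. nrm \<AA> (ev t (u m) \<ominus> ev t (u n)) < e"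
        using le by (meson le_less_trans)
    qed (rule ev)
    then show ?thesis by (auto simp: tends_def ev)
  qed
  define \<pi> where "\<pi> X = (SOME y. tends (\<lambda>n. ev t (ck_rep X n)) y)" for X
  have \<pi>: "\<pi> (ck_class A u) = y" if u: "u \<in> ck_cauchy A" and y: "tends (\<lambda>n. ev t (u n)) y" for u y
  proof -
    let ?v = "ck_rep (ck_class A u)"
    have v: "tends (\<lambda>n. ev t (?v n)) (\<pi> (ck_class A u))"
      unfolding \<pi>_def using ex[OF ck_rep_class(1)[OF u]] by (rule someI_ex)
    have "tends (\<lambda>n. ev t (?v n)) y"
    proof (rule tendsI)
      show "(\<lambda>n. ck_norm A (?v n - u n) + nrm \<AA> (ev t (u n) \<ominus> y)) \<longlonglongrightarrow> 0"
        using tendsto_add[OF ck_rep_class(2)[OF u], of "\<lambda>n. nrm \<AA> (ev t (u n) \<ominus> y)" 0] y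
        by (simp add: tends_def)
      show "nrm \<AA> (ev t (?v n) \<ominus> y) \<le> ck_norm A (?v n - u n) + nrm \<AA> (ev t (u n) \<ominus> y)" for n
        using nrm_minus_triangle[of "ev t (?v n)" "ev t (u n)" y] le[of "?v n" "u n"] y
        by (simp add: tends_def ev)
    qed (use y in \<open>simp_all add: tends_def ev\<close>)
    with v show ?thesis by (rule tends_unique)
  qed
  have \<pi>t: "tends (\<lambda>n. ev t (u n)) (\<pi> (ck_class A u))" if "u \<in> ck_cauchy A" for u
    using ex[OF that] \<pi>[OF that] by auto
  have "star_hom (CK_algebra A) \<AA> \<pi>"
    unfolding star_hom_def
  proof (intro conjI ring_hom_memI ballI allI)
    fix X k assume "X \<in> carrier (CK_algebra A)"
    then obtain u where u: "u \<in> ck_cauchy A" "X = ck_class A u" by (rule CK_carrierE)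
    note tu = \<pi>t[OF u(1)]
    show "\<pi> X \<in> carrier \<AA>" using tu u by (simp add: tends_def)
    show "\<pi> (k \<odot>\<^bsub>CK_algebra A\<^esub> X) = k \<odot> \<pi> X"
      unfolding u CK_smult[OF u(1)]
      by (rule \<pi>) (use tends_smult[OF tu] u in \<open>simp_all add: ev ck_cauchy_intros\<close>)
    show "\<pi> (star (CK_algebra A) X) = star \<AA> (\<pi> X)"
      unfolding u CK_star[OF u(1)]
      by (rule \<pi>) (use tends_star[OF tu] u in \<open>simp_all add: ev ck_cauchy_intros\<close>)
    fix Y assume "Y \<in> carrier (CK_algebra A)"
    then obtain v where v: "v \<in> ck_cauchy A" "Y = ck_class A v" by (rule CK_carrierE)
    note tv = \<pi>t[OF v(1)]
    show "\<pi> (X \<oplus>\<^bsub>CK_algebra A\<^esub> Y) = \<pi> X \<oplus> \<pi> Y"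
      unfolding u v CK_add[OF u(1) v(1)]
      by (rule \<pi>) (use tends_add[OF tu tv] u v in \<open>simp_all add: ev ck_cauchy_intros\<close>)
    show "\<pi> (X \<otimes>\<^bsub>CK_algebra A\<^esub> Y) = \<pi> X \<otimes> \<pi> Y"
      unfolding u v CK_mult[OF u(1) v(1)]
      by (rule \<pi>) (use tends_mult[OF tu tv] u v in \<open>simp_all add: ev ck_cauchy_intros\<close>)
  next
    show "\<pi> \<one>\<^bsub>CK_algebra A\<^esub> = \<one>"
      unfolding CK_one by (rule \<pi>) (simp_all add: ev tends_const)
  qed
  moreover have "\<pi> (ck_gen A i) = t i" for i
    unfolding ck_gen_def by (rule \<pi>) (simp_all add: ev tends_const t)
  ultimately show ?thesis by blast
qed

end

context
  fixes A :: "int ^ 'n ^ 'n"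
begin

private abbreviation (input) "OA \<equiv> CK_algebra A"
private abbreviation (input) "c \<equiv> \<lambda>a. ck_class A (\<lambda>_. a)"

private lemma c_in: "c a \<in> carrier OA"
  by (simp add: ck_class_in_carrier)

private lemma c_ops:
  "c a \<oplus>\<^bsub>OA\<^esub> c b = c (a + b)" "c a \<otimes>\<^bsub>OA\<^esub> c b = c (a * b)" "k \<odot>\<^bsub>OA\<^esub> c a = c (free_scale k a)"
  "star OA (c a) = c (free_star a)" "\<zero>\<^bsub>OA\<^esub> = c 0" "\<one>\<^bsub>OA\<^esub> = c 1"
  by (simp_all add: CK_ops)

private lemma c_sum: "finite S \<Longrightarrow> (\<Oplus>\<^bsub>OA\<^esub>i\<in>S. c (f i)) = c (\<Sum>i\<in>S. f i)"
proof (induction S rule: finite_induct)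
  case empty
  interpret cstar_algebra OA by (rule CK_cstar_algebra)
  show ?case by (simp add: c_ops(5))
next
  case (insert x S)
  interpret cstar_algebra OA by (rule CK_cstar_algebra)
  from insert show ?case by (simp add: finsum_insert c_in c_ops(1))
qed

private lemma c_eqI: "a - b \<in> ck_relators A \<Longrightarrow> c a = c b"
  using ck_norm_in_seminorms[of A] by (simp add: ck_class_eq_iff ck_seminorms_def)

lemma CK_gen_family: "ck_family A OA (ck_gen A)"
  unfolding ck_family_def partial_isometry_def ck_gen_def c_ops
proof (intro conjI allI impI c_in)
  fix i j :: 'n
  show "c (free_gen i * free_star (free_gen i) * free_gen i) = c (free_gen i)"
    by (rule c_eqI) (rule ck_relatorsI)
  show "c (free_star (free_gen i) * free_gen j) = c 0" if "i \<noteq> j"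
    by (rule c_eqI) (simp add: ck_relatorsI that)
  show "c (free_star (free_gen i) * free_gen i) =
      (\<Oplus>\<^bsub>OA\<^esub>j\<in>UNIV. c (free_scale (of_int (A $ i $ j)) (free_gen j * free_star (free_gen j))))"
    unfolding c_sum[OF finite] by (rule c_eqI) (rule ck_relatorsI)
  show "(\<Oplus>\<^bsub>OA\<^esub>i\<in>UNIV. c (free_gen i * free_star (free_gen i))) = c 1"
    unfolding c_sum[OF finite] by (rule c_eqI) (rule ck_relatorsI)
qed

private lemma c_in_subalgebra:
  assumes S: "cstar_subalgebra OA S" and g: "range (ck_gen A) \<subseteq> S"
  shows "c a \<in> S"
proof -
  have ops: "c (a + b) \<in> S" "c (a * b) \<in> S" if "c a \<in> S" "c b \<in> S" for a b
    using S that by (simp_all add: cstar_subalgebra_def flip: c_ops(1,2))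
  have op1: "c (free_scale k a) \<in> S" "c (free_star a) \<in> S" if "c a \<in> S" for a k
    using S that by (simp_all add: cstar_subalgebra_def flip: c_ops(3,4))
  have op0: "c 0 \<in> S" using S by (simp add: cstar_subalgebra_def flip: c_ops(5))
  have gen: "c (free_gen i) \<in> S" for i using g by (auto simp: ck_gen_def)
  have sum: "c (\<Sum>i\<in>T. f i) \<in> S" if "\<And>i. c (f i) \<in> S" for f :: "'n \<Rightarrow> 'n free_alg" and T
    by (induction T rule: infinite_finite_induct) (simp_all add: op0 ops that)
  have one: "c 1 \<in> S"
    using sum[of "\<lambda>i. free_gen i * free_star (free_gen i)" UNIV]
    by (simp add: ops op1 gen c_eqI[OF ck_relatorsI(4)])
  have word: "c (Poly_Mapping.single (Monomial ls) 1) \<in> S" for ls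
  proof (induction ls)
    case Nil show ?case using one by (simp flip: zero_monomial_def)
  next
    case (Cons l ls)
    have "c (Poly_Mapping.single (Monomial [l]) 1) \<in> S"
    proof (cases l)
      case (Gen i) then show ?thesis using gen[of i] by (simp add: free_gen_def)
    next
      case (Adj i)
      then have "Poly_Mapping.single (Monomial [l]) 1 = free_star (free_gen i)"
        by (simp add: free_gen_def free_star_single monomial_star_def)
      then show ?thesis using op1(2)[OF gen, of i] by simp
    qed
    from ops(2)[OF this Cons] show ?case by (simp add: mult_single plus_monomial_def)
  qed
  have mono: "c (Poly_Mapping.single w k) \<in> S" for w k
    using op1(1)[OF word, of k "letters w"] by (simp add: free_scale_single)
  show ?thesis by (induction a rule: poly_mapping_add_induct) (simp_all add: op0 ops mono)
qed

lemma CK_limit: assumes "u \<in> ck_cauchy A"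
  shows "(\<lambda>n. nrm OA (c (u n) \<ominus>\<^bsub>OA\<^esub> ck_class A u)) \<longlonglongrightarrow> 0"
proof (rule LIMSEQ_I)
  fix e :: real assume "e > 0"
  have eq: "nrm OA (c a \<ominus>\<^bsub>OA\<^esub> ck_class A u) = nrm OA (ck_class A u \<ominus>\<^bsub>OA\<^esub> c a)" for a
    by (rule cstar_algebra.nrm_minus_commute[OF CK_cstar_algebra]) (simp_all add: ck_class_in_carrier assms)
  have nn: "0 \<le> nrm OA (ck_class A u \<ominus>\<^bsub>OA\<^esub> c a)" for a
    unfolding CK_minus[OF assms ck_cauchy_const]
    by (rule cstar_algebra.nrm_nonneg[OF CK_cstar_algebra])
      (intro ck_class_in_carrier ck_cauchy_diff ck_cauchy_const assms)
  obtain M where "\<forall>n\<ge>M. nrm OA (ck_class A u \<ominus>\<^bsub>OA\<^esub> c (u n)) \<le> e / 2"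
    using CK_dense[OF assms, of "e / 2"] \<open>e > 0\<close> by auto
  then show "\<exists>M. \<forall>n\<ge>M. norm (nrm OA (c (u n) \<ominus>\<^bsub>OA\<^esub> ck_class A u) - 0) < e"
    using \<open>e > 0\<close> by (intro exI[of _ M]) (force simp: eq nn)
qed

lemma CK_generated: "cstar_generated OA (range (ck_gen A)) = carrier OA"
proof
  interpret cstar_algebra OA by (rule CK_cstar_algebra)
  have "cstar_subalgebra OA (carrier OA)"
    by (auto simp: cstar_subalgebra_def star_closed complex_ring_def intro!: scalars.smult_closed)
  moreover have "range (ck_gen A) \<subseteq> carrier OA" by (auto simp: ck_gen_def c_in)
  ultimately show "cstar_generated OA (range (ck_gen A)) \<subseteq> carrier OA"
    by (auto simp: cstar_generated_def)
  have "X \<in> S" if X: "X \<in> carrier OA" and S: "cstar_subalgebra OA S" "range (ck_gen A) \<subseteq> S" for X S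
  proof -
    obtain u where u: "u \<in> ck_cauchy A" "X = ck_class A u" using X by (rule CK_carrierE)
    have "\<forall>v. \<forall>x\<in>carrier OA. (\<forall>n. v n \<in> S) \<and> (\<lambda>n. nrm OA (v n \<ominus>\<^bsub>OA\<^esub> x)) \<longlonglongrightarrow> 0 \<longrightarrow> x \<in> S"
      using S(1) by (simp add: cstar_subalgebra_def)
    from this[rule_format, OF X, of "\<lambda>n. c (u n)"] show ?thesis
      using CK_limit[OF u(1)] c_in_subalgebra[OF S] u(2) by simp
  qed
  then show "carrier OA \<subseteq> cstar_generated OA (range (ck_gen A))"
    by (auto simp: cstar_generated_def)
qed

end

end

theory Submission
  imports Defs
begin

text \<open>
  \<^emph>\<open>Conjugacies and groupoids.\<close> A conjugacy \<open>h\<close> acts on arrows by \<open>(x, n, y) \<mapsto> (h x, n, h y)\<close>. Conversely, an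
  isomorphism of topological groupoids restricts to the units, which are a copy of the shift space on which
  \<^const>\<open>eps\<close> is the shift.

  \<^emph>\<open>How the algebra encodes the shift.\<close> Conjugacies and isomorphisms of the algebras are compared directly.
  In any Cuntz--Krieger family, each set \<open>U\<close> of points that depends on finitely many coordinates has a projection
  \<open>proj U\<close> in the diagonal, and \<open>U \<mapsto> proj U\<close> respects the Boolean operations. With \<open>s = \<Sum>\<^sub>i s\<^sub>i\<close> one has
  \<open>s (proj W) = proj (\<sigma>\<^sup>-\<^sup>1 W) s\<close>, and \<open>(proj U) s s\<^sup>* (proj U) = proj U\<close> when \<open>\<sigma>\<close> is injective on \<open>U\<close>. Hence, for such \<open>U\<close>,
  \<open>(proj U) \<tau>(proj W) (proj U) = proj (U \<inter> \<sigma>\<^sup>-\<^sup>1 W)\<close> (\<open>corner_tau\<close>): locally, \<open>\<tau>\<close> on the diagonal is composition with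
  the shift.

  \<^emph>\<open>From a conjugacy to an isomorphism.\<close> Since \<open>s\<^sub>i = (proj Z\<^sub>i) s\<close> for the set \<open>Z\<^sub>i\<close> of points that start with \<open>i\<close>,
  an isomorphism that extends \<open>proj U \<mapsto> proj (h U)\<close> and sends \<open>s\<close> to \<open>s\<close> has to send \<open>s\<^sub>i\<close> to
  \<open>(proj (h Z\<^sub>i)) s\<close>. These elements satisfy the relations (\<open>ck_family_gen_image\<close>), so the universal property
  provides a homomorphism, which intertwines the maps \<open>\<tau>\<close> because it sends \<open>s\<close> to \<open>s\<close>; the homomorphism of \<open>h\<^sup>-\<^sup>1\<close> is
  inverse to it on generators. To pass from generators to the closed algebras that they generate one
  needs that homomorphisms are continuous (\<open>hom_contractive\<close>).

  \<^emph>\<open>From an isomorphism to a conjugacy.\<close> The projections in the diagonal are exactly the \<open>proj U\<close>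
  (\<open>diagonal_projection\<close>), and \<open>proj U\<close> vanishes only for empty \<open>U\<close>, because the algebra acts on
  functions on the shift space (\<open>ck_word_nrm\<close>). So an isomorphism of the algebras that preserves the diagonals matches the clopen
  sets of the two shift spaces, and Stone duality (\<open>stone_map\<close>) turns the matching into a homeomorphism. It is a
  conjugacy because \<open>corner_tau\<close> recovers the sets \<open>\<sigma>\<^sup>-\<^sup>1 W\<close> from \<open>\<tau>\<close>.
\<close>

section \<open>Conjugacies and groupoid isomorphisms\<close>

lemma topspace_shift_topology [simp]: "topspace (shift_topology A) = shift_space A"
  by (simp add: shift_topology_def)

lemma shift_in_shift_space: "x \<in> shift_space A \<Longrightarrow> shift x \<in> shift_space A"
  by (simp add: shift_space_def shift_def)

lemma funpow_shift_in_shift_space: "x \<in> shift_space A \<Longrightarrow> (shift ^^ k) x \<in> shift_space A"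
  by (induction k) (simp_all add: shift_in_shift_space)

lemma shift_groupoid_simps [simp]:
  "arrows (shift_groupoid A) = shift_arrows A"
  "src (shift_groupoid A) (x, n, y) = (y, 0, y)"
  "rng (shift_groupoid A) (x, n, y) = (x, 0, x)"
  "gmul (shift_groupoid A) (x, n, y) (z, m, w) = (x, n + m, w)"
  "ginv (shift_groupoid A) (x, n, y) = (y, - n, x)"
  by (simp_all add: shift_groupoid_def)

lemma shift_arrowsE:
  assumes "g \<in> shift_arrows A"
  obtains x k l y where "g = (x, int k - int l, y)" "x \<in> shift_space A" "y \<in> shift_space A"
    "(shift ^^ k) x = (shift ^^ l) y"
  using assms by (auto simp: shift_arrows_def)

lemma shift_arrowsI:
  "x \<in> shift_space A \<Longrightarrow> y \<in> shift_space A \<Longrightarrow> (shift ^^ k) x = (shift ^^ l) y \<Longrightarrow>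
    n = int k - int l \<Longrightarrow> (x, n, y) \<in> shift_arrows A"
  by (auto simp: shift_arrows_def)

lemma gmul_in:
  assumes "g \<in> shift_arrows A" "g' \<in> shift_arrows A" "src (shift_groupoid A) g = rng (shift_groupoid A) g'"
  shows "gmul (shift_groupoid A) g g' \<in> shift_arrows A"
proof -
  obtain x k l y where g: "g = (x, int k - int l, y)" "x \<in> shift_space A" "(shift ^^ k) x = (shift ^^ l) y"
    using assms(1) by (rule shift_arrowsE)
  obtain k' l' y' z where g': "g' = (y', int k' - int l', z)" "z \<in> shift_space A"
    "(shift ^^ k') y' = (shift ^^ l') z"
    using assms(2) by (rule shift_arrowsE)
  have y: "y' = y" using assms(3) by (simp add: g g')
  have "(shift ^^ (k + k')) x = (shift ^^ k') ((shift ^^ k) x)"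
    by (metis add.commute comp_apply funpow_add)
  also have "\<dots> = (shift ^^ (l + k')) y" by (metis g(3) add.commute comp_apply funpow_add)
  also have "\<dots> = (shift ^^ (l + l')) z" by (metis g'(3) y comp_apply funpow_add)
  finally have "(x, int k - int l + (int k' - int l'), z) \<in> shift_arrows A"
    by (intro shift_arrowsI[of _ _ _ "k + k'" "l + l'"] g g') simp_all
  then show ?thesis by (simp add: g g')
qed

lemma ginv_in:
  assumes "g \<in> shift_arrows A" shows "ginv (shift_groupoid A) g \<in> shift_arrows A"
proof -
  obtain x k l y where g: "g = (x, int k - int l, y)" "x \<in> shift_space A" "y \<in> shift_space A"
    "(shift ^^ k) x = (shift ^^ l) y"
    using assms by (rule shift_arrowsE)
  then have "(y, - (int k - int l), x) \<in> shift_arrows A"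
    by (intro shift_arrowsI[of _ _ _ l k]) simp_all
  then show ?thesis by (simp add: g)
qed

lemma one_sided_conjugacy_bij:
  assumes "one_sided_conjugacy A B h"
  shows "bij_betw h (shift_space A) (shift_space B)"
  using assms by (simp add: one_sided_conjugacy_def homeomorphic_eq_everything_map bij_betw_def)

lemma one_sided_conjugacy_inverse:
  assumes "one_sided_conjugacy A B h"
  obtains h' where "one_sided_conjugacy B A h'"
    "\<And>x. x \<in> shift_space A \<Longrightarrow> h' (h x) = x" "\<And>y. y \<in> shift_space B \<Longrightarrow> h (h' y) = y"
proof -
  obtain h' where "homeomorphic_maps (shift_topology A) (shift_topology B) h h'"
    using assms by (auto simp: one_sided_conjugacy_def homeomorphic_map_maps)
  then have hom: "homeomorphic_map (shift_topology B) (shift_topology A) h'"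
    and inv: "\<And>x. x \<in> shift_space A \<Longrightarrow> h' (h x) = x" "\<And>y. y \<in> shift_space B \<Longrightarrow> h (h' y) = y"
    by (auto simp: homeomorphic_maps_map)
  have h': "h' ` shift_space B \<subseteq> shift_space A"
    using hom by (simp add: homeomorphic_eq_everything_map)
  have "h' (shift y) = shift (h' y)" if "y \<in> shift_space B" for y
  proof -
    have "h (shift (h' y)) = shift y"
      using assms that h' inv by (auto simp: one_sided_conjugacy_def)
    then show ?thesis using inv(1)[of "shift (h' y)"] h' that by (auto simp: shift_in_shift_space)
  qed
  with hom have "one_sided_conjugacy B A h'" by (simp add: one_sided_conjugacy_def)
  with inv show thesis using that by blast
qed

lemma one_sided_conjugacy_funpow:
  assumes "one_sided_conjugacy A B h" "x \<in> shift_space A"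
  shows "h ((shift ^^ k) x) = (shift ^^ k) (h x)"
  using assms(1)
  by (induction k) (simp_all add: one_sided_conjugacy_def funpow_shift_in_shift_space[OF assms(2)])

definition arrow_map :: "((nat \<Rightarrow> 'm) \<Rightarrow> nat \<Rightarrow> 'n) \<Rightarrow> 'm arrow \<Rightarrow> 'n arrow" where
  "arrow_map h = (\<lambda>(x, n, y). (h x, n, h y))"

lemma arrow_map_simps [simp]: "arrow_map h (x, n, y) = (h x, n, h y)"
  by (simp add: arrow_map_def)

lemma arrow_map_in:
  assumes "one_sided_conjugacy A B h"
  shows "arrow_map h \<in> shift_arrows A \<rightarrow> shift_arrows B"
proof -
  have "h x \<in> shift_space B" if "x \<in> shift_space A" for x
    using one_sided_conjugacy_bij[OF assms] that by (auto simp: bij_betw_def)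
  moreover have "\<exists>k' l'. int k - int l = int k' - int l' \<and> (shift ^^ k') (h x) = (shift ^^ l') (h y)"
    if "x \<in> shift_space A" "y \<in> shift_space A" "(shift ^^ k) x = (shift ^^ l) y" for x y k l
    using that by (intro exI[of _ k] exI[of _ l])
      (simp flip: one_sided_conjugacy_funpow[OF assms])
  ultimately show ?thesis by (auto simp: shift_arrows_def)
qed

lemma groupoid_hom_arrow_map:
  assumes "one_sided_conjugacy A B h"
  shows "groupoid_hom (shift_groupoid A) (shift_groupoid B) (arrow_map h)"
  using arrow_map_in[OF assms] by (auto simp: groupoid_hom_def)

text \<open>As \<open>h\<close> commutes with the powers of the shift, the preimage of \<open>Z(U, k, l, V)\<close> is \<open>Z(h\<^sup>-\<^sup>1 U, k, l, h\<^sup>-\<^sup>1 V)\<close>,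
  and this is again a set of the basis.\<close>

lemma continuous_map_arrow_map:
  assumes "one_sided_conjugacy A B h"
  shows "continuous_map (gtop (shift_groupoid A)) (gtop (shift_groupoid B)) (arrow_map h)"
proof -
  obtain h' where h': "one_sided_conjugacy B A h'"
    and inv: "\<And>x. x \<in> shift_space A \<Longrightarrow> h' (h x) = x" "\<And>y. y \<in> shift_space B \<Longrightarrow> h (h' y) = y"
    using one_sided_conjugacy_inverse[OF assms] by metis
  have hin: "h x \<in> shift_space B" if "x \<in> shift_space A" for x
    using one_sided_conjugacy_bij[OF assms] that by (auto simp: bij_betw_def)
  have h'in: "h' y \<in> shift_space A" if "y \<in> shift_space B" for y
    using one_sided_conjugacy_bij[OF h'] that by (auto simp: bij_betw_def)
  have cont: "continuous_map (shift_topology A) (shift_topology B) h"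
    using assms by (simp add: one_sided_conjugacy_def homeomorphic_imp_continuous_map)
  have "openin (gtop (shift_groupoid A)) (arrow_map h -` Z \<inter> topspace (gtop (shift_groupoid A)))"
    if Z: "Z \<in> Zbasis B" for Z
  proof -
    obtain U k l V where UV: "Z = Zset B U k l V" "openin (shift_topology B) U" "openin (shift_topology B) V"
      "inj_on (shift ^^ k) U" "inj_on (shift ^^ l) V" "(shift ^^ k) ` U = (shift ^^ l) ` V"
      using Z by (auto simp: Zbasis_def)
    define pre where "pre W = {x \<in> shift_space A. h x \<in> W}" for W
    have open_pre: "openin (shift_topology A) (pre W)" if "openin (shift_topology B) W" for W
      using openin_continuous_map_preimage[OF cont that] by (simp add: pre_def)
    have sub: "U \<subseteq> shift_space B" "V \<subseteq> shift_space B"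
      using UV(2,3) openin_subset by fastforce+
    have inj_pre: "inj_on (shift ^^ j) (pre W)" if "inj_on (shift ^^ j) W" for j W
    proof (rule inj_onI)
      fix x y assume xy: "x \<in> pre W" "y \<in> pre W" "(shift ^^ j) x = (shift ^^ j) y"
      then have "(shift ^^ j) (h x) = (shift ^^ j) (h y)"
        using one_sided_conjugacy_funpow[OF assms, of _ j] by (auto simp: pre_def) metis
      then have "h x = h y" using that xy by (auto simp: pre_def inj_on_def)
      then show "x = y" using xy inv(1) by (auto simp: pre_def) metis
    qed
    have image_pre: "(shift ^^ j) ` pre W = h' ` (shift ^^ j) ` W" if "W \<subseteq> shift_space B" for j W
    proof -
      have "pre W = h' ` W" using that inv hin h'in by (force simp: pre_def image_iff)
      moreover have "(shift ^^ j) ` h' ` W = h' ` (shift ^^ j) ` W"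
        using that one_sided_conjugacy_funpow[OF h', of _ j] by (auto simp: image_image subset_iff)
      ultimately show ?thesis by simp
    qed
    have "arrow_map h -` Z \<inter> shift_arrows A = Zset A (pre U) k l (pre V)"
    proof (intro equalityI subsetI)
      fix g assume "g \<in> arrow_map h -` Z \<inter> shift_arrows A"
      moreover obtain x n y where g: "g = (x, n, y)" by (cases g)
      ultimately have *: "(x, n, y) \<in> shift_arrows A" "x \<in> shift_space A" "y \<in> shift_space A"
        "h x \<in> U" "h y \<in> V" "n = int k - int l"
        "(shift ^^ k) (h x) = (shift ^^ l) (h y)" by (auto simp: UV(1) Zset_def shift_arrows_def)
      then have "h ((shift ^^ k) x) = h ((shift ^^ l) y)"
        by (simp add: one_sided_conjugacy_funpow[OF assms])
      then have "(shift ^^ k) x = (shift ^^ l) y"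
        using inv(1) funpow_shift_in_shift_space *(2,3) by metis
      then show "g \<in> Zset A (pre U) k l (pre V)" using * by (simp add: g Zset_def pre_def)
    next
      fix g assume "g \<in> Zset A (pre U) k l (pre V)"
      moreover obtain x n y where g: "g = (x, n, y)" by (cases g)
      ultimately have *: "(x, n, y) \<in> shift_arrows A" "x \<in> shift_space A" "y \<in> shift_space A"
        "h x \<in> U" "h y \<in> V" "n = int k - int l"
        "(shift ^^ k) x = (shift ^^ l) y" by (auto simp: Zset_def pre_def)
      moreover from this have "(shift ^^ k) (h x) = (shift ^^ l) (h y)"
        by (simp flip: one_sided_conjugacy_funpow[OF assms])
      moreover have "(h x, n, h y) \<in> shift_arrows B" using funcset_mem[OF arrow_map_in[OF assms] *(1)] by simp
      ultimately show "g \<in> arrow_map h -` Z \<inter> shift_arrows A" by (simp add: g UV(1) Zset_def)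
    qed
    moreover have "Zset A (pre U) k l (pre V) \<in> Zbasis A"
      unfolding Zbasis_def mem_Collect_eq
      by (intro exI[of _ "pre U"] exI[of _ k] exI[of _ l] exI[of _ "pre V"])
        (simp add: open_pre inj_pre image_pre sub UV)
    ultimately show ?thesis
      by (simp add: topspace_shift_groupoid) (simp add: shift_groupoid_def topology_generated_by_Basis)
  qed
  moreover have "arrow_map h ` topspace (gtop (shift_groupoid A)) \<subseteq> \<Union> (Zbasis B)"
    using arrow_map_in[OF assms] topspace_shift_groupoid[of A] topspace_shift_groupoid[of B]
    by (simp add: shift_groupoid_def image_subset_iff_funcset)
  ultimately show ?thesis
    unfolding shift_groupoid_def[of B] by (simp add: continuous_on_generated_topo_iff)
qed

lemma groupoid_iso_if_conjugacy:
  assumes "one_sided_conjugacy A B h"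
  shows "top_groupoid_iso (shift_groupoid A) (shift_groupoid B) (arrow_map h) \<and>
    (\<forall>g\<in>arrows (shift_groupoid A). arrow_map h (eps g) = eps (arrow_map h g))"
proof -
  obtain h' where h': "one_sided_conjugacy B A h'"
    and inv: "\<And>x. x \<in> shift_space A \<Longrightarrow> h' (h x) = x" "\<And>y. y \<in> shift_space B \<Longrightarrow> h (h' y) = y"
    using one_sided_conjugacy_inverse[OF assms] by metis
  have inv_arr: "arrow_map h' (arrow_map h g) = g" if "g \<in> shift_arrows A" for g
    using that inv by (cases g) (auto simp: shift_arrows_def)
  have inv_arr': "arrow_map h (arrow_map h' g) = g" if "g \<in> shift_arrows B" for g
    using that inv by (cases g) (auto simp: shift_arrows_def)
  have bij: "bij_betw (arrow_map h) (shift_arrows A) (shift_arrows B)"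
    by (rule bij_betw_byWitness[where f' = "arrow_map h'"])
      (use inv_arr inv_arr' arrow_map_in[OF assms] arrow_map_in[OF h'] in \<open>auto simp: image_subset_iff_funcset simp del: arrow_map_simps\<close>)
  have eq: "inv_into (shift_arrows A) (arrow_map h) g = arrow_map h' g" if "g \<in> shift_arrows B" for g
    using that inv_arr' bij arrow_map_in[OF h'] by (intro inv_into_f_eq) (auto simp: bij_betw_def)
  have "groupoid_hom (shift_groupoid B) (shift_groupoid A) (inv_into (shift_arrows A) (arrow_map h))"
    unfolding groupoid_hom_def shift_groupoid_simps(1)
  proof (intro conjI ballI impI)
    show "inv_into (shift_arrows A) (arrow_map h) \<in> shift_arrows B \<rightarrow> shift_arrows A"
      using eq arrow_map_in[OF h'] by (simp add: Pi_iff)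
    fix g assume g: "g \<in> shift_arrows B"
    show "inv_into (shift_arrows A) (arrow_map h) (ginv (shift_groupoid B) g) =
        ginv (shift_groupoid A) (inv_into (shift_arrows A) (arrow_map h) g)"
      using groupoid_hom_arrow_map[OF h'] ginv_in[OF g] g
      by (simp add: groupoid_hom_def eq)
    fix g' assume g': "g' \<in> shift_arrows B" and comp: "src (shift_groupoid B) g = rng (shift_groupoid B) g'"
    have "src (shift_groupoid A) (arrow_map h' g) = rng (shift_groupoid A) (arrow_map h' g') \<and>
        arrow_map h' (gmul (shift_groupoid B) g g') = gmul (shift_groupoid A) (arrow_map h' g) (arrow_map h' g')"
      using groupoid_hom_arrow_map[OF h'] g g' comp by (simp add: groupoid_hom_def)
    then show "src (shift_groupoid A) (inv_into (shift_arrows A) (arrow_map h) g) =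
          rng (shift_groupoid A) (inv_into (shift_arrows A) (arrow_map h) g')"
      "inv_into (shift_arrows A) (arrow_map h) (gmul (shift_groupoid B) g g') =
          gmul (shift_groupoid A) (inv_into (shift_arrows A) (arrow_map h) g) (inv_into (shift_arrows A) (arrow_map h) g')"
      by (simp_all add: eq g g' gmul_in[OF g g' comp])
  qed
  then have "groupoid_iso (shift_groupoid A) (shift_groupoid B) (arrow_map h)"
    using bij groupoid_hom_arrow_map[OF assms] by (simp add: groupoid_iso_def)
  moreover have "homeomorphic_maps (gtop (shift_groupoid A)) (gtop (shift_groupoid B)) (arrow_map h) (arrow_map h')"
    using continuous_map_arrow_map[OF assms] continuous_map_arrow_map[OF h'] inv_arr inv_arr'
    by (simp add: homeomorphic_maps_def topspace_shift_groupoid)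
  moreover have "arrow_map h (eps g) = eps (arrow_map h g)" if "g \<in> shift_arrows A" for g
    using assms that by (cases g) (auto simp: eps_def one_sided_conjugacy_def shift_arrows_def)
  ultimately show ?thesis by (auto simp: top_groupoid_iso_def homeomorphic_map_maps)
qed

text \<open>A set \<open>Z(U, k, l, V)\<close> contains units only if \<open>k = l\<close>, and then they are the points of \<open>U \<inter> V\<close>.\<close>

lemma continuous_map_unit_embedding:
  "continuous_map (shift_topology A) (gtop (shift_groupoid A)) (\<lambda>x. (x, 0, x))"
proof -
  have units: "(x, 0, x) \<in> shift_arrows A" if "x \<in> shift_space A" for x
    using that by (auto simp: shift_arrows_def)
  have "openin (shift_topology A) ((\<lambda>x. (x, 0, x)) -` Z \<inter> topspace (shift_topology A))"
    if Z: "Z \<in> Zbasis A" for Z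
  proof -
    obtain U k l V where UV: "Z = Zset A U k l V" "openin (shift_topology A) U" "openin (shift_topology A) V"
      using Z by (auto simp: Zbasis_def)
    have "U \<subseteq> shift_space A" using UV(2) openin_subset by fastforce
    then have "(\<lambda>x. (x, 0, x)) -` Z \<inter> topspace (shift_topology A) = (if k = l then U \<inter> V else {})"
      using units by (auto simp: UV(1) Zset_def)
    then show ?thesis using UV by (auto simp: openin_Int)
  qed
  moreover have "(\<lambda>x. (x, 0, x)) ` topspace (shift_topology A) \<subseteq> \<Union> (Zbasis A)"
    using units topspace_shift_groupoid[of A] by (auto simp: shift_groupoid_def)
  ultimately show ?thesis
    unfolding shift_groupoid_def by (simp add: continuous_on_generated_topo_iff)
qed

lemma continuous_map_range:
  "continuous_map (gtop (shift_groupoid A)) (shift_topology A) fst"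
  unfolding continuous_map_def
proof (intro conjI allI impI)
  show "fst \<in> topspace (gtop (shift_groupoid A)) \<rightarrow> topspace (shift_topology A)"
    by (auto simp: topspace_shift_groupoid shift_arrows_def)
  fix U assume U: "openin (shift_topology A) U"
  show "openin (gtop (shift_groupoid A)) {g \<in> topspace (gtop (shift_groupoid A)). fst g \<in> U}"
    unfolding openin_shift_groupoid
  proof
    fix g assume "g \<in> {g \<in> topspace (gtop (shift_groupoid A)). fst g \<in> U}"
    then have gA: "g \<in> shift_arrows A" and gU: "fst g \<in> U"
      by (auto simp: topspace_shift_groupoid)
    then obtain x k l y where g: "g = (x, int k - int l, y)" "(shift ^^ k) x = (shift ^^ l) y"
      "x \<in> shift_space A" "y \<in> shift_space A" by (auto simp: shift_arrows_def)
    obtain m where m: "\<And>j. j \<ge> m \<Longrightarrow> cylinder A (fst g) j \<subseteq> U"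
      using open_contains_cylinder[OF U gU] by blast
    \<comment> \<open>Lengthening both prefixes by \<open>m\<close> keeps the degree and pushes the left one into \<open>U\<close>.\<close>
    have e: "(shift ^^ (k + m)) x = (shift ^^ (l + m)) y"
      by (simp add: add.commute[of _ m] funpow_add g(2))
    have "Zcyl A x (k + m) (l + m) y \<in> Zbasis A"
      using g e by (intro Zcyl_in_Zbasis)
    moreover have "g \<in> Zcyl A x (k + m) (l + m) y"
      using g gA e by (simp add: Zcyl_def Zset_def cylinder_def)
    moreover have "cylinder A x (Suc (k + m)) \<subseteq> U" using m[of "Suc (k + m)"] g by simp
    then have "Zcyl A x (k + m) (l + m) y \<subseteq> {g \<in> topspace (gtop (shift_groupoid A)). fst g \<in> U}"
      by (auto simp: Zcyl_def Zset_def topspace_shift_groupoid)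
    ultimately show "\<exists>Z\<in>Zbasis A. g \<in> Z \<and> Z \<subseteq> {g \<in> topspace (gtop (shift_groupoid A)). fst g \<in> U}"
      by blast
  qed
qed

text \<open>Units are the arrows that are composable with themselves and equal to their square: adding the
  degrees forces degree \<open>0\<close>.\<close>

lemma groupoid_hom_unit:
  assumes "groupoid_hom (shift_groupoid A) (shift_groupoid B) \<Phi>" "x \<in> shift_space A"
  shows "\<exists>y\<in>shift_space B. \<Phi> (x, 0, x) = (y, 0, y)"
proof -
  have u: "(x, 0, x) \<in> shift_arrows A" using assms(2) by (auto simp: shift_arrows_def)
  obtain y n z where y: "\<Phi> (x, 0, x) = (y, n, z)" by (cases "\<Phi> (x, 0, x)")
  have "\<Phi> (x, 0, x) \<in> shift_arrows B" using assms(1) u by (auto simp: groupoid_hom_def)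
  moreover have "src (shift_groupoid B) (\<Phi> (x, 0, x)) = rng (shift_groupoid B) (\<Phi> (x, 0, x))"
    "\<Phi> (x, 0, x) = gmul (shift_groupoid B) (\<Phi> (x, 0, x)) (\<Phi> (x, 0, x))"
    using assms(1) u unfolding groupoid_hom_def by force+
  ultimately show ?thesis by (auto simp: y shift_arrows_def)
qed

text \<open>On units \<open>\<Phi>\<close> is a map of points. It is continuous because the units carry the topology of the shift
  space and the range map is continuous, and \<open>\<Phi>\<^sup>-\<^sup>1\<close> provides its inverse.\<close>

lemma conjugacy_if_groupoid_iso:
  assumes iso: "top_groupoid_iso (shift_groupoid A) (shift_groupoid B) \<Phi>"
    and eps: "\<forall>g\<in>arrows (shift_groupoid A). \<Phi> (eps g) = eps (\<Phi> g)"
  shows "one_sided_conjugacy A B (\<lambda>x. fst (\<Phi> (x, 0, x)))"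
proof -
  let ?\<Psi> = "inv_into (shift_arrows A) \<Phi>"
  let ?h = "\<lambda>x. fst (\<Phi> (x, 0, x))" and ?h' = "\<lambda>y. fst (?\<Psi> (y, 0, y))"
  have bij: "bij_betw \<Phi> (shift_arrows A) (shift_arrows B)"
    and hom: "groupoid_hom (shift_groupoid A) (shift_groupoid B) \<Phi>"
      "groupoid_hom (shift_groupoid B) (shift_groupoid A) ?\<Psi>"
    and homeo: "homeomorphic_map (gtop (shift_groupoid A)) (gtop (shift_groupoid B)) \<Phi>"
    using iso by (auto simp: top_groupoid_iso_def groupoid_iso_def)
  have unitA: "(x, 0, x) \<in> shift_arrows A" if "x \<in> shift_space A" for x
    using that by (auto simp: shift_arrows_def)
  have unitB: "(y, 0, y) \<in> shift_arrows B" if "y \<in> shift_space B" for y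
    using that by (auto simp: shift_arrows_def)
  have \<Phi>: "\<Phi> (x, 0, x) = (?h x, 0, ?h x)" if "x \<in> shift_space A" for x
    using groupoid_hom_unit[OF hom(1) that] by auto
  have \<Psi>: "?\<Psi> (y, 0, y) = (?h' y, 0, ?h' y)" if "y \<in> shift_space B" for y
    using groupoid_hom_unit[OF hom(2) that] by auto
  have inv: "?\<Psi> (\<Phi> g) = g" if "g \<in> shift_arrows A" for g
    using bij that by (simp add: bij_betw_def)
  have inv': "\<Phi> (?\<Psi> g) = g" if "g \<in> shift_arrows B" for g
    using bij that by (simp add: bij_betw_def f_inv_into_f)
  obtain \<Psi>' where \<Psi>': "homeomorphic_maps (gtop (shift_groupoid A)) (gtop (shift_groupoid B)) \<Phi> \<Psi>'"
    using homeo by (auto simp: homeomorphic_map_maps)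
  have cont: "continuous_map (gtop (shift_groupoid A)) (gtop (shift_groupoid B)) \<Phi>"
    using \<Psi>' by (simp add: homeomorphic_maps_def)
  have cont': "continuous_map (gtop (shift_groupoid B)) (gtop (shift_groupoid A)) ?\<Psi>"
  proof (rule continuous_map_eq)
    show "continuous_map (gtop (shift_groupoid B)) (gtop (shift_groupoid A)) \<Psi>'"
      using \<Psi>' by (simp add: homeomorphic_maps_def)
    fix g assume "g \<in> topspace (gtop (shift_groupoid B))"
    then have "\<Psi>' g \<in> shift_arrows A" "\<Phi> (\<Psi>' g) = g"
      using \<Psi>' by (auto simp: homeomorphic_maps_def topspace_shift_groupoid continuous_map_def)
    then show "\<Psi>' g = ?\<Psi> g" using inv by metis
  qed
  have c: "continuous_map (shift_topology A) (shift_topology B) ?h"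
    using continuous_map_compose[OF continuous_map_compose[OF continuous_map_unit_embedding cont] continuous_map_range]
    by (simp add: comp_def)
  have c': "continuous_map (shift_topology B) (shift_topology A) ?h'"
    using continuous_map_compose[OF continuous_map_compose[OF continuous_map_unit_embedding cont'] continuous_map_range]
    by (simp add: comp_def)
  have hin: "?h x \<in> shift_space B" if "x \<in> shift_space A" for x
    using c that by (auto simp: continuous_map_def)
  have h'in: "?h' y \<in> shift_space A" if "y \<in> shift_space B" for y
    using c' that by (auto simp: continuous_map_def)
  have "?h' (?h x) = x" if "x \<in> shift_space A" for x
    using inv[OF unitA[OF that]] \<Phi>[OF that] by (metis fst_conv)
  moreover have "?h (?h' y) = y" if "y \<in> shift_space B" for y
    using inv'[OF unitB[OF that]] \<Psi>[OF that] by (metis fst_conv)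
  ultimately have "homeomorphic_maps (shift_topology A) (shift_topology B) ?h ?h'"
    using c c' by (simp add: homeomorphic_maps_def)
  moreover have "?h (shift x) = shift (?h x)" if "x \<in> shift_space A" for x
  proof -
    have "\<Phi> (eps (x, 0, x)) = eps (\<Phi> (x, 0, x))" using eps unitA[OF that] by simp
    moreover obtain y where "\<Phi> (x, 0, x) = (y, 0, y)" using groupoid_hom_unit[OF hom(1) \<open>x \<in> _\<close>] by blast
    ultimately show ?thesis by (simp add: eps_def)
  qed
  ultimately show ?thesis by (auto simp: one_sided_conjugacy_def homeomorphic_map_maps)
qed


section \<open>Homomorphisms of C*-algebras are contractive\<close>

context cstar_algebra
begin

lemma tends_Suc: "tends u x \<Longrightarrow> tends (\<lambda>n. u (Suc n)) x"
  unfolding tends_def using LIMSEQ_Suc by fast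

lemma nrm_one_le: "nrm \<AA> \<one> \<le> 1"
proof -
  have "nrm \<AA> \<one> * nrm \<AA> \<one> = nrm \<AA> \<one>"
    using cstar_identity[of \<one>] by (simp add: star_one power2_eq_square)
  then show ?thesis by auto
qed

lemma square_difference:
  assumes [simp]: "u \<in> carrier \<AA>" "v \<in> carrier \<AA>"
  shows "u \<otimes> u \<ominus> v \<otimes> v = u \<otimes> (u \<ominus> v) \<oplus> (u \<ominus> v) \<otimes> v"
proof -
  have "u \<otimes> (u \<ominus> v) \<oplus> (u \<ominus> v) \<otimes> v = u \<otimes> u \<oplus> (\<ominus> (u \<otimes> v) \<oplus> (u \<otimes> v \<oplus> \<ominus> (v \<otimes> v)))"
    by (simp add: a_minus_def r_distr l_distr r_minus l_minus a_assoc)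
  then show ?thesis by (simp add: a_minus_def r_neg1)
qed

lemma add_minus_cancel:
  assumes [simp]: "b \<in> carrier \<AA>" "u \<in> carrier \<AA>" "v \<in> carrier \<AA>"
  shows "(b \<oplus> u) \<ominus> (b \<oplus> v) = u \<ominus> v"
proof -
  have "(b \<oplus> u) \<ominus> (b \<oplus> v) = (b \<oplus> \<ominus> b) \<oplus> (u \<oplus> \<ominus> v)" by (simp add: a_minus_def minus_add a_ac del: r_neg)
  then show ?thesis by (simp add: r_neg a_minus_def)
qed

text \<open>The Lipschitz estimate for the iteration \<open>z \<mapsto> (a + z\<^sup>2) / 2\<close>. It comes from \<open>u\<^sup>2 - v\<^sup>2 = u (u - v) + (u - v) v\<close>, which
  holds for arbitrary \<open>u\<close> and \<open>v\<close>.\<close>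

lemma half_square_lipschitz:
  assumes [simp]: "a \<in> carrier \<AA>" "u \<in> carrier \<AA>" "v \<in> carrier \<AA>"
  shows "nrm \<AA> ((1 / 2) \<odot> (a \<oplus> u \<otimes> u) \<ominus> (1 / 2) \<odot> (a \<oplus> v \<otimes> v)) \<le>
    (nrm \<AA> u * nrm \<AA> (u \<ominus> v) + nrm \<AA> (u \<ominus> v) * nrm \<AA> v) / 2"
proof -
  have "nrm \<AA> ((1 / 2) \<odot> (a \<oplus> u \<otimes> u) \<ominus> (1 / 2) \<odot> (a \<oplus> v \<otimes> v)) = nrm \<AA> (u \<otimes> (u \<ominus> v) \<oplus> (u \<ominus> v) \<otimes> v) / 2"
    by (simp add: add_minus_cancel square_difference nrm_smult flip: smult_minus)
  then show ?thesis
    using nrm_triangle[of "u \<otimes> (u \<ominus> v)" "(u \<ominus> v) \<otimes> v"] nrm_mult[of u "u \<ominus> v"] nrm_mult[of "u \<ominus> v" v]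
    by simp
qed

text \<open>If \<open>\<parallel>a\<parallel> < 1\<close>, then \<open>y = 1 - z\<close> is a square root of \<open>1 - a\<close> as soon as \<open>z = (a + z\<^sup>2) / 2\<close>.
  The right-hand side is a contraction of the ball of radius \<open>1 - sqrt (1 - \<parallel>a\<parallel>)\<close>, and its
  iterates from \<open>0\<close> are polynomials in \<open>a\<close>, so \<open>z\<close> commutes with everything that commutes with \<open>a\<close>.\<close>

primrec sqrt_iter :: "'a \<Rightarrow> nat \<Rightarrow> 'a" where
  "sqrt_iter a 0 = \<zero>"
| "sqrt_iter a (Suc n) = (1 / 2) \<odot> (a \<oplus> sqrt_iter a n \<otimes> sqrt_iter a n)"

lemma sqrt_iter_in [simp]: "a \<in> carrier \<AA> \<Longrightarrow> sqrt_iter a n \<in> carrier \<AA>"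
  by (induction n) auto

lemma sqrt_iter_star: "a \<in> carrier \<AA> \<Longrightarrow> star \<AA> a = a \<Longrightarrow> star \<AA> (sqrt_iter a n) = sqrt_iter a n"
  by (induction n) (simp_all add: star_zero star_smult star_add star_mult)

lemma sqrt_iter_commute:
  assumes "a \<in> carrier \<AA>" "x \<in> carrier \<AA>" "x \<otimes> a = a \<otimes> x"
  shows "x \<otimes> sqrt_iter a n = sqrt_iter a n \<otimes> x"
proof (induction n)
  case 0 then show ?case using assms by simp
next
  case (Suc n)
  have "x \<otimes> (sqrt_iter a n \<otimes> sqrt_iter a n) = sqrt_iter a n \<otimes> sqrt_iter a n \<otimes> x"
    using assms Suc by (metis m_assoc sqrt_iter_in)
  then show ?case using assms
    by (simp add: smult_mult_left smult_mult_right l_distr r_distr)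
qed

declare sqrt_iter.simps(2) [simp del]

lemma sqrt_one_minus:
  assumes a [simp]: "a \<in> carrier \<AA>" and sa: "star \<AA> a = a" and na: "nrm \<AA> a < 1"
  obtains y where "y \<in> carrier \<AA>" "star \<AA> y = y" "y \<otimes> y = \<one> \<ominus> a"
    "\<And>x. x \<in> carrier \<AA> \<Longrightarrow> x \<otimes> a = a \<otimes> x \<Longrightarrow> x \<otimes> y = y \<otimes> x"
proof -
  let ?z = "sqrt_iter a"
  define r where "r = 1 - sqrt (1 - nrm \<AA> a)"
  have r: "0 \<le> r" "r < 1" "(nrm \<AA> a + r * r) / 2 = r"
  proof -
    show "0 \<le> r" "r < 1" using na nrm_nonneg[OF a] by (auto simp: r_def)
    have "sqrt (1 - nrm \<AA> a) * sqrt (1 - nrm \<AA> a) = 1 - nrm \<AA> a" using na by simp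
    moreover have "r * r = 1 - 2 * sqrt (1 - nrm \<AA> a) + sqrt (1 - nrm \<AA> a) * sqrt (1 - nrm \<AA> a)"
      by (simp add: r_def algebra_simps)
    ultimately show "(nrm \<AA> a + r * r) / 2 = r" unfolding r_def by (simp only:) (simp add: field_simps)
  qed
  have zr: "nrm \<AA> (?z n) \<le> r" for n
  proof (induction n)
    case 0 show ?case using r by (simp add: nrm_zero)
  next
    case (Suc n)
    have "nrm \<AA> (?z (Suc n)) \<le> (nrm \<AA> a + nrm \<AA> (?z n) * nrm \<AA> (?z n)) / 2"
      using nrm_triangle[of a "?z n \<otimes> ?z n"] nrm_mult[of "?z n" "?z n"]
      by (simp add: nrm_smult sqrt_iter.simps(2))
    also have "\<dots> \<le> (nrm \<AA> a + r * r) / 2"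
      by (intro divide_right_mono add_mono mult_mono Suc r nrm_nonneg) simp_all
    finally show ?case using r by simp
  qed
  have average: "(p * d + d * q) / 2 \<le> r * R" if "p \<le> r" "q \<le> r" "0 \<le> d" "d \<le> R" "0 \<le> q" for p q d R :: real
  proof -
    have "p * d \<le> r * R" "d * q \<le> R * r" using that r by (auto intro!: mult_mono)
    from add_mono[OF this] show ?thesis by (simp add: mult.commute)
  qed
  have step: "nrm \<AA> (?z (Suc n) \<ominus> ?z n) \<le> r ^ n" for n
  proof (induction n)
    case 0
    have "?z (Suc 0) \<ominus> ?z 0 = (1 / 2) \<odot> a" by (simp add: a_minus_def sqrt_iter.simps(2))
    then show ?case using na by (simp add: nrm_smult)
  next
    case (Suc n)
    let ?d = "?z (Suc n) \<ominus> ?z n"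
    have "nrm \<AA> (?z (Suc (Suc n)) \<ominus> ?z (Suc n)) \<le> (nrm \<AA> (?z (Suc n)) * nrm \<AA> ?d + nrm \<AA> ?d * nrm \<AA> (?z n)) / 2"
      using half_square_lipschitz[OF a sqrt_iter_in[OF a, of "Suc n"] sqrt_iter_in[OF a, of n]]
      unfolding sqrt_iter.simps(2)[symmetric] .
    also have "\<dots> \<le> r * r ^ n"
      by (rule average[OF zr zr _ Suc]) (simp_all add: nrm_nonneg)
    finally show ?case by simp
  qed
  have cau: "nrm \<AA> (?z (n + k) \<ominus> ?z n) \<le> r ^ n / (1 - r)" for n k
  proof -
    have "nrm \<AA> (?z (n + k) \<ominus> ?z n) \<le> r ^ n * (1 - r ^ k) / (1 - r)"
    proof (induction k)
      case 0 show ?case by (simp add: a_minus_def r_neg nrm_zero)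
    next
      case (Suc k)
      have "nrm \<AA> (?z (n + Suc k) \<ominus> ?z n) \<le> r ^ (n + k) + r ^ n * (1 - r ^ k) / (1 - r)"
        using nrm_minus_triangle[of "?z (Suc (n + k))" "?z (n + k)" "?z n"] step[of "n + k"] Suc
        by simp
      also have "\<dots> = r ^ n * (1 - r ^ Suc k) / (1 - r)"
        using r by (simp add: field_simps power_add)
      finally show ?case .
    qed
    also have "\<dots> \<le> r ^ n * 1 / (1 - r)"
      using r by (intro divide_right_mono mult_left_mono) auto
    finally show ?thesis by simp
  qed
  have lim: "(\<lambda>n. r ^ n / (1 - r)) \<longlonglongrightarrow> 0"
    using LIMSEQ_realpow_zero[OF r(1,2)] tendsto_divide_zero by blast
  have "\<exists>z\<in>carrier \<AA>. (\<lambda>n. nrm \<AA> (?z n \<ominus> z)) \<longlonglongrightarrow> 0"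
  proof (rule complete)
    fix e :: real assume "e > 0"
    then obtain M where M: "\<And>n. n \<ge> M \<Longrightarrow> r ^ n / (1 - r) < e"
      using LIMSEQ_D[OF lim, of e] r by fastforce
    have *: "nrm \<AA> (?z m \<ominus> ?z n) < e" if "m \<ge> n" "n \<ge> M" for m n
      using cau[of n "m - n"] M[of n] that by auto
    have "nrm \<AA> (?z m \<ominus> ?z n) < e" if "m \<ge> M" "n \<ge> M" for m n
      using *[of n m] *[of m n] that nrm_minus_commute[of "?z m" "?z n"] by (cases "m \<ge> n") auto
    then show "\<exists>M. \<forall>m\<ge>M. \<forall>n\<ge>M. nrm \<AA> (?z m \<ominus> ?z n) < e" by blast
  qed simp
  then obtain z where z: "tends ?z z" by (auto simp: tends_def)
  then have zin [simp]: "z \<in> carrier \<AA>" by (simp add: tends_def)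
  have "tends (\<lambda>n. ?z (Suc n)) ((1 / 2) \<odot> (a \<oplus> z \<otimes> z))"
    by (simp add: tends_smult tends_add tends_mult tends_const z sqrt_iter.simps(2))
  then have fix_z: "(1 / 2) \<odot> (a \<oplus> z \<otimes> z) = z" using tends_Suc[OF z] tends_unique by blast
  have "a \<oplus> z \<otimes> z = 2 \<odot> ((1 / 2) \<odot> (a \<oplus> z \<otimes> z))" by (simp add: smult_smult smult_1)
  also have "\<dots> = z \<oplus> z" unfolding fix_z using smult_add_left[of z 1 1] by (simp add: smult_1)
  finally have "a = (z \<oplus> z) \<ominus> z \<otimes> z"
    by (metis a a_minus_def add.inv_solve_right m_closed zin a_closed)
  then have sq: "(\<one> \<ominus> z) \<otimes> (\<one> \<ominus> z) = \<one> \<ominus> a"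
    by (simp add: a_minus_def l_distr r_distr l_minus r_minus minus_add minus_minus a_ac)
  have sz: "star \<AA> z = z"
    using tends_unique[OF tends_star[OF z]] z by (simp add: sqrt_iter_star sa)
  have comm: "x \<otimes> (\<one> \<ominus> z) = (\<one> \<ominus> z) \<otimes> x" if x: "x \<in> carrier \<AA>" "x \<otimes> a = a \<otimes> x" for x
  proof -
    have "tends (\<lambda>n. ?z n \<otimes> x) (x \<otimes> z)"
      using tends_mult[OF tends_const[OF x(1)] z] by (simp add: sqrt_iter_commute[OF a x])
    then have "x \<otimes> z = z \<otimes> x" using tends_mult[OF z tends_const[OF x(1)]] tends_unique by blast
    then show ?thesis using x by (simp add: a_minus_def l_distr r_distr l_minus r_minus)
  qed
  show thesis by (rule that[OF _ _ sq comm]) (simp_all add: star_minus star_one sz)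
qed

text \<open>Here \<open>a + i b\<close> is unitary, and \<open>a\<close> is its real part.\<close>

lemma nrm_le_1_if_squares_sum_to_one:
  assumes [simp]: "a \<in> carrier \<AA>" "b \<in> carrier \<AA>"
    and sa: "star \<AA> a = a" "star \<AA> b = b" and comm: "a \<otimes> b = b \<otimes> a" and sq: "b \<otimes> b = \<one> \<ominus> a \<otimes> a"
  shows "nrm \<AA> a \<le> 1"
proof -
  define u where "u = a \<oplus> \<i> \<odot> b"
  have u [simp]: "u \<in> carrier \<AA>" by (simp add: u_def)
  have su: "star \<AA> u = a \<oplus> (- \<i>) \<odot> b" by (simp add: u_def star_add star_smult sa)
  have "star \<AA> u \<otimes> u = (a \<otimes> a \<oplus> b \<otimes> b) \<oplus> ((- \<i>) \<odot> (b \<otimes> a) \<oplus> \<i> \<odot> (b \<otimes> a))"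
    unfolding su unfolding u_def
    by (simp add: l_distr r_distr smult_mult_left smult_mult_right smult_add_right smult_smult smult_1 comm a_ac)
  also have "(- \<i>) \<odot> (b \<otimes> a) \<oplus> \<i> \<odot> (b \<otimes> a) = \<zero>"
    using smult_add_left[of "b \<otimes> a" "- \<i>" \<i>] by (simp add: smult_0)
  also have "a \<otimes> a \<oplus> b \<otimes> b = \<one>"
    unfolding sq by (simp add: a_minus_def a_comm[of \<one>] r_neg2)
  finally have "star \<AA> u \<otimes> u = \<one>" by simp
  then have "(nrm \<AA> u)\<^sup>2 \<le> 1" using cstar_identity[OF u] nrm_one_le by simp
  then have nu: "nrm \<AA> u \<le> 1" by (simp add: abs_square_le_1 nrm_nonneg)
  have "2 \<odot> a = u \<oplus> star \<AA> u"
  proof -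
    have "u \<oplus> star \<AA> u = (a \<oplus> a) \<oplus> (\<i> \<odot> b \<oplus> (- \<i>) \<odot> b)"
      unfolding su unfolding u_def by (simp add: a_ac)
    also have "\<i> \<odot> b \<oplus> (- \<i>) \<odot> b = \<zero>"
      using smult_add_left[of b \<i> "- \<i>"] by (simp add: smult_0)
    finally show ?thesis using smult_add_left[of a 1 1] by (simp add: smult_1)
  qed
  then have "2 * nrm \<AA> a \<le> nrm \<AA> u + nrm \<AA> (star \<AA> u)"
    using nrm_triangle[of u "star \<AA> u"] nrm_smult[of a 2] by simp
  then show ?thesis using nu by (simp add: nrm_star)
qed

end

lemma star_homD:
  assumes "star_hom \<AA> \<BB> \<Psi>" "x \<in> carrier \<AA>"
  shows "\<Psi> x \<in> carrier \<BB>" "\<Psi> (c \<odot>\<^bsub>\<AA>\<^esub> x) = c \<odot>\<^bsub>\<BB>\<^esub> \<Psi> x" "\<Psi> (star \<AA> x) = star \<BB> (\<Psi> x)"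
    "y \<in> carrier \<AA> \<Longrightarrow> \<Psi> (x \<otimes>\<^bsub>\<AA>\<^esub> y) = \<Psi> x \<otimes>\<^bsub>\<BB>\<^esub> \<Psi> y"
    "y \<in> carrier \<AA> \<Longrightarrow> \<Psi> (x \<oplus>\<^bsub>\<AA>\<^esub> y) = \<Psi> x \<oplus>\<^bsub>\<BB>\<^esub> \<Psi> y"
    "\<Psi> \<one>\<^bsub>\<AA>\<^esub> = \<one>\<^bsub>\<BB>\<^esub>"
  using assms by (simp_all add: star_hom_def ring_hom_def Pi_iff)

lemma cstar_subalgebraI:
  assumes "S \<subseteq> carrier \<AA>" "\<zero>\<^bsub>\<AA>\<^esub> \<in> S"
    "\<And>x y. x \<in> S \<Longrightarrow> y \<in> S \<Longrightarrow> x \<oplus>\<^bsub>\<AA>\<^esub> y \<in> S" "\<And>x y. x \<in> S \<Longrightarrow> y \<in> S \<Longrightarrow> x \<otimes>\<^bsub>\<AA>\<^esub> y \<in> S"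
    "\<And>c x. x \<in> S \<Longrightarrow> c \<odot>\<^bsub>\<AA>\<^esub> x \<in> S" "\<And>x. x \<in> S \<Longrightarrow> star \<AA> x \<in> S"
    "\<And>u x. x \<in> carrier \<AA> \<Longrightarrow> (\<And>n::nat. u n \<in> S) \<Longrightarrow> (\<lambda>n. nrm \<AA> (u n \<ominus>\<^bsub>\<AA>\<^esub> x)) \<longlonglongrightarrow> 0 \<Longrightarrow> x \<in> S"
  shows "cstar_subalgebra \<AA> S"
  unfolding cstar_subalgebra_def
proof (intro conjI ballI allI impI)
  fix u x assume "x \<in> carrier \<AA>" "(\<forall>n. u n \<in> S) \<and> (\<lambda>n. nrm \<AA> (u n \<ominus>\<^bsub>\<AA>\<^esub> x)) \<longlonglongrightarrow> 0"
  then show "x \<in> S" using assms(7)[of x u] by blast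
qed (rule assms; assumption)+

lemma cstar_subalgebraD:
  assumes "cstar_subalgebra \<AA> S"
  shows "S \<subseteq> carrier \<AA>" "\<zero>\<^bsub>\<AA>\<^esub> \<in> S"
    "\<And>x y. x \<in> S \<Longrightarrow> y \<in> S \<Longrightarrow> x \<oplus>\<^bsub>\<AA>\<^esub> y \<in> S" "\<And>x y. x \<in> S \<Longrightarrow> y \<in> S \<Longrightarrow> x \<otimes>\<^bsub>\<AA>\<^esub> y \<in> S"
    "\<And>c x. x \<in> S \<Longrightarrow> c \<odot>\<^bsub>\<AA>\<^esub> x \<in> S" "\<And>x. x \<in> S \<Longrightarrow> star \<AA> x \<in> S"
  using assms unfolding cstar_subalgebra_def by simp_all

lemma cstar_subalgebra_limit:
  fixes u :: "nat \<Rightarrow> 'a"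
  assumes "cstar_subalgebra (\<AA> :: ('a, 'x) cstar_scheme) S" "x \<in> carrier \<AA>" "\<And>n. u n \<in> S" "(\<lambda>n. nrm \<AA> (u n \<ominus>\<^bsub>\<AA>\<^esub> x)) \<longlonglongrightarrow> 0"
  shows "x \<in> S"
proof -
  have "\<forall>u. \<forall>x\<in>carrier \<AA>. (\<forall>n::nat. u n \<in> S) \<and> (\<lambda>n. nrm \<AA> (u n \<ominus>\<^bsub>\<AA>\<^esub> x)) \<longlonglongrightarrow> 0 \<longrightarrow> x \<in> S"
    using assms(1) unfolding cstar_subalgebra_def by (elim conjE)
  with assms(2-4) show ?thesis by blast
qed

locale cstar_hom = A: cstar_algebra \<AA> + B: cstar_algebra \<BB>
  for \<AA> :: "('a, 'x) cstar_scheme" and \<BB> :: "('b, 'y) cstar_scheme" +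
  fixes \<Psi> :: "'a \<Rightarrow> 'b"
  assumes star_hom: "star_hom \<AA> \<BB> \<Psi>"
begin

lemmas hom_closed [simp] = star_homD(1)[OF star_hom]
lemmas hom_smult = star_homD(2)[OF star_hom]
lemmas hom_star = star_homD(3)[OF star_hom]
lemmas hom_mult = star_homD(4)[OF star_hom]
lemmas hom_add = star_homD(5)[OF star_hom]
lemmas hom_one = star_homD(6)[OF star_hom A.one_closed]

lemma hom_zero: "\<Psi> \<zero>\<^bsub>\<AA>\<^esub> = \<zero>\<^bsub>\<BB>\<^esub>"
  using hom_smult[of "\<zero>\<^bsub>\<AA>\<^esub>" 0] by (simp add: A.smult_0 B.smult_0)

lemma hom_minus: "x \<in> carrier \<AA> \<Longrightarrow> y \<in> carrier \<AA> \<Longrightarrow> \<Psi> (x \<ominus>\<^bsub>\<AA>\<^esub> y) = \<Psi> x \<ominus>\<^bsub>\<BB>\<^esub> \<Psi> y"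
  by (simp add: a_minus_def hom_add hom_smult flip: A.smult_minus1 B.smult_minus1)

lemma hom_sum:
  "finite S \<Longrightarrow> (\<And>i. i \<in> S \<Longrightarrow> f i \<in> carrier \<AA>) \<Longrightarrow> \<Psi> (\<Oplus>\<^bsub>\<AA>\<^esub>i\<in>S. f i) = (\<Oplus>\<^bsub>\<BB>\<^esub>i\<in>S. \<Psi> (f i))"
proof (induction S rule: finite_induct)
  case (insert i S)
  then have "f i \<in> carrier \<AA>" "f \<in> S \<rightarrow> carrier \<AA>" "\<Psi> (f i) \<in> carrier \<BB>" "(\<lambda>i. \<Psi> (f i)) \<in> S \<rightarrow> carrier \<BB>"
    by auto
  with insert show ?case by (simp add: A.finsum_insert B.finsum_insert hom_add A.finsum_closed)
qed (simp add: hom_zero)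

lemma hom_contractive_selfadjoint:
  assumes x: "x \<in> carrier \<AA>" and sx: "star \<AA> x = x" and nx: "nrm \<AA> x < 1"
  shows "nrm \<BB> (\<Psi> x) \<le> 1"
proof -
  let ?a = "x \<otimes>\<^bsub>\<AA>\<^esub> x"
  have a: "?a \<in> carrier \<AA>" using x by simp
  have "nrm \<AA> ?a < 1"
    using A.cstar_identity[OF x] nx A.nrm_nonneg[OF x] by (simp add: sx power_less_one_iff)
  moreover have "star \<AA> ?a = ?a" by (simp add: A.star_mult sx x)
  ultimately obtain y where y: "y \<in> carrier \<AA>" "star \<AA> y = y" "y \<otimes>\<^bsub>\<AA>\<^esub> y = \<one>\<^bsub>\<AA>\<^esub> \<ominus>\<^bsub>\<AA>\<^esub> ?a"
    and comm: "\<And>w. w \<in> carrier \<AA> \<Longrightarrow> w \<otimes>\<^bsub>\<AA>\<^esub> ?a = ?a \<otimes>\<^bsub>\<AA>\<^esub> w \<Longrightarrow> w \<otimes>\<^bsub>\<AA>\<^esub> y = y \<otimes>\<^bsub>\<AA>\<^esub> w"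
    using A.sqrt_one_minus[OF a] by metis
  have xy: "x \<otimes>\<^bsub>\<AA>\<^esub> y = y \<otimes>\<^bsub>\<AA>\<^esub> x" using comm[OF x] x by (simp add: A.m_assoc)
  show ?thesis
  proof (rule B.nrm_le_1_if_squares_sum_to_one)
    show "\<Psi> x \<in> carrier \<BB>" "\<Psi> y \<in> carrier \<BB>" using x y(1) by simp_all
    show "star \<BB> (\<Psi> x) = \<Psi> x" "star \<BB> (\<Psi> y) = \<Psi> y"
      using hom_star[OF x] hom_star[OF y(1)] sx y(2) by simp_all
    show "\<Psi> x \<otimes>\<^bsub>\<BB>\<^esub> \<Psi> y = \<Psi> y \<otimes>\<^bsub>\<BB>\<^esub> \<Psi> x"
      using hom_mult[OF x y(1)] hom_mult[OF y(1) x] xy by simp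
    show "\<Psi> y \<otimes>\<^bsub>\<BB>\<^esub> \<Psi> y = \<one>\<^bsub>\<BB>\<^esub> \<ominus>\<^bsub>\<BB>\<^esub> \<Psi> x \<otimes>\<^bsub>\<BB>\<^esub> \<Psi> x"
      using hom_mult[OF y(1) y(1)] hom_minus[OF A.one_closed a] hom_mult[OF x x] hom_one y(3) by simp
  qed
qed

text \<open>Let \<open>x\<close> be self-adjoint with \<open>\<parallel>x\<parallel> < 1\<close>, and \<open>y\<close> a self-adjoint square root of \<open>1 - x\<^sup>2\<close> that commutes with \<open>x\<close>. The
  homomorphism preserves the relation \<open>x\<^sup>2 + y\<^sup>2 = 1\<close>, which alone bounds the norm of the image of \<open>x\<close> by \<open>1\<close>.
  Scaling gives all self-adjoint elements, and the C*-identity gives the rest.\<close>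

lemma hom_contractive:
  assumes x [simp]: "x \<in> carrier \<AA>"
  shows "nrm \<BB> (\<Psi> x) \<le> nrm \<AA> x"
proof -
  have sa: "nrm \<BB> (\<Psi> w) \<le> nrm \<AA> w" if w: "w \<in> carrier \<AA>" "star \<AA> w = w" for w
  proof (rule field_le_epsilon)
    fix e :: real assume "e > 0"
    define R where "R = nrm \<AA> w + e"
    have R: "R > 0" using \<open>e > 0\<close> A.nrm_nonneg[OF w(1)] by (simp add: R_def)
    let ?v = "complex_of_real (1 / R) \<odot>\<^bsub>\<AA>\<^esub> w"
    have "star \<AA> ?v = ?v" using w by (simp add: A.star_smult)
    moreover have "nrm \<AA> ?v < 1"
      using R \<open>e > 0\<close> w by (simp add: A.nrm_smult norm_divide) (simp add: R_def)
    ultimately have "nrm \<BB> (\<Psi> ?v) \<le> 1" using w by (intro hom_contractive_selfadjoint) simp_all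
    then show "nrm \<BB> (\<Psi> w) \<le> nrm \<AA> w + e"
      using R w by (simp add: hom_smult B.nrm_smult norm_divide field_simps) (simp add: R_def)
  qed
  have "(nrm \<BB> (\<Psi> x))\<^sup>2 = nrm \<BB> (\<Psi> (star \<AA> x \<otimes>\<^bsub>\<AA>\<^esub> x))"
    by (simp add: hom_mult hom_star B.cstar_identity)
  also have "\<dots> \<le> nrm \<AA> (star \<AA> x \<otimes>\<^bsub>\<AA>\<^esub> x)"
    by (rule sa) (simp_all add: A.star_mult A.star_star)
  also have "\<dots> = (nrm \<AA> x)\<^sup>2" by (simp add: A.cstar_identity)
  finally show ?thesis by (rule power2_le_imp_le) (simp add: A.nrm_nonneg)
qed

lemma tends_hom: assumes "A.tends u x" shows "B.tends (\<lambda>n. \<Psi> (u n)) (\<Psi> x)"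
proof (rule B.tendsI)
  have c: "u n \<in> carrier \<AA>" "x \<in> carrier \<AA>" for n using assms by (auto simp: A.tends_def)
  show "\<Psi> (u n) \<in> carrier \<BB>" "\<Psi> x \<in> carrier \<BB>" for n using c by simp_all
  show "(\<lambda>n. nrm \<AA> (u n \<ominus>\<^bsub>\<AA>\<^esub> x)) \<longlonglongrightarrow> 0" using assms by (simp add: A.tends_def)
  show "nrm \<BB> (\<Psi> (u n) \<ominus>\<^bsub>\<BB>\<^esub> \<Psi> x) \<le> nrm \<AA> (u n \<ominus>\<^bsub>\<AA>\<^esub> x)" for n
    using hom_contractive[of "u n \<ominus>\<^bsub>\<AA>\<^esub> x"] c by (simp add: hom_minus)
qed

lemma subalgebra_preimage:
  assumes S: "cstar_subalgebra \<BB> S"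
  shows "cstar_subalgebra \<AA> {x \<in> carrier \<AA>. \<Psi> x \<in> S}"
proof (rule cstar_subalgebraI)
  fix u :: "nat \<Rightarrow> 'a" and x
  assume x: "x \<in> carrier \<AA>" and u: "\<And>n. u n \<in> {x \<in> carrier \<AA>. \<Psi> x \<in> S}"
    and lim: "(\<lambda>n. nrm \<AA> (u n \<ominus>\<^bsub>\<AA>\<^esub> x)) \<longlonglongrightarrow> 0"
  have "A.tends u x" using x u lim by (simp add: A.tends_def)
  then have "(\<lambda>n. nrm \<BB> (\<Psi> (u n) \<ominus>\<^bsub>\<BB>\<^esub> \<Psi> x)) \<longlonglongrightarrow> 0" using tends_hom by (simp add: B.tends_def)
  then have "\<Psi> x \<in> S" using u x cstar_subalgebra_limit[OF S, of "\<Psi> x" "\<lambda>n. \<Psi> (u n)"] by simp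
  with x show "x \<in> {x \<in> carrier \<AA>. \<Psi> x \<in> S}" by simp
qed (simp_all add: hom_zero hom_add hom_mult hom_smult hom_star cstar_subalgebraD(2-)[OF S] subset_iff)

end

lemma star_hom_comp: "star_hom \<AA> \<BB> \<Psi> \<Longrightarrow> star_hom \<BB> \<CC> \<Psi>' \<Longrightarrow> star_hom \<AA> \<CC> (\<lambda>x. \<Psi>' (\<Psi> x))"
  by (simp add: star_hom_def ring_hom_def Pi_iff)

lemma (in cstar_algebra) star_hom_id: "star_hom \<AA> \<AA> (\<lambda>x. x)"
  by (simp add: star_hom_def ring_hom_def)

lemma cstar_generated_minimal:
  "cstar_subalgebra \<AA> S \<Longrightarrow> X \<subseteq> S \<Longrightarrow> cstar_generated \<AA> X \<subseteq> S"
  by (auto simp: cstar_generated_def)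

text \<open>The equalizer of two homomorphisms is closed, as both are continuous, so it is a C*-subalgebra.\<close>

lemma star_homs_agree:
  assumes "cstar_algebra \<AA>" "cstar_algebra \<BB>" "star_hom \<AA> \<BB> \<Psi>" "star_hom \<AA> \<BB> \<Psi>'"
    and X: "X \<subseteq> carrier \<AA>" "\<And>x. x \<in> X \<Longrightarrow> \<Psi> x = \<Psi>' x" and x: "x \<in> cstar_generated \<AA> X"
  shows "\<Psi> x = \<Psi>' x"
proof -
  interpret F: cstar_hom \<AA> \<BB> \<Psi> using assms(1-3) by (simp add: cstar_hom_def cstar_hom_axioms_def)
  interpret G: cstar_hom \<AA> \<BB> \<Psi>' using assms(1,2,4) by (simp add: cstar_hom_def cstar_hom_axioms_def)
  have "cstar_subalgebra \<AA> {x \<in> carrier \<AA>. \<Psi> x = \<Psi>' x}"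
  proof (rule cstar_subalgebraI)
    fix u :: "nat \<Rightarrow> 'a" and x
    assume x: "x \<in> carrier \<AA>" and u: "\<And>n. u n \<in> {x \<in> carrier \<AA>. \<Psi> x = \<Psi>' x}"
      and lim: "(\<lambda>n. nrm \<AA> (u n \<ominus>\<^bsub>\<AA>\<^esub> x)) \<longlonglongrightarrow> 0"
    have "F.A.tends u x" using x u lim by (simp add: F.A.tends_def)
    then have "F.B.tends (\<lambda>n. \<Psi> (u n)) (\<Psi> x)" "F.B.tends (\<lambda>n. \<Psi> (u n)) (\<Psi>' x)"
      using F.tends_hom[of u x] G.tends_hom[of u x] u by simp_all
    with x show "x \<in> {x \<in> carrier \<AA>. \<Psi> x = \<Psi>' x}" using F.B.tends_unique by simp
  qed (simp_all add: subset_iff F.hom_zero G.hom_zero F.hom_add G.hom_add F.hom_mult G.hom_mult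
      F.hom_smult G.hom_smult F.hom_star G.hom_star)
  from cstar_generated_minimal[OF this, of X] X x show ?thesis by blast
qed


section \<open>Sets depending on finitely many coordinates\<close>

definition determined :: "int ^ 'n ^ 'n \<Rightarrow> nat \<Rightarrow> (nat \<Rightarrow> 'n) set \<Rightarrow> bool" where
  "determined A n U \<longleftrightarrow>
     U \<subseteq> shift_space A \<and> (\<forall>x\<in>U. \<forall>y\<in>shift_space A. (\<forall>i<n. x i = y i) \<longrightarrow> y \<in> U)"

text \<open>By compactness of the shift space these are the sets that are both open and closed
  (\<open>openin_clopen\<close>, \<open>clopen_if_openin\<close>).\<close>

definition clopen :: "int ^ 'n ^ 'n \<Rightarrow> (nat \<Rightarrow> 'n) set \<Rightarrow> bool" where
  "clopen A U \<longleftrightarrow> (\<exists>n. determined A n U)"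

definition prepend :: "'n \<Rightarrow> (nat \<Rightarrow> 'n) \<Rightarrow> nat \<Rightarrow> 'n" where
  "prepend j x = case_nat j x"

definition pull :: "int ^ 'n ^ 'n \<Rightarrow> 'n \<Rightarrow> (nat \<Rightarrow> 'n) set \<Rightarrow> (nat \<Rightarrow> 'n) set" where
  "pull A j U = {x \<in> shift_space A. prepend j x \<in> U}"

definition follow :: "int ^ 'n ^ 'n \<Rightarrow> 'n \<Rightarrow> (nat \<Rightarrow> 'n) set" where
  "follow A j = {x \<in> shift_space A. A $ j $ x 0 = 1}"

definition coord :: "int ^ 'n ^ 'n \<Rightarrow> nat \<Rightarrow> 'n \<Rightarrow> (nat \<Rightarrow> 'n) set" where
  "coord A n j = {x \<in> shift_space A. x n = j}"

definition shift_vimage :: "int ^ 'n ^ 'n \<Rightarrow> (nat \<Rightarrow> 'n) set \<Rightarrow> (nat \<Rightarrow> 'n) set" where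
  "shift_vimage A W = {x \<in> shift_space A. shift x \<in> W}"

lemma prepend_simps [simp]: "prepend j x 0 = j" "prepend j x (Suc n) = x n" "shift (prepend j x) = x"
  by (simp_all add: prepend_def shift_def)

lemma prepend_shift: "prepend (x 0) (shift x) = x"
  by (rule ext) (simp add: prepend_def shift_def split: nat.split)

lemma prepend_in_shift_space: "prepend j x \<in> shift_space A \<longleftrightarrow> x \<in> shift_space A \<and> A $ j $ x 0 = 1"
  by (auto simp: shift_space_def prepend_def split: nat.split)

lemma determinedD: "determined A n U \<Longrightarrow> x \<in> U \<Longrightarrow> y \<in> shift_space A \<Longrightarrow> (\<And>i. i < n \<Longrightarrow> x i = y i) \<Longrightarrow> y \<in> U"
  by (auto simp: determined_def)

lemma determined_subset: "determined A n U \<Longrightarrow> U \<subseteq> shift_space A"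
  by (simp add: determined_def)

lemma clopen_subset: "clopen A U \<Longrightarrow> U \<subseteq> shift_space A"
  by (auto simp: clopen_def determined_def)

lemma determined_mono: "determined A n U \<Longrightarrow> n \<le> m \<Longrightarrow> determined A m U"
  unfolding determined_def by (meson less_le_trans)

lemma determined_Int: "determined A n U \<Longrightarrow> determined A n V \<Longrightarrow> determined A n (U \<inter> V)"
  unfolding determined_def by blast

lemma determined_Un: "determined A n U \<Longrightarrow> determined A n V \<Longrightarrow> determined A n (U \<union> V)"
  unfolding determined_def by blast

lemma determined_compl: "determined A n U \<Longrightarrow> determined A n (shift_space A - U)"
  unfolding determined_def by (metis Diff_iff Diff_subset)

lemma determined_empty [simp]: "determined A n {}"
  and determined_space [simp]: "determined A n (shift_space A)"
  by (auto simp: determined_def)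

lemma clopen_common:
  assumes "clopen A U" "clopen A V"
  obtains n where "determined A (Suc n) U" "determined A (Suc n) V"
proof -
  obtain k l where "determined A k U" "determined A l V" using assms by (auto simp: clopen_def)
  then show thesis using that[of "k + l"] determined_mono by (metis le_SucI le_add1 le_add2)
qed

lemma clopenE: assumes "clopen A U" obtains n where "determined A (Suc n) U"
  using clopen_common[OF assms assms] by blast

lemma clopen_intros:
  "clopen A {}" "clopen A (shift_space A)"
  "clopen A U \<Longrightarrow> clopen A V \<Longrightarrow> clopen A (U \<inter> V)"
  "clopen A U \<Longrightarrow> clopen A V \<Longrightarrow> clopen A (U \<union> V)"
  "clopen A U \<Longrightarrow> clopen A (shift_space A - U)"
proof -
  show "clopen A {}" "clopen A (shift_space A)" by (auto simp: clopen_def)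
  show "clopen A (U \<inter> V)" "clopen A (U \<union> V)" if "clopen A U" "clopen A V"
    using clopen_common[OF that] determined_Int determined_Un by (metis clopen_def)+
  show "clopen A (shift_space A - U)" if "clopen A U"
    using that determined_compl by (auto simp: clopen_def)
qed

lemma clopen_UN: "finite S \<Longrightarrow> (\<And>i. i \<in> S \<Longrightarrow> clopen A (V i)) \<Longrightarrow> clopen A (\<Union>i\<in>S. V i)"
  by (induction S rule: finite_induct) (auto intro: clopen_intros)

lemma determined_cylinder: "determined A n (cylinder A x n)"
  by (auto simp: determined_def cylinder_def)

lemma clopen_cylinder: "clopen A (cylinder A x n)"
  using determined_cylinder by (auto simp: clopen_def)

lemma determined_coord: "determined A (Suc n) (coord A n j)"
  by (auto simp: determined_def coord_def)

lemma clopen_coord: "clopen A (coord A n j)"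
  using determined_coord by (auto simp: clopen_def)

lemma determined_follow: "determined A (Suc n) (follow A j)"
  by (auto simp: determined_def follow_def)

lemma clopen_follow: "clopen A (follow A j)"
  using determined_follow by (auto simp: clopen_def)

lemma determined_pull:
  assumes "determined A (Suc (Suc n)) U" shows "determined A (Suc n) (pull A j U)"
  unfolding determined_def
proof (intro conjI ballI impI)
  fix x y assume x: "x \<in> pull A j U" and y: "y \<in> shift_space A" and eq: "\<forall>i<Suc n. x i = y i"
  have "prepend j x \<in> shift_space A" using x determined_subset[OF assms] by (auto simp: pull_def)
  with eq y have "prepend j y \<in> shift_space A" by (simp add: prepend_in_shift_space)
  moreover have "prepend j x i = prepend j y i" if "i < Suc (Suc n)" for i
    using that eq by (cases i) auto
  ultimately have "prepend j y \<in> U" using x determinedD[OF assms] by (auto simp: pull_def)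
  with y show "y \<in> pull A j U" by (simp add: pull_def)
qed (simp add: pull_def)

lemma clopen_pull: "clopen A U \<Longrightarrow> clopen A (pull A j U)"
  by (metis clopenE clopen_def determined_pull determined_mono le_SucI order_refl)

lemma determined_shift_vimage:
  assumes "determined A n W" shows "determined A (Suc n) (shift_vimage A W)"
  unfolding determined_def
proof (intro conjI ballI impI)
  fix x y assume x: "x \<in> shift_vimage A W" and y: "y \<in> shift_space A" and eq: "\<forall>i<Suc n. x i = y i"
  have "shift x i = shift y i" if "i < n" for i using that eq by (simp add: shift_def)
  with x y show "y \<in> shift_vimage A W"
    using determinedD[OF assms, of "shift x" "shift y"] shift_in_shift_space[OF y]
    by (auto simp: shift_vimage_def)
qed (auto simp: shift_vimage_def)

lemma clopen_shift_vimage: "clopen A W \<Longrightarrow> clopen A (shift_vimage A W)"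
  by (meson clopen_def determined_shift_vimage)

lemma pull_subset_follow: "U \<subseteq> shift_space A \<Longrightarrow> pull A j U \<subseteq> follow A j"
  by (auto simp: pull_def follow_def dest!: subsetD) (simp add: prepend_in_shift_space)

lemma pull_coord_vimage: "pull A k (coord A 0 j \<inter> shift_vimage A W) = (if k = j then W \<inter> follow A j else {})"
  if "W \<subseteq> shift_space A"
  using that by (auto simp: pull_def coord_def shift_vimage_def follow_def prepend_in_shift_space)

lemma pull_vimage: "W \<subseteq> shift_space A \<Longrightarrow> pull A j (shift_vimage A W) = W \<inter> follow A j"
  by (auto simp: pull_def shift_vimage_def follow_def prepend_in_shift_space)

lemma shift_image_pull: "U \<subseteq> shift_space A \<Longrightarrow> shift ` U = (\<Union>j. pull A j U)"
proof (intro equalityI subsetI)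
  fix y assume U: "U \<subseteq> shift_space A" and "y \<in> shift ` U"
  then obtain x where "x \<in> U" "y = shift x" by blast
  then have "y \<in> pull A (x 0) U" using U by (auto simp: pull_def prepend_shift shift_in_shift_space)
  then show "y \<in> (\<Union>j. pull A j U)" by blast
next
  fix y assume "y \<in> (\<Union>j. pull A j U)"
  then obtain j where "prepend j y \<in> U" by (auto simp: pull_def)
  then have "shift (prepend j y) \<in> shift ` U" by blast
  then show "y \<in> shift ` U" by simp
qed

text \<open>Two points of \<open>U\<close> with different first letters have different shifts.\<close>

lemma pull_disjoint: "inj_on shift U \<Longrightarrow> i \<noteq> j \<Longrightarrow> pull A i U \<inter> pull A j U = {}"
  by (auto simp: pull_def inj_on_def) (metis prepend_simps(1,3))

lemma exists_point:
  assumes "ck_matrix A" shows "\<exists>x\<in>shift_space A. x 0 = j"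
proof -
  have "\<exists>k. A $ i $ k = 1" for i
    using assms unfolding ck_matrix_def by (metis insertE singletonD)
  then obtain f where f: "\<And>i. A $ i $ f i = 1" by metis
  have "(\<lambda>n. (f ^^ n) j) \<in> shift_space A" by (simp add: shift_space_def f)
  then show ?thesis by (rule rev_bexI) simp
qed

lemma first_letters_follow: "ck_matrix A \<Longrightarrow> (\<lambda>x. x 0) ` follow A i = {j. A $ i $ j = 1}"
proof (intro equalityI subsetI)
  fix j assume A: "ck_matrix A" and "j \<in> {j. A $ i $ j = 1}"
  moreover obtain x where "x \<in> shift_space A" "x 0 = j" using exists_point[OF A] by blast
  ultimately show "j \<in> (\<lambda>x. x 0) ` follow A i" by (force simp: follow_def)
qed (auto simp: follow_def)

lemma pull_determined_1:
  assumes "determined A (Suc 0) U"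
  shows "pull A j U = (if j \<in> (\<lambda>x. x 0) ` U then follow A j else {})"
proof (cases "j \<in> (\<lambda>x. x 0) ` U")
  case True
  then obtain x where x: "x \<in> U" "x 0 = j" by blast
  have "prepend j y \<in> U" if "y \<in> follow A j" for y
    using that x by (intro determinedD[OF assms x(1)]) (auto simp: follow_def prepend_in_shift_space)
  then show ?thesis using True pull_subset_follow[OF determined_subset[OF assms], of j]
    by (auto simp: pull_def follow_def)
next
  case False
  then show ?thesis by (auto simp: pull_def image_iff)
qed

section \<open>The projections of a Cuntz--Krieger family\<close>

lemma (in cstar_algebra) finsum_delta:
  assumes "finite S" "\<And>j. f j \<in> carrier \<AA>" "\<And>j. j \<noteq> k \<Longrightarrow> f j = \<zero>"
  shows "(\<Oplus>j\<in>S. f j) = (if k \<in> S then f k else \<zero>)"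
proof -
  have "(\<Oplus>j\<in>S. f j) = (\<Oplus>j\<in>S \<inter> {k}. f j)"
    by (rule add.finprod_mono_neutral_cong_right) (use assms in auto)
  then show ?thesis using assms(2) by (simp add: Int_insert_right)
qed

lemma (in cstar_algebra) star_finsum:
  assumes "finite S" "\<And>j. f j \<in> carrier \<AA>"
  shows "star \<AA> (\<Oplus>j\<in>S. f j) = (\<Oplus>j\<in>S. star \<AA> (f j))"
  using assms(1) by (induction S rule: finite_induct) (simp_all add: star_zero star_add assms(2) Pi_iff)

locale ck_rep = cstar_algebra \<AA> for \<AA> :: "('a, 'x) cstar_scheme" (structure) +
  fixes A :: "int ^ 'n ^ 'n" and t :: "'n \<Rightarrow> 'a"
  assumes matrix: "ck_matrix A" and family: "ck_family A \<AA> t"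
begin

abbreviation (input) "X \<equiv> shift_space A"

lemma t_in [simp]: "t i \<in> carrier \<AA>"
  using family by (simp add: ck_family_def partial_isometry_def)

lemma t_star_t: "t i \<otimes> (star \<AA> (t i) \<otimes> t i) = t i"
proof -
  have "t i \<otimes> star \<AA> (t i) \<otimes> t i = t i" using family by (simp add: ck_family_def partial_isometry_def)
  then show ?thesis by (simp add: m_assoc)
qed

lemma star_t_t: "star \<AA> (t i) \<otimes> t i \<otimes> star \<AA> (t i) = star \<AA> (t i)"
proof -
  have "star \<AA> (t i \<otimes> (star \<AA> (t i) \<otimes> t i)) = star \<AA> (t i)" by (simp only: t_star_t)
  then show ?thesis by (simp add: star_mult star_star)
qed

lemma star_t_t_other: "i \<noteq> j \<Longrightarrow> star \<AA> (t i) \<otimes> t j = \<zero>"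
  using family by (simp add: ck_family_def)

lemma sum_ranges: "(\<Oplus>i\<in>UNIV. t i \<otimes> star \<AA> (t i)) = \<one>"
  using family by (simp add: ck_family_def)

lemma star_t_sum:
  assumes "\<And>j. c j \<in> carrier \<AA>" "finite S"
  shows "star \<AA> (t i) \<otimes> (\<Oplus>j\<in>S. t j \<otimes> c j) = (if i \<in> S then star \<AA> (t i) \<otimes> t i \<otimes> c i else \<zero>)"
proof -
  have "star \<AA> (t i) \<otimes> (\<Oplus>j\<in>S. t j \<otimes> c j) = (\<Oplus>j\<in>S. star \<AA> (t i) \<otimes> (t j \<otimes> c j))"
    by (rule finsum_rdistr) (use assms in auto)
  also have "\<dots> = (if i \<in> S then star \<AA> (t i) \<otimes> (t i \<otimes> c i) else \<zero>)"
    by (rule finsum_delta) (use assms star_t_t_other in \<open>auto simp flip: m_assoc\<close>)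
  finally show ?thesis using assms by (simp add: m_assoc)
qed

text \<open>The terms with \<open>i \<noteq> j\<close> vanish, since \<open>t\<^sub>i\<^sup>* t\<^sub>j = 0\<close>.\<close>

lemma block_mult:
  assumes [simp]: "\<And>j. a j \<in> carrier \<AA>" "\<And>j. b j \<in> carrier \<AA>"
  shows "(\<Oplus>j\<in>UNIV. t j \<otimes> a j \<otimes> star \<AA> (t j)) \<otimes> (\<Oplus>j\<in>UNIV. t j \<otimes> b j \<otimes> star \<AA> (t j)) =
    (\<Oplus>j\<in>UNIV. t j \<otimes> (a j \<otimes> (star \<AA> (t j) \<otimes> t j) \<otimes> b j) \<otimes> star \<AA> (t j))"
proof -
  have "(\<Oplus>j\<in>UNIV. t j \<otimes> a j \<otimes> star \<AA> (t j)) \<otimes> (\<Oplus>j\<in>UNIV. t j \<otimes> b j \<otimes> star \<AA> (t j)) =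
      (\<Oplus>i\<in>UNIV. t i \<otimes> a i \<otimes> star \<AA> (t i) \<otimes> (\<Oplus>j\<in>UNIV. t j \<otimes> b j \<otimes> star \<AA> (t j)))"
    by (rule finsum_ldistr) auto
  also have "\<dots> = (\<Oplus>j\<in>UNIV. t j \<otimes> (a j \<otimes> (star \<AA> (t j) \<otimes> t j) \<otimes> b j) \<otimes> star \<AA> (t j))"
  proof (rule finsum_cong')
    fix i :: 'n
    show "t i \<otimes> a i \<otimes> star \<AA> (t i) \<otimes> (\<Oplus>j\<in>UNIV. t j \<otimes> b j \<otimes> star \<AA> (t j)) =
        t i \<otimes> (a i \<otimes> (star \<AA> (t i) \<otimes> t i) \<otimes> b i) \<otimes> star \<AA> (t i)"
      using star_t_sum[of "\<lambda>j. b j \<otimes> star \<AA> (t j)" UNIV i] by (simp add: m_assoc Pi_iff)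
  qed auto
  finally show ?thesis .
qed

text \<open>\<open>coord_proj n U\<close> is the projection belonging to a set \<open>U\<close> that depends on the coordinates
  \<open>0, \<dots>, n\<close>. The recursion is forced by \<open>\<Sum>\<^sub>j t\<^sub>j t\<^sub>j\<^sup>* = 1\<close>: the part of \<open>U\<close> that starts with \<open>j\<close> contributes
  \<open>t\<^sub>j\<close> times the projection of what may follow \<open>j\<close>, times \<open>t\<^sub>j\<^sup>*\<close>. It starts at one coordinate rather than
  at none, because the points that may follow \<open>j\<close> form a set that depends on one coordinate.\<close>

primrec coord_proj :: "nat \<Rightarrow> (nat \<Rightarrow> 'n) set \<Rightarrow> 'a" where
  "coord_proj 0 U = (\<Oplus>j\<in>(\<lambda>x. x 0) ` U. t j \<otimes> star \<AA> (t j))"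
| "coord_proj (Suc n) U = (\<Oplus>j\<in>UNIV. t j \<otimes> coord_proj n (pull A j U) \<otimes> star \<AA> (t j))"

lemma coord_proj_in [simp]: "coord_proj n U \<in> carrier \<AA>"
  by (induction n arbitrary: U) (auto intro!: finsum_closed)

lemma coord_proj_star: "star \<AA> (coord_proj n U) = coord_proj n U"
  by (induction n arbitrary: U) (simp_all add: star_finsum star_mult star_star m_assoc)

text \<open>The Cuntz--Krieger relation \<open>t\<^sub>i\<^sup>* t\<^sub>i = \<Sum>\<^sub>j A(i, j) t\<^sub>j t\<^sub>j\<^sup>*\<close>, read as a statement about sets of points.\<close>

lemma coord_proj_follow_0: "coord_proj 0 (follow A i) = star \<AA> (t i) \<otimes> t i"
proof -
  have "star \<AA> (t i) \<otimes> t i = (\<Oplus>j\<in>UNIV. of_int (A $ i $ j) \<odot> (t j \<otimes> star \<AA> (t j)))"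
    using family by (simp add: ck_family_def)
  also have "\<dots> = (\<Oplus>j\<in>{j. A $ i $ j = 1}. t j \<otimes> star \<AA> (t j))"
  proof (rule add.finprod_mono_neutral_cong_right)
    show "of_int (A $ i $ j) \<odot> (t j \<otimes> star \<AA> (t j)) = \<zero>" if "j \<in> UNIV - {j. A $ i $ j = 1}" for j
    proof -
      have "A $ i $ j = 0" using matrix that unfolding ck_matrix_def by fastforce
      then show ?thesis by (simp add: smult_0)
    qed
  qed (auto simp: smult_1)
  finally show ?thesis using first_letters_follow[OF matrix] by simp
qed

lemma coord_proj_empty [simp]: "coord_proj n {} = \<zero>"
  by (induction n) (simp_all add: pull_def)

text \<open>The induction takes place on the pieces \<open>pull A j U\<close>; it starts because a set that depends on the
  first letter only contains either all points that start with \<open>j\<close> or none of them.\<close>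

lemma coord_proj_Suc: "determined A (Suc n) U \<Longrightarrow> coord_proj (Suc n) U = coord_proj n U"
proof (induction n arbitrary: U)
  case 0
  have "coord_proj (Suc 0) U = (\<Oplus>j\<in>UNIV. if j \<in> (\<lambda>x. x 0) ` U then t j \<otimes> star \<AA> (t j) else \<zero>)"
    unfolding coord_proj.simps(2)
  proof (rule finsum_cong')
    fix j :: 'n
    show "t j \<otimes> coord_proj 0 (pull A j U) \<otimes> star \<AA> (t j) =
        (if j \<in> (\<lambda>x. x 0) ` U then t j \<otimes> star \<AA> (t j) else \<zero>)"
      unfolding pull_determined_1[OF 0]
      by (simp add: coord_proj_follow_0 t_star_t del: coord_proj.simps)
  qed auto
  also have "\<dots> = coord_proj 0 U"
    unfolding coord_proj.simps by (rule add.finprod_mono_neutral_cong_right) auto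
  finally show ?case .
next
  case (Suc n)
  have "coord_proj (Suc n) (pull A j U) = coord_proj n (pull A j U)" for j
    by (rule Suc.IH) (rule determined_pull[OF Suc.prems])
  then show ?case by (simp only: coord_proj.simps(2)[of "Suc n"] coord_proj.simps(2)[of n U])
qed

lemma coord_proj_stable: "determined A (Suc n) U \<Longrightarrow> n \<le> m \<Longrightarrow> coord_proj m U = coord_proj n U"
proof (induction m)
  case (Suc m)
  show ?case
  proof (cases "n = Suc m")
    case False
    then have "n \<le> m" using Suc by simp
    moreover from this have "determined A (Suc m) U" using determined_mono[OF Suc.prems(1), of "Suc m"] by simp
    ultimately show ?thesis using Suc coord_proj_Suc by simp
  qed simp
qed simp

lemma coord_proj_follow: "coord_proj n (follow A i) = star \<AA> (t i) \<otimes> t i"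
  using coord_proj_stable[OF determined_follow[of A 0 i], of n] coord_proj_follow_0 by simp

lemma coord_proj_space: "coord_proj n X = \<one>"
proof -
  have "j \<in> (\<lambda>x. x 0) ` X" for j using exists_point[OF matrix, of j] by auto
  then have "(\<lambda>x. x 0) ` X = UNIV" by blast
  then have "coord_proj 0 X = \<one>" by (simp add: sum_ranges)
  then show ?thesis using coord_proj_stable[of 0 X n] by simp
qed

lemma first_letters_Int:
  assumes "determined A (Suc 0) U" "V \<subseteq> X" shows "(\<lambda>x. x 0) ` (U \<inter> V) = (\<lambda>x. x 0) ` U \<inter> (\<lambda>x. x 0) ` V"
proof (intro equalityI subsetI)
  fix j assume "j \<in> (\<lambda>x. x 0) ` U \<inter> (\<lambda>x. x 0) ` V"
  then obtain x y where xy: "x \<in> U" "x 0 = j" "y \<in> V" "y 0 = j" by auto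
  then have "y \<in> U" using determinedD[OF assms(1), of x y] assms(2) by auto
  then show "j \<in> (\<lambda>x. x 0) ` (U \<inter> V)" using xy by (intro image_eqI[of _ _ y]) simp_all
qed auto

lemma range_proj_mult:
  "t i \<otimes> star \<AA> (t i) \<otimes> (t j \<otimes> star \<AA> (t j)) = (if i = j then t i \<otimes> star \<AA> (t i) else \<zero>)"
proof -
  have "t i \<otimes> star \<AA> (t i) \<otimes> (t j \<otimes> star \<AA> (t j)) = t i \<otimes> (star \<AA> (t i) \<otimes> t j) \<otimes> star \<AA> (t j)"
    by (simp add: m_assoc)
  then show ?thesis by (simp add: t_star_t star_t_t_other)
qed

lemma coord_proj_mult:
  "determined A (Suc n) U \<Longrightarrow> determined A (Suc n) V \<Longrightarrow> coord_proj n U \<otimes> coord_proj n V = coord_proj n (U \<inter> V)"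
proof (induction n arbitrary: U V)
  case 0
  let ?S = "(\<lambda>x. x 0) ` U" and ?T = "(\<lambda>x. x 0) ` V"
  have "coord_proj 0 U \<otimes> coord_proj 0 V = (\<Oplus>i\<in>?S. t i \<otimes> star \<AA> (t i) \<otimes> (\<Oplus>j\<in>?T. t j \<otimes> star \<AA> (t j)))"
    unfolding coord_proj.simps by (rule finsum_ldistr) (auto intro: finsum_closed)
  also have "\<dots> = (\<Oplus>i\<in>?S \<inter> ?T. t i \<otimes> star \<AA> (t i))"
  proof -
    have *: "t i \<otimes> star \<AA> (t i) \<otimes> (\<Oplus>j\<in>?T. t j \<otimes> star \<AA> (t j)) = (if i \<in> ?T then t i \<otimes> star \<AA> (t i) else \<zero>)" for i
    proof -
      have "t i \<otimes> star \<AA> (t i) \<otimes> (\<Oplus>j\<in>?T. t j \<otimes> star \<AA> (t j)) =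
          (\<Oplus>j\<in>?T. t i \<otimes> star \<AA> (t i) \<otimes> (t j \<otimes> star \<AA> (t j)))"
        by (rule finsum_rdistr) auto
      also have "\<dots> = (if i \<in> ?T then t i \<otimes> star \<AA> (t i) \<otimes> (t i \<otimes> star \<AA> (t i)) else \<zero>)"
        by (rule finsum_delta) (auto simp: range_proj_mult)
      finally show ?thesis by (simp add: range_proj_mult)
    qed
    show ?thesis unfolding * by (rule add.finprod_mono_neutral_cong_right) auto
  qed
  also have "?S \<inter> ?T = (\<lambda>x. x 0) ` (U \<inter> V)"
    using first_letters_Int[OF 0(1) determined_subset[OF 0(2)]] by simp
  finally show ?case by simp
next
  case (Suc n)
  have "coord_proj (Suc n) U \<otimes> coord_proj (Suc n) V =
      (\<Oplus>j\<in>UNIV. t j \<otimes> (coord_proj n (pull A j U) \<otimes> (star \<AA> (t j) \<otimes> t j) \<otimes> coord_proj n (pull A j V)) \<otimes> star \<AA> (t j))"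
    unfolding coord_proj.simps by (rule block_mult) simp_all
  also have "\<dots> = coord_proj (Suc n) (U \<inter> V)"
  proof -
    have "coord_proj n (pull A j U) \<otimes> (star \<AA> (t j) \<otimes> t j) \<otimes> coord_proj n (pull A j V) =
        coord_proj n (pull A j (U \<inter> V))" for j
    proof -
      have d: "determined A (Suc n) (pull A j U)" "determined A (Suc n) (pull A j V)"
        using determined_pull Suc.prems by blast+
      have "pull A j U \<inter> follow A j \<inter> pull A j V = pull A j (U \<inter> V)"
        using pull_subset_follow[OF determined_subset[OF Suc.prems(1)], of j] by (auto simp: pull_def)
      then show ?thesis
        using d by (simp add: Suc.IH determined_Int determined_follow flip: coord_proj_follow[of n])
    qed
    then show ?thesis by simp
  qed
  finally show ?case .
qed

lemma coord_proj_add: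
  "determined A (Suc n) U \<Longrightarrow> determined A (Suc n) V \<Longrightarrow> U \<inter> V = {} \<Longrightarrow>
    coord_proj n (U \<union> V) = coord_proj n U \<oplus> coord_proj n V"
proof (induction n arbitrary: U V)
  case 0
  have "(\<lambda>x. x 0) ` U \<inter> (\<lambda>x. x 0) ` V = {}"
    using first_letters_Int[OF 0(1) determined_subset[OF 0(2)]] 0(3) by simp
  then show ?case by (simp add: image_Un finsum_Un_disjoint)
next
  case (Suc n)
  have "coord_proj n (pull A j (U \<union> V)) = coord_proj n (pull A j U) \<oplus> coord_proj n (pull A j V)" for j
  proof -
    have "pull A j (U \<union> V) = pull A j U \<union> pull A j V" "pull A j U \<inter> pull A j V = {}"
      using Suc.prems(3) by (auto simp: pull_def)
    then show ?thesis
      using Suc.IH[OF determined_pull[OF Suc.prems(1)] determined_pull[OF Suc.prems(2)]] by simp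
  qed
  then show ?case by (simp add: l_distr r_distr finsum_addf Pi_iff)
qed

text \<open>All sufficiently large numbers of coordinates give the same projection (\<open>proj_eq\<close>); the least one is a choice.\<close>

definition proj :: "(nat \<Rightarrow> 'n) set \<Rightarrow> 'a" where
  "proj U = coord_proj (LEAST n. determined A (Suc n) U) U"

lemma proj_in [simp]: "proj U \<in> carrier \<AA>"
  by (simp add: proj_def)

lemma proj_eq: assumes "determined A (Suc n) U" shows "proj U = coord_proj n U"
  unfolding proj_def
  using coord_proj_stable[OF LeastI[where P = "\<lambda>n. determined A (Suc n) U", OF assms] Least_le[where P = "\<lambda>n. determined A (Suc n) U", OF assms]]
  by simp

lemma proj_star: "star \<AA> (proj U) = proj U"
  by (simp add: proj_def coord_proj_star)

lemma proj_empty: "proj {} = \<zero>"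
  by (simp add: proj_def)

lemma proj_space: "proj X = \<one>"
  by (simp add: proj_def coord_proj_space)

lemma proj_mult: assumes "clopen A U" "clopen A V" shows "proj U \<otimes> proj V = proj (U \<inter> V)"
proof -
  obtain n where n: "determined A (Suc n) U" "determined A (Suc n) V" using clopen_common[OF assms] .
  from coord_proj_mult[OF this] show ?thesis
    using proj_eq[OF n(1)] proj_eq[OF n(2)] proj_eq[OF determined_Int[OF n]] by simp
qed

lemma proj_mult_self: "clopen A U \<Longrightarrow> proj U \<otimes> proj U = proj U"
  by (simp add: proj_mult)

lemma proj_comm: "clopen A U \<Longrightarrow> clopen A V \<Longrightarrow> proj U \<otimes> proj V = proj V \<otimes> proj U"
  by (simp add: proj_mult Int_commute)

lemma proj_add: assumes "clopen A U" "clopen A V" "U \<inter> V = {}" shows "proj (U \<union> V) = proj U \<oplus> proj V"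
proof -
  obtain n where n: "determined A (Suc n) U" "determined A (Suc n) V" using clopen_common[OF assms(1,2)] .
  from coord_proj_add[OF this assms(3)] show ?thesis
    using proj_eq[OF n(1)] proj_eq[OF n(2)] proj_eq[OF determined_Un[OF n]] by simp
qed

lemma proj_compl: assumes U: "clopen A U" shows "proj (X - U) = \<one> \<ominus> proj U"
proof -
  have "U \<union> (X - U) = X" using clopen_subset[OF U] by blast
  then have "\<one> = proj U \<oplus> proj (X - U)"
    using proj_add[OF U clopen_intros(5)[OF U]] proj_space by simp
  then show ?thesis by (simp add: a_minus_def a_comm[of "proj U"] a_assoc r_neg)
qed

lemma proj_UN:
  assumes "finite S" "\<And>i. i \<in> S \<Longrightarrow> clopen A (V i)"
    "\<And>i j. i \<in> S \<Longrightarrow> j \<in> S \<Longrightarrow> i \<noteq> j \<Longrightarrow> V i \<inter> V j = {}"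
  shows "proj (\<Union>i\<in>S. V i) = (\<Oplus>i\<in>S. proj (V i))"
  using assms
proof (induction S rule: finite_induct)
  case (insert i S)
  have "V i \<inter> (\<Union>i\<in>S. V i) = {}" using insert.prems(2)[of i] insert.hyps(2) by blast
  then have "proj (V i \<union> (\<Union>i\<in>S. V i)) = proj (V i) \<oplus> proj (\<Union>i\<in>S. V i)"
    using insert by (intro proj_add clopen_UN) auto
  then show ?case using insert by (simp add: Pi_iff)
qed (simp add: proj_empty)

lemma star_t_t_proj: "star \<AA> (t i) \<otimes> t i = proj (follow A i)"
  using proj_eq[OF determined_follow] coord_proj_follow by simp

lemma t_star_t_proj: "t j \<otimes> star \<AA> (t j) = proj (coord A 0 j)"
proof -
  have "(\<lambda>x. x 0) ` coord A 0 j = {j}" using exists_point[OF matrix, of j] by (auto simp: coord_def)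
  then show ?thesis using proj_eq[OF determined_coord] by simp
qed

lemma proj_decomposition:
  assumes "clopen A U" shows "proj U = (\<Oplus>j\<in>UNIV. t j \<otimes> proj (pull A j U) \<otimes> star \<AA> (t j))"
proof -
  obtain n where n: "determined A (Suc n) U" using clopenE[OF assms] .
  have n': "determined A (Suc (Suc n)) U" using determined_mono[OF n] by simp
  show ?thesis using proj_eq[OF n'] proj_eq[OF determined_pull[OF n']] by simp
qed

lemma t_proj_t:
  assumes "clopen A W" shows "t j \<otimes> proj W \<otimes> star \<AA> (t j) = proj (coord A 0 j \<inter> shift_vimage A W)"
proof -
  have "proj (coord A 0 j \<inter> shift_vimage A W) =
      (\<Oplus>k\<in>UNIV. t k \<otimes> proj (pull A k (coord A 0 j \<inter> shift_vimage A W)) \<otimes> star \<AA> (t k))"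
    by (intro proj_decomposition clopen_intros clopen_coord clopen_shift_vimage assms)
  also have "\<dots> = (if j \<in> UNIV then t j \<otimes> proj (pull A j (coord A 0 j \<inter> shift_vimage A W)) \<otimes> star \<AA> (t j) else \<zero>)"
    by (rule finsum_delta) (simp_all add: pull_coord_vimage[OF clopen_subset[OF assms]] proj_empty)
  also have "\<dots> = t j \<otimes> (proj W \<otimes> (star \<AA> (t j) \<otimes> t j)) \<otimes> star \<AA> (t j)"
    by (simp add: pull_coord_vimage[OF clopen_subset[OF assms]] star_t_t_proj proj_mult clopen_follow assms)
  also have "\<dots> = t j \<otimes> proj W \<otimes> (star \<AA> (t j) \<otimes> t j \<otimes> star \<AA> (t j))"
    by (simp add: m_assoc)
  finally show ?thesis by (simp add: star_t_t)
qed

lemma star_t_proj_t: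
  assumes "clopen A U" shows "star \<AA> (t j) \<otimes> proj U \<otimes> t j = proj (pull A j U)"
proof -
  let ?f = "star \<AA> (t j) \<otimes> t j"
  have "star \<AA> (t j) \<otimes> proj U = star \<AA> (t j) \<otimes> (\<Oplus>k\<in>UNIV. t k \<otimes> (proj (pull A k U) \<otimes> star \<AA> (t k)))"
    by (subst proj_decomposition[OF assms]) (simp add: m_assoc)
  also have "\<dots> = ?f \<otimes> (proj (pull A j U) \<otimes> star \<AA> (t j))"
    by (subst star_t_sum) simp_all
  finally have "star \<AA> (t j) \<otimes> proj U \<otimes> t j = ?f \<otimes> proj (pull A j U) \<otimes> ?f"
    by (simp add: m_assoc)
  also have "\<dots> = proj (follow A j \<inter> pull A j U \<inter> follow A j)"
    by (simp add: star_t_t_proj proj_mult clopen_intros clopen_follow clopen_pull assms)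
  also have "follow A j \<inter> pull A j U \<inter> follow A j = pull A j U"
    using pull_subset_follow[OF clopen_subset[OF assms], of j] by blast
  finally show ?thesis .
qed

lemma proj_t:
  assumes "clopen A U" shows "proj U \<otimes> t j = t j \<otimes> proj (pull A j U)"
proof -
  have "proj U \<otimes> t j = proj U \<otimes> (t j \<otimes> star \<AA> (t j)) \<otimes> t j" by (simp add: m_assoc t_star_t)
  also have "\<dots> = (t j \<otimes> star \<AA> (t j)) \<otimes> proj U \<otimes> t j"
    by (simp add: t_star_t_proj proj_comm assms clopen_coord)
  also have "\<dots> = t j \<otimes> (star \<AA> (t j) \<otimes> proj U \<otimes> t j)" by (simp add: m_assoc)
  finally show ?thesis by (simp add: star_t_proj_t assms)
qed

definition s where "s = (\<Oplus>j\<in>UNIV. t j)"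

lemma s_in [simp]: "s \<in> carrier \<AA>"
  by (simp add: s_def Pi_iff)

lemma proj_s: assumes "clopen A U" shows "proj U \<otimes> s = (\<Oplus>j\<in>UNIV. t j \<otimes> proj (pull A j U))"
  unfolding s_def using assms by (subst finsum_rdistr) (simp_all add: Pi_iff proj_t)

lemma s_proj: assumes "clopen A W" shows "s \<otimes> proj W = proj (shift_vimage A W) \<otimes> s"
proof -
  have "proj (shift_vimage A W) \<otimes> s = (\<Oplus>j\<in>UNIV. t j \<otimes> proj (pull A j (shift_vimage A W)))"
    by (rule proj_s) (rule clopen_shift_vimage[OF assms])
  also have "\<dots> = (\<Oplus>j\<in>UNIV. t j \<otimes> proj W)"
  proof (rule finsum_cong')
    fix j
    have "proj (pull A j (shift_vimage A W)) = (star \<AA> (t j) \<otimes> t j) \<otimes> proj W"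
      by (simp add: star_t_t_proj proj_mult clopen_follow assms pull_vimage clopen_subset Int_commute)
    then have "t j \<otimes> proj (pull A j (shift_vimage A W)) = t j \<otimes> (star \<AA> (t j) \<otimes> t j) \<otimes> proj W"
      by (simp add: m_assoc)
    then show "t j \<otimes> proj (pull A j (shift_vimage A W)) = t j \<otimes> proj W" by (simp add: t_star_t)
  qed auto
  also have "\<dots> = s \<otimes> proj W" unfolding s_def by (subst finsum_ldistr) (simp_all add: Pi_iff)
  finally show ?thesis by simp
qed

text \<open>Where the shift is injective, \<open>s s\<^sup>*\<close> acts as the identity: the cross terms
  \<open>t\<^sub>j t\<^sub>k\<^sup>*\<close> connect points with the same image.\<close>

lemma corner:
  assumes U: "clopen A U" and inj: "inj_on shift U"
  shows "proj U \<otimes> s \<otimes> (star \<AA> s \<otimes> proj U) = proj U"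
proof -
  let ?p = "\<lambda>j. proj (pull A j U)"
  have "star \<AA> s \<otimes> proj U = star \<AA> (proj U \<otimes> s)" by (simp add: star_mult proj_star)
  also have "\<dots> = (\<Oplus>j\<in>UNIV. ?p j \<otimes> star \<AA> (t j))"
    by (simp add: proj_s U star_finsum star_mult proj_star)
  finally have r: "star \<AA> s \<otimes> proj U = (\<Oplus>j\<in>UNIV. ?p j \<otimes> star \<AA> (t j))" .
  have "proj U \<otimes> s \<otimes> (star \<AA> s \<otimes> proj U) = (\<Oplus>i\<in>UNIV. t i \<otimes> ?p i \<otimes> (\<Oplus>j\<in>UNIV. ?p j \<otimes> star \<AA> (t j)))"
    unfolding r proj_s[OF U] by (rule finsum_ldistr) (auto intro: finsum_closed)
  also have "\<dots> = (\<Oplus>i\<in>UNIV. t i \<otimes> ?p i \<otimes> star \<AA> (t i))"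
  proof (rule finsum_cong')
    fix i
    have "t i \<otimes> ?p i \<otimes> (\<Oplus>j\<in>UNIV. ?p j \<otimes> star \<AA> (t j)) = (\<Oplus>j\<in>UNIV. t i \<otimes> ?p i \<otimes> (?p j \<otimes> star \<AA> (t j)))"
      by (rule finsum_rdistr) auto
    also have "\<dots> = (if i \<in> UNIV then t i \<otimes> ?p i \<otimes> (?p i \<otimes> star \<AA> (t i)) else \<zero>)"
    proof (rule finsum_delta)
      fix j assume "j \<noteq> i"
      then have "?p i \<otimes> ?p j = \<zero>"
        using pull_disjoint[OF inj, of i j A] by (simp add: proj_mult clopen_pull U proj_empty)
      moreover have "t i \<otimes> ?p i \<otimes> (?p j \<otimes> star \<AA> (t j)) = t i \<otimes> (?p i \<otimes> ?p j) \<otimes> star \<AA> (t j)"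
        by (simp add: m_assoc)
      ultimately show "t i \<otimes> ?p i \<otimes> (?p j \<otimes> star \<AA> (t j)) = \<zero>" by simp
    qed auto
    also have "\<dots> = t i \<otimes> (?p i \<otimes> ?p i) \<otimes> star \<AA> (t i)" by (simp add: m_assoc)
    finally show "t i \<otimes> ?p i \<otimes> (\<Oplus>j\<in>UNIV. ?p j \<otimes> star \<AA> (t j)) = t i \<otimes> ?p i \<otimes> star \<AA> (t i)"
      by (simp add: proj_mult_self clopen_pull U)
  qed auto
  finally show ?thesis using proj_decomposition[OF U] by simp
qed

text \<open>The compression of \<open>\<tau>(proj W) = s (proj W) s\<^sup>*\<close> to a set on which the shift is injective: moving
  \<open>proj W\<close> past \<open>s\<close> gives \<open>proj (\<sigma>\<^sup>-\<^sup>1 W)\<close>, and the remaining \<open>s s\<^sup>*\<close> is absorbed.\<close>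

lemma corner_tau:
  assumes U: "clopen A U" and W: "clopen A W" and inj: "inj_on shift U"
  shows "proj U \<otimes> (s \<otimes> proj W \<otimes> star \<AA> s) \<otimes> proj U = proj (U \<inter> shift_vimage A W)"
proof -
  note V = clopen_shift_vimage[OF W]
  have "proj U \<otimes> (s \<otimes> proj W \<otimes> star \<AA> s) \<otimes> proj U =
      (proj U \<otimes> proj (shift_vimage A W)) \<otimes> s \<otimes> (star \<AA> s \<otimes> proj U)"
    by (simp add: s_proj W m_assoc)
  also have "\<dots> = proj (shift_vimage A W) \<otimes> (proj U \<otimes> s \<otimes> (star \<AA> s \<otimes> proj U))"
    by (simp add: proj_comm[OF U V] m_assoc)
  also have "\<dots> = proj (shift_vimage A W \<inter> U)" by (simp add: corner U inj proj_mult V)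
  finally show ?thesis by (simp add: Int_commute)
qed

text \<open>Dually, \<open>s\<^sup>* (proj U) s\<close> is the sum of the projections of the sets \<open>pull A j U\<close>, which cover the image
  \<open>\<sigma> U\<close> and are disjoint when \<open>\<sigma>\<close> is injective on \<open>U\<close>.\<close>

lemma star_s_proj_s:
  assumes U: "clopen A U" and inj: "inj_on shift U"
  shows "star \<AA> s \<otimes> (proj U \<otimes> s) = proj (shift ` U)"
proof -
  have st: "star \<AA> s \<otimes> t j = star \<AA> (t j) \<otimes> t j" for j
  proof -
    have "star \<AA> s \<otimes> t j = (\<Oplus>i\<in>UNIV. star \<AA> (t i) \<otimes> t j)"
      unfolding s_def by (simp add: star_finsum finsum_ldistr Pi_iff)
    also have "\<dots> = (if j \<in> UNIV then star \<AA> (t j) \<otimes> t j else \<zero>)"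
      by (rule finsum_delta) (simp_all add: star_t_t_other)
    finally show ?thesis by simp
  qed
  have "star \<AA> s \<otimes> (proj U \<otimes> s) = (\<Oplus>j\<in>UNIV. star \<AA> s \<otimes> (t j \<otimes> proj (pull A j U)))"
    unfolding proj_s[OF U] by (rule finsum_rdistr) auto
  also have "\<dots> = (\<Oplus>j\<in>UNIV. proj (pull A j U))"
  proof (rule finsum_cong')
    fix j
    have "star \<AA> s \<otimes> (t j \<otimes> proj (pull A j U)) = proj (follow A j) \<otimes> proj (pull A j U)"
      by (simp add: st star_t_t_proj flip: m_assoc)
    also have "\<dots> = proj (pull A j U)"
      using pull_subset_follow[OF clopen_subset[OF U], of j]
      by (simp add: proj_mult clopen_follow clopen_pull U Int_absorb1)
    finally show "star \<AA> s \<otimes> (t j \<otimes> proj (pull A j U)) = proj (pull A j U)" .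
  qed auto
  also have "\<dots> = proj (\<Union>j. pull A j U)"
    by (rule proj_UN[symmetric]) (simp_all add: clopen_pull U pull_disjoint[OF inj])
  finally show ?thesis by (simp only: shift_image_pull[OF clopen_subset[OF U]])
qed

definition word_elem where "word_elem \<alpha> = foldr (\<lambda>i x. t i \<otimes> x) \<alpha> \<one>"

lemma word_elem_simps [simp]: "word_elem [] = \<one>" "word_elem (j # \<alpha>) = t j \<otimes> word_elem \<alpha>"
  by (simp_all add: word_elem_def)

lemma word_elem_in [simp]: "word_elem \<alpha> \<in> carrier \<AA>"
  by (induction \<alpha>) simp_all

lemma word_elem_snoc: "word_elem (\<alpha> @ [j]) = word_elem \<alpha> \<otimes> t j"
  by (induction \<alpha>) (simp_all add: m_assoc)

lemma proj_word: "word_elem \<alpha> \<otimes> star \<AA> (word_elem \<alpha>) = proj {x \<in> X. \<forall>i<length \<alpha>. x i = \<alpha> ! i}"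
  and clopen_word: "clopen A {x \<in> X. \<forall>i<length \<alpha>. x i = \<alpha> ! i}"
proof -
  have "clopen A {x \<in> X. \<forall>i<length \<alpha>. x i = \<alpha> ! i} \<and>
    word_elem \<alpha> \<otimes> star \<AA> (word_elem \<alpha>) = proj {x \<in> X. \<forall>i<length \<alpha>. x i = \<alpha> ! i}"
  proof (induction \<alpha>)
    case Nil show ?case by (simp add: star_one proj_space clopen_intros)
  next
    case (Cons j \<alpha>)
    let ?W = "{x \<in> X. \<forall>i<length \<alpha>. x i = \<alpha> ! i}"
    have eq: "{x \<in> X. \<forall>i<length (j # \<alpha>). x i = (j # \<alpha>) ! i} = coord A 0 j \<inter> shift_vimage A ?W"
      by (auto simp: coord_def shift_vimage_def shift_in_shift_space All_less_Suc2) (simp_all add: shift_def)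
    have "word_elem (j # \<alpha>) \<otimes> star \<AA> (word_elem (j # \<alpha>)) =
        t j \<otimes> (word_elem \<alpha> \<otimes> star \<AA> (word_elem \<alpha>)) \<otimes> star \<AA> (t j)"
      by (simp add: star_mult m_assoc)
    also have "\<dots> = proj (coord A 0 j \<inter> shift_vimage A ?W)" using Cons t_proj_t by simp
    finally show ?case unfolding eq
      using Cons by (simp add: clopen_intros clopen_coord clopen_shift_vimage)
  qed
  then show "word_elem \<alpha> \<otimes> star \<AA> (word_elem \<alpha>) = proj {x \<in> X. \<forall>i<length \<alpha>. x i = \<alpha> ! i}"
    "clopen A {x \<in> X. \<forall>i<length \<alpha>. x i = \<alpha> ! i}" by simp_all
qed

lemma word_elem_inadmissible: "\<not> admissible_word A \<alpha> \<Longrightarrow> word_elem \<alpha> \<otimes> star \<AA> (word_elem \<alpha>) = \<zero>"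
proof -
  assume "\<not> admissible_word A \<alpha>"
  then obtain i where "Suc i < length \<alpha>" "A $ (\<alpha> ! i) $ (\<alpha> ! Suc i) \<noteq> 1" by (auto simp: admissible_word_def)
  then have "{x \<in> X. \<forall>i<length \<alpha>. x i = \<alpha> ! i} = {}"
    by (auto simp: shift_space_def) (metis Suc_lessD)
  then show ?thesis by (simp only: proj_word proj_empty)
qed

text \<open>Unfolding the recursion writes \<open>proj U\<close> as a sum of projections of words. The induction has to carry the
  word \<open>\<beta>\<close> that has been split off so far.\<close>

lemma proj_in_generated:
  assumes S: "\<zero> \<in> S" "\<And>x y. x \<in> S \<Longrightarrow> y \<in> S \<Longrightarrow> x \<oplus> y \<in> S"
    and gen: "\<And>\<alpha>. admissible_word A \<alpha> \<Longrightarrow> word_elem \<alpha> \<otimes> star \<AA> (word_elem \<alpha>) \<in> S"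
  shows "proj U \<in> S"
proof -
  have sum: "(\<Oplus>j\<in>T. f j) \<in> S" if "finite T" "\<And>j. f j \<in> S" "\<And>j. f j \<in> carrier \<AA>" for T and f :: "'n \<Rightarrow> 'a"
    using that(1) by (induction T rule: finite_induct) (simp_all add: S that Pi_iff)
  have gen': "word_elem \<alpha> \<otimes> star \<AA> (word_elem \<alpha>) \<in> S" for \<alpha>
    using gen word_elem_inadmissible S(1) by (cases "admissible_word A \<alpha>") simp_all
  have push: "word_elem \<beta> \<otimes> (t j \<otimes> c \<otimes> star \<AA> (t j)) \<otimes> star \<AA> (word_elem \<beta>) =
      word_elem (\<beta> @ [j]) \<otimes> c \<otimes> star \<AA> (word_elem (\<beta> @ [j]))" if "c \<in> carrier \<AA>" for \<beta> j c
    using that by (simp add: word_elem_snoc star_mult m_assoc)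
  have push_sum: "word_elem \<beta> \<otimes> (\<Oplus>j\<in>T. f j) \<otimes> star \<AA> (word_elem \<beta>) =
      (\<Oplus>j\<in>T. word_elem \<beta> \<otimes> f j \<otimes> star \<AA> (word_elem \<beta>))"
    if "finite T" "\<And>j. f j \<in> carrier \<AA>" for \<beta> T and f :: "'n \<Rightarrow> 'a"
    using that by (simp add: finsum_rdistr finsum_ldistr Pi_iff)
  have "word_elem \<beta> \<otimes> coord_proj n U \<otimes> star \<AA> (word_elem \<beta>) \<in> S" for n \<beta> U
  proof (induction n arbitrary: \<beta> U)
    case 0
    have "word_elem \<beta> \<otimes> (t j \<otimes> star \<AA> (t j)) \<otimes> star \<AA> (word_elem \<beta>) \<in> S" for j
      using push[of \<one> \<beta> j] gen'[of "\<beta> @ [j]"] by simp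
    then show ?case by (simp add: push_sum sum)
  next
    case (Suc n)
    show ?case by (simp add: push_sum push) (rule sum, simp_all add: Suc)
  qed
  from this[of "[]"] show ?thesis by (simp add: proj_def star_one)
qed

end


section \<open>Projections in the diagonal\<close>

context cstar_algebra
begin

lemma minus_eq_zero_iff:
  assumes [simp]: "x \<in> carrier \<AA>" "y \<in> carrier \<AA>" shows "x \<ominus> y = \<zero> \<longleftrightarrow> x = y"
proof
  assume "x \<ominus> y = \<zero>"
  moreover have "x = (x \<ominus> y) \<oplus> y" by (simp add: a_minus_def a_assoc l_neg)
  ultimately show "x = y" by simp
qed (simp add: a_minus_def r_neg)

lemma subalgebra_carrier: "cstar_subalgebra \<AA> (carrier \<AA>)"
  by (rule cstar_subalgebraI) simp_all

lemma subalgebra_generated: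
  assumes "X \<subseteq> carrier \<AA>"
  shows "cstar_subalgebra \<AA> (cstar_generated \<AA> X)" "X \<subseteq> cstar_generated \<AA> X"
proof -
  have gen_iff: "x \<in> cstar_generated \<AA> X \<longleftrightarrow> (\<forall>S. cstar_subalgebra \<AA> S \<longrightarrow> X \<subseteq> S \<longrightarrow> x \<in> S)" for x
    by (auto simp: cstar_generated_def)
  note D = cstar_subalgebraD
  show "cstar_subalgebra \<AA> (cstar_generated \<AA> X)"
  proof (rule cstar_subalgebraI)
    show "cstar_generated \<AA> X \<subseteq> carrier \<AA>"
      using subalgebra_carrier assms by (auto simp: cstar_generated_def)
    show "\<zero> \<in> cstar_generated \<AA> X" by (simp add: gen_iff D(2))
    show "x \<oplus> y \<in> cstar_generated \<AA> X" "x \<otimes> y \<in> cstar_generated \<AA> X"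
      if "x \<in> cstar_generated \<AA> X" "y \<in> cstar_generated \<AA> X" for x y
      using that by (simp_all add: gen_iff D(3,4))
    show "c \<odot> x \<in> cstar_generated \<AA> X" "star \<AA> x \<in> cstar_generated \<AA> X" if "x \<in> cstar_generated \<AA> X" for c x
      using that by (simp_all add: gen_iff D(5,6))
    show "x \<in> cstar_generated \<AA> X" if "x \<in> carrier \<AA>" "\<And>n::nat. u n \<in> cstar_generated \<AA> X"
      "(\<lambda>n. nrm \<AA> (u n \<ominus> x)) \<longlonglongrightarrow> 0" for u x
    proof -
      have "x \<in> S" if S: "cstar_subalgebra \<AA> S" "X \<subseteq> S" for S
      proof (rule cstar_subalgebra_limit[OF S(1) \<open>x \<in> carrier \<AA>\<close> _ \<open>(\<lambda>n. nrm \<AA> (u n \<ominus> x)) \<longlonglongrightarrow> 0\<close>])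
        show "u n \<in> S" for n using \<open>\<And>n. u n \<in> cstar_generated \<AA> X\<close>[of n] S by (auto simp: cstar_generated_def)
      qed
      then show ?thesis by (auto simp: cstar_generated_def)
    qed
  qed
  show "X \<subseteq> cstar_generated \<AA> X" by (auto simp: cstar_generated_def)
qed

text \<open>To show that the closure is closed, an approximant of \<open>v\<^sub>n\<close> within \<open>1 / (n + 1)\<close> is chosen for each member of a convergent
  sequence \<open>v\<close> in the closure.\<close>

lemma subalgebra_closure:
  assumes L: "L \<subseteq> carrier \<AA>" "\<zero> \<in> L" "\<And>x y. x \<in> L \<Longrightarrow> y \<in> L \<Longrightarrow> x \<oplus> y \<in> L"
    "\<And>x y. x \<in> L \<Longrightarrow> y \<in> L \<Longrightarrow> x \<otimes> y \<in> L" "\<And>c x. x \<in> L \<Longrightarrow> c \<odot> x \<in> L" "\<And>x. x \<in> L \<Longrightarrow> star \<AA> x \<in> L"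
  shows "cstar_subalgebra \<AA> {x. \<exists>u. (\<forall>n. u n \<in> L) \<and> tends u x}" (is "cstar_subalgebra \<AA> ?C")
proof (rule cstar_subalgebraI)
  show "?C \<subseteq> carrier \<AA>" by (auto simp: tends_def)
  show "\<zero> \<in> ?C" using L(2) tends_const[of \<zero>] by (intro CollectI exI[of _ "\<lambda>_. \<zero>"]) simp
  fix x y c assume "x \<in> ?C"
  then obtain u where u: "\<forall>n. u n \<in> L" "tends u x" by blast
  show "c \<odot> x \<in> ?C" using u L(5) tends_smult[OF u(2)] by (intro CollectI exI[of _ "\<lambda>n. c \<odot> u n"]) simp
  show "star \<AA> x \<in> ?C" using u L(6) tends_star[OF u(2)] by (intro CollectI exI[of _ "\<lambda>n. star \<AA> (u n)"]) simp
  assume "y \<in> ?C"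
  then obtain v where v: "\<forall>n. v n \<in> L" "tends v y" by blast
  show "x \<oplus> y \<in> ?C" using u v L(3) tends_add[OF u(2) v(2)] by (intro CollectI exI[of _ "\<lambda>n. u n \<oplus> v n"]) simp
  show "x \<otimes> y \<in> ?C" using u v L(4) tends_mult[OF u(2) v(2)] by (intro CollectI exI[of _ "\<lambda>n. u n \<otimes> v n"]) simp
next
  fix v :: "nat \<Rightarrow> 'a" and x assume x: "x \<in> carrier \<AA>" and v: "\<And>n. v n \<in> ?C" and lim: "(\<lambda>n. nrm \<AA> (v n \<ominus> x)) \<longlonglongrightarrow> 0"
  have vc: "v n \<in> carrier \<AA>" for n using v[of n] by (auto simp: tends_def)
  have "\<exists>d\<in>L. nrm \<AA> (d \<ominus> v n) < inverse (real (Suc n))" for n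
  proof -
    obtain u where u: "\<forall>k. u k \<in> L" "tends u (v n)" using v[of n] by blast
    then have "(\<lambda>k. nrm \<AA> (u k \<ominus> v n)) \<longlonglongrightarrow> 0" by (simp add: tends_def)
    then have "\<forall>\<^sub>F k in sequentially. nrm \<AA> (u k \<ominus> v n) < inverse (real (Suc n))"
      by (rule order_tendstoD) simp
    then show ?thesis using u(1) eventually_sequentially by auto
  qed
  then obtain d where d: "\<And>n. d n \<in> L" "\<And>n. nrm \<AA> (d n \<ominus> v n) < inverse (real (Suc n))" by metis
  have "tends d x"
  proof (rule tendsI)
    show "d n \<in> carrier \<AA>" "x \<in> carrier \<AA>" for n using d L(1) x by auto
    then show "nrm \<AA> (d n \<ominus> x) \<le> inverse (real (Suc n)) + nrm \<AA> (v n \<ominus> x)" for n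
      using nrm_minus_triangle[of "d n" "v n" x] d(2)[of n] vc[of n] by simp
    show "(\<lambda>n. inverse (real (Suc n)) + nrm \<AA> (v n \<ominus> x)) \<longlonglongrightarrow> 0"
      using tendsto_add[OF LIMSEQ_inverse_real_of_nat lim] by simp
  qed
  with d(1) show "x \<in> ?C" by blast
qed

text \<open>A projection \<open>r \<le> p\<close> at distance less than \<open>1/2\<close> from \<open>c p\<close> is \<open>0\<close> or \<open>p\<close>: otherwise
  compressing by \<open>r\<close> gives \<open>\<bar>1 - c\<bar> < 1/2\<close>, and compressing by \<open>p - r\<close> gives \<open>\<bar>c\<bar> < 1/2\<close>.\<close>

lemma subprojection_near_scalar:
  assumes [simp]: "r \<in> carrier \<AA>" "p \<in> carrier \<AA>"
    and rr: "r \<otimes> r = r" and pp: "p \<otimes> p = p" and rp: "r \<otimes> p = r" "p \<otimes> r = r"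
    and near: "nrm \<AA> (r \<ominus> c \<odot> p) < 1 / 2"
  shows "r = \<zero> \<or> r = p"
proof (rule ccontr)
  assume "\<not> (r = \<zero> \<or> r = p)"
  then have "nrm \<AA> r \<noteq> 0" "nrm \<AA> (p \<ominus> r) \<noteq> 0" by (auto simp: nrm_eq_0 minus_eq_zero_iff)
  then have pos: "0 < nrm \<AA> r" "0 < nrm \<AA> (p \<ominus> r)"
    using nrm_nonneg[of r] nrm_nonneg[of "p \<ominus> r"] by auto
  have *: "cmod k < 1 / 2" if "(r \<ominus> c \<odot> p) \<otimes> q = k \<odot> q" "q \<in> carrier \<AA>" "0 < nrm \<AA> q" for k q
  proof -
    have "cmod k * nrm \<AA> q \<le> nrm \<AA> (r \<ominus> c \<odot> p) * nrm \<AA> q"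
      using nrm_mult[of "r \<ominus> c \<odot> p" q] that by (simp add: nrm_smult)
    then have "cmod k \<le> nrm \<AA> (r \<ominus> c \<odot> p)" using that by simp
    with near show ?thesis by simp
  qed
  have "cmod (1 - c) < 1 / 2"
  proof (rule *)
    show "(r \<ominus> c \<odot> p) \<otimes> r = (1 - c) \<odot> r"
      using smult_add_left[of r 1 "- c"] smult_smult[of r "-1" c]
      by (simp add: a_minus_def l_distr l_minus smult_mult_left rr rp smult_1 smult_minus1)
  qed (use pos in simp_all)
  moreover have "cmod (- c) < 1 / 2"
  proof (rule *)
    have "(r \<ominus> c \<odot> p) \<otimes> (p \<ominus> r) = \<ominus> (c \<odot> (p \<ominus> r))"
    proof -
      have "r \<otimes> (p \<ominus> r) = \<zero>" by (simp add: a_minus_def r_distr r_minus rr rp r_neg)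
      moreover have "p \<otimes> (p \<ominus> r) = p \<ominus> r" by (simp add: a_minus_def r_distr r_minus pp rp)
      ultimately show ?thesis
        by (simp add: a_minus_def[of \<AA> r "c \<odot> p"] l_distr l_minus smult_mult_left)
    qed
    then show "(r \<ominus> c \<odot> p) \<otimes> (p \<ominus> r) = (- c) \<odot> (p \<ominus> r)"
      using smult_smult[of "p \<ominus> r" "-1" c] by (simp add: smult_minus1)
  qed (use pos in simp_all)
  moreover have "1 \<le> cmod (1 - c) + cmod c" using norm_triangle_ineq[of "1 - c" c] by simp
  ultimately show False by simp
qed

lemma projection_nrm_le:
  assumes "p \<in> carrier \<AA>" "star \<AA> p = p" "p \<otimes> p = p" shows "nrm \<AA> p \<le> 1"
proof -
  have "nrm \<AA> p * nrm \<AA> p = nrm \<AA> p" using cstar_identity[OF assms(1)] assms by (simp add: power2_eq_square)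
  then show ?thesis by auto
qed

end

lemma cylinder_mono: "n \<le> m \<Longrightarrow> cylinder A x m \<subseteq> cylinder A x n"
  by (auto simp: cylinder_def)

lemma finite_cylinders: "finite ((\<lambda>x. cylinder A x n) ` (S :: (nat \<Rightarrow> 'n::finite) set))"
proof -
  let ?f = "\<lambda>l. {z \<in> shift_space A. \<forall>i<n. z i = l ! i}"
  have "cylinder A x n \<in> ?f ` {l. set l \<subseteq> UNIV \<and> length l = n}" for x
    by (rule image_eqI[of _ _ "map x [0..<n]"]) (auto simp: cylinder_def)
  then have "(\<lambda>x. cylinder A x n) ` S \<subseteq> ?f ` {l. set l \<subseteq> UNIV \<and> length l = n}" by blast
  moreover have "finite {l. set l \<subseteq> (UNIV :: 'n set) \<and> length l = n}" by (rule finite_lists_length_eq) simp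
  ultimately show ?thesis by (rule finite_subset[OF _ finite_imageI])
qed

context ck_rep
begin

definition diagonal where
  "diagonal = cstar_generated \<AA> {word_elem \<alpha> \<otimes> star \<AA> (word_elem \<alpha>) | \<alpha>. admissible_word A \<alpha>}"

lemma diagonal_subalgebra: "cstar_subalgebra \<AA> diagonal"
  unfolding diagonal_def by (rule subalgebra_generated) auto

lemma diagonal_least:
  assumes "cstar_subalgebra \<AA> S" "\<And>U. clopen A U \<Longrightarrow> proj U \<in> S" shows "diagonal \<subseteq> S"
  unfolding diagonal_def
  by (rule cstar_generated_minimal[OF assms(1)]) (auto simp: proj_word clopen_word assms(2))

lemma proj_in_diagonal: "proj U \<in> diagonal"
proof (rule proj_in_generated)
  show "word_elem \<alpha> \<otimes> star \<AA> (word_elem \<alpha>) \<in> diagonal" if "admissible_word A \<alpha>" for \<alpha>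
  proof -
    let ?G = "{word_elem \<alpha> \<otimes> star \<AA> (word_elem \<alpha>) | \<alpha>. admissible_word A \<alpha>}"
    have "?G \<subseteq> carrier \<AA>" by auto
    from subalgebra_generated(2)[OF this] show ?thesis using that unfolding diagonal_def by blast
  qed
qed (use cstar_subalgebraD[OF diagonal_subalgebra] in simp_all)

text \<open>The elements of \<open>steps\<close> act as scalars on all cylinders of some length, like step functions on the shift
  space. They form a *-algebra that contains every \<open>proj U\<close>, so each element of the diagonal is a limit of them.\<close>

definition scalar_on :: "'a \<Rightarrow> nat \<Rightarrow> (nat \<Rightarrow> 'n) \<Rightarrow> complex \<Rightarrow> bool" where
  "scalar_on d n x c \<longleftrightarrow> d \<otimes> proj (cylinder A x n) = c \<odot> proj (cylinder A x n) \<and>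
     proj (cylinder A x n) \<otimes> d = c \<odot> proj (cylinder A x n)"

definition steps :: "'a set" where
  "steps = {d \<in> carrier \<AA>. \<exists>n. \<forall>x\<in>X. \<exists>c. scalar_on d n x c}"

lemma scalar_on_refine:
  assumes "scalar_on d n x c" "n \<le> m" and [simp]: "d \<in> carrier \<AA>" shows "scalar_on d m x c"
proof -
  let ?p = "proj (cylinder A x n)" and ?q = "proj (cylinder A x m)"
  have pq: "?p \<otimes> ?q = ?q" "?q \<otimes> ?p = ?q"
    using cylinder_mono[OF assms(2), of A x] by (simp_all add: proj_mult clopen_cylinder Int_absorb1 Int_absorb2)
  have "d \<otimes> ?q = (d \<otimes> ?p) \<otimes> ?q" using pq by (simp add: m_assoc)
  moreover have "?q \<otimes> d = ?q \<otimes> (?p \<otimes> d)" using pq by (simp flip: m_assoc)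
  ultimately show ?thesis
    using assms(1) pq by (simp add: scalar_on_def smult_mult_left smult_mult_right)
qed

lemma steps_common:
  assumes "d \<in> steps" "e \<in> steps"
  obtains n where "\<forall>x\<in>X. \<exists>c. scalar_on d n x c" "\<forall>x\<in>X. \<exists>c. scalar_on e n x c"
proof -
  obtain k l where "\<forall>x\<in>X. \<exists>c. scalar_on d k x c" "\<forall>x\<in>X. \<exists>c. scalar_on e l x c" and "d \<in> carrier \<AA>" "e \<in> carrier \<AA>"
    using assms unfolding steps_def by blast
  then show thesis using that[of "k + l"] scalar_on_refine by (meson le_add1 le_add2)
qed

lemma scalar_on_ops:
  assumes [simp]: "d \<in> carrier \<AA>" "e \<in> carrier \<AA>" and s: "scalar_on d n x c" "scalar_on e n x k"
  shows "scalar_on (d \<oplus> e) n x (c + k)" "scalar_on (d \<otimes> e) n x (c * k)" "scalar_on (l \<odot> d) n x (l * c)"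
    "scalar_on (star \<AA> d) n x (cnj c)"
proof -
  let ?p = "proj (cylinder A x n)"
  have d: "d \<otimes> ?p = c \<odot> ?p" "?p \<otimes> d = c \<odot> ?p" and e: "e \<otimes> ?p = k \<odot> ?p" "?p \<otimes> e = k \<odot> ?p"
    using s by (auto simp: scalar_on_def)
  show "scalar_on (d \<oplus> e) n x (c + k)" by (simp add: scalar_on_def l_distr r_distr d e smult_add_left)
  show "scalar_on (l \<odot> d) n x (l * c)" by (simp add: scalar_on_def smult_mult_left smult_mult_right d smult_smult)
  have "d \<otimes> e \<otimes> ?p = (c * k) \<odot> ?p" by (simp add: m_assoc e d smult_mult_right smult_smult mult.commute)
  moreover have "?p \<otimes> (d \<otimes> e) = (c * k) \<odot> ?p"
    by (simp add: d e smult_mult_left smult_smult flip: m_assoc)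
  ultimately show "scalar_on (d \<otimes> e) n x (c * k)" by (simp add: scalar_on_def)
  have "star \<AA> (d \<otimes> ?p) = cnj c \<odot> ?p" "star \<AA> (?p \<otimes> d) = cnj c \<odot> ?p" unfolding d by (simp_all add: star_smult proj_star)
  then show "scalar_on (star \<AA> d) n x (cnj c)" by (simp add: scalar_on_def star_mult proj_star)
qed

lemma proj_in_steps: assumes "clopen A U" shows "proj U \<in> steps"
proof -
  obtain n where n: "determined A n U" using assms by (auto simp: clopen_def)
  have "\<exists>c. scalar_on (proj U) n x c" if "x \<in> X" for x
  proof (cases "x \<in> U")
    case True
    then have "cylinder A x n \<subseteq> U" using n by (auto simp: determined_def cylinder_def)
    then have "scalar_on (proj U) n x 1"
      by (simp add: scalar_on_def proj_mult assms clopen_cylinder smult_1 Int_absorb1 Int_absorb2)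
    then show ?thesis by blast
  next
    case False
    have "U \<inter> cylinder A x n = {}"
      using False that determinedD[OF n, of _ x] by (auto simp: cylinder_def)
    then have "scalar_on (proj U) n x 0"
      by (simp add: scalar_on_def proj_mult assms clopen_cylinder smult_0 proj_empty Int_commute)
    then show ?thesis by blast
  qed
  then show ?thesis by (auto simp: steps_def)
qed

lemma diagonal_approx: assumes "d \<in> diagonal" obtains u where "\<forall>n. u n \<in> steps" "tends u d"
proof -
  have "cstar_subalgebra \<AA> {x. \<exists>u. (\<forall>n. u n \<in> steps) \<and> tends u x}"
  proof (rule subalgebra_closure)
    show c: "steps \<subseteq> carrier \<AA>" by (auto simp: steps_def)
    show "\<zero> \<in> steps" using proj_in_steps[of "{}"] by (simp add: proj_empty clopen_intros)
    fix d e l assume d: "d \<in> steps"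
    then have dc: "d \<in> carrier \<AA>" using c by blast
    obtain n where n: "\<And>x. x \<in> X \<Longrightarrow> \<exists>c. scalar_on d n x c" using d by (auto simp: steps_def)
    have "\<exists>c. scalar_on (l \<odot> d) n x c" "\<exists>c. scalar_on (star \<AA> d) n x c" if "x \<in> X" for x
      using n[OF that] scalar_on_ops(3,4)[OF dc dc] by blast+
    then show "l \<odot> d \<in> steps" "star \<AA> d \<in> steps" using dc by (auto simp: steps_def)
    assume e: "e \<in> steps"
    then have ec: "e \<in> carrier \<AA>" using c by blast
    obtain m where m: "\<forall>x\<in>X. \<exists>c. scalar_on d m x c" "\<forall>x\<in>X. \<exists>c. scalar_on e m x c"
      using steps_common[OF d e] .
    have "\<exists>c. scalar_on (d \<oplus> e) m x c" "\<exists>c. scalar_on (d \<otimes> e) m x c" if "x \<in> X" for x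
      using m(1)[rule_format, OF that] m(2)[rule_format, OF that] scalar_on_ops(1,2)[OF dc ec] by blast+
    then show "d \<oplus> e \<in> steps" "d \<otimes> e \<in> steps" using dc ec by (auto simp: steps_def)
  qed
  then have "diagonal \<subseteq> {x. \<exists>u. (\<forall>n. u n \<in> steps) \<and> tends u x}"
  proof (rule diagonal_least)
    fix U assume "clopen A U"
    then show "proj U \<in> {x. \<exists>u. (\<forall>n. u n \<in> steps) \<and> tends u x}"
      using proj_in_steps tends_const[of "proj U"] by (intro CollectI exI[of _ "\<lambda>_. proj U"]) simp
  qed
  then show thesis using assms that by blast
qed

lemma diagonal_commutes: "d \<in> diagonal \<Longrightarrow> clopen A U \<Longrightarrow> d \<otimes> proj U = proj U \<otimes> d"
proof -
  let ?C = "{d \<in> carrier \<AA>. \<forall>U. clopen A U \<longrightarrow> d \<otimes> proj U = proj U \<otimes> d}"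
  have "cstar_subalgebra \<AA> ?C"
  proof (rule cstar_subalgebraI)
    fix d e c assume d: "d \<in> ?C"
    show "c \<odot> d \<in> ?C" using d by (simp add: smult_mult_left smult_mult_right)
    have "star \<AA> d \<otimes> proj U = proj U \<otimes> star \<AA> d" if U: "clopen A U" for U
    proof -
      have "star \<AA> (proj U \<otimes> d) = star \<AA> (d \<otimes> proj U)" using d U by simp
      then show ?thesis using d by (simp add: star_mult proj_star)
    qed
    then show "star \<AA> d \<in> ?C" using d by simp
    assume e: "e \<in> ?C"
    show "d \<oplus> e \<in> ?C" using d e by (simp add: l_distr r_distr)
    have "d \<otimes> e \<otimes> proj U = proj U \<otimes> (d \<otimes> e)" if U: "clopen A U" for U
    proof -
      have dc: "d \<in> carrier \<AA>" "e \<in> carrier \<AA>" "d \<otimes> proj U = proj U \<otimes> d" "e \<otimes> proj U = proj U \<otimes> e" using d e U by auto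
      have "d \<otimes> e \<otimes> proj U = d \<otimes> (e \<otimes> proj U)" using dc(1,2) by (simp add: m_assoc)
      also have "\<dots> = (d \<otimes> proj U) \<otimes> e" using dc(1,2,4) by (simp add: m_assoc)
      also have "\<dots> = proj U \<otimes> (d \<otimes> e)" using dc(1-3) by (simp add: m_assoc)
      finally show ?thesis .
    qed
    then show "d \<otimes> e \<in> ?C" using d e by simp
  next
    fix u :: "nat \<Rightarrow> 'a" and d assume d: "d \<in> carrier \<AA>" and u: "\<And>n. u n \<in> ?C" and lim: "(\<lambda>n. nrm \<AA> (u n \<ominus> d)) \<longlonglongrightarrow> 0"
    have t: "tends u d" using d u lim by (simp add: tends_def)
    have "d \<otimes> proj U = proj U \<otimes> d" if U: "clopen A U" for U
    proof (rule tends_unique)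
      show "tends (\<lambda>n. u n \<otimes> proj U) (d \<otimes> proj U)" by (rule tends_mult[OF t tends_const]) simp
      have "(\<lambda>n. u n \<otimes> proj U) = (\<lambda>n. proj U \<otimes> u n)" using u U by simp
      then show "tends (\<lambda>n. u n \<otimes> proj U) (proj U \<otimes> d)" using tends_mult[OF tends_const[of "proj U"] t] by simp
    qed
    with d show "d \<in> ?C" by simp
  qed auto
  then have "diagonal \<subseteq> ?C" by (rule diagonal_least) (simp add: proj_comm)
  then show "d \<in> diagonal \<Longrightarrow> clopen A U \<Longrightarrow> d \<otimes> proj U = proj U \<otimes> d" by blast
qed

text \<open>The finitely many cylinders of length \<open>n\<close> cover the space, whose projection is \<open>1\<close>.\<close>

lemma zero_if_zero_on_cylinders:
  assumes a [simp]: "a \<in> carrier \<AA>" and z: "\<And>x. x \<in> X \<Longrightarrow> a \<otimes> proj (cylinder A x n) = \<zero>"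
  shows "a = \<zero>"
proof -
  have un: "clopen A (V \<union> W) \<and> a \<otimes> proj (V \<union> W) = \<zero>"
    if "clopen A V" "clopen A W" "a \<otimes> proj V = \<zero>" "a \<otimes> proj W = \<zero>" for V W
  proof -
    let ?W = "W \<inter> (X - V)"
    have cl: "clopen A ?W" using that by (intro clopen_intros)
    have "a \<otimes> proj ?W = (a \<otimes> proj W) \<otimes> proj (X - V)"
      using that(1,2) by (simp add: m_assoc proj_mult clopen_intros)
    also have "\<dots> = \<zero>" unfolding that(4) by simp
    finally have "a \<otimes> proj ?W = \<zero>" .
    moreover have "V \<union> W = V \<union> ?W" using clopen_subset[OF that(2)] by blast
    moreover have "proj (V \<union> ?W) = proj V \<oplus> proj ?W" by (rule proj_add[OF that(1) cl]) blast
    ultimately show ?thesis using that by (simp add: r_distr clopen_intros)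
  qed
  have "clopen A (\<Union>F) \<and> a \<otimes> proj (\<Union>F) = \<zero>"
    if "finite F" "F \<subseteq> (\<lambda>x. cylinder A x n) ` X" for F
    using that
  proof (induction F rule: finite_induct)
    case empty show ?case by (simp add: proj_empty clopen_intros)
  next
    case (insert V F)
    then obtain x where "x \<in> X" "V = cylinder A x n" by auto
    with insert show ?case using un[of V "\<Union>F"] z by (simp add: clopen_cylinder)
  qed
  from this[OF finite_cylinders subset_refl]
  have "a \<otimes> proj (\<Union>x\<in>X. cylinder A x n) = \<zero>" by blast
  moreover have "(\<Union>x\<in>X. cylinder A x n) = X" by (auto simp: cylinder_def)
  ultimately show ?thesis by (simp add: proj_space)
qed

text \<open>A projection \<open>e\<close> of the diagonal is within \<open>1 / 2\<close> of an element that is scalar on the cylinders of some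
  length, so on each of them \<open>e\<close> is \<open>0\<close> or the projection of that cylinder; \<open>U\<close> is the union of the cylinders of the second kind.\<close>

theorem diagonal_projection:
  assumes e: "e \<in> diagonal" "star \<AA> e = e" "e \<otimes> e = e"
  obtains U where "clopen A U" "e = proj U"
proof -
  have ec [simp]: "e \<in> carrier \<AA>" using cstar_subalgebraD(1)[OF diagonal_subalgebra] e by blast
  obtain u where u: "\<forall>n. u n \<in> steps" "tends u e" using diagonal_approx[OF e(1)] .
  then have "(\<lambda>k. nrm \<AA> (u k \<ominus> e)) \<longlonglongrightarrow> 0" by (simp add: tends_def)
  then have "\<forall>\<^sub>F k in sequentially. nrm \<AA> (u k \<ominus> e) < 1 / 2" by (rule order_tendstoD) simp
  then obtain k where "nrm \<AA> (u k \<ominus> e) < 1 / 2" using eventually_sequentially by auto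
  then obtain d where d: "d \<in> steps" "nrm \<AA> (d \<ominus> e) < 1 / 2" using u(1) by blast
  then have dc [simp]: "d \<in> carrier \<AA>" by (simp add: steps_def)
  obtain n where n: "\<And>x. x \<in> X \<Longrightarrow> \<exists>c. scalar_on d n x c" using d(1) by (auto simp: steps_def)
  let ?p = "\<lambda>x. proj (cylinder A x n)"
  have dich: "e \<otimes> ?p x = \<zero> \<or> e \<otimes> ?p x = ?p x" if x: "x \<in> X" for x
  proof -
    obtain c where c: "d \<otimes> ?p x = c \<odot> ?p x" using n[OF x] by (auto simp: scalar_on_def)
    have pp: "?p x \<otimes> ?p x = ?p x" by (rule proj_mult_self[OF clopen_cylinder])
    have com: "?p x \<otimes> e = e \<otimes> ?p x" by (rule diagonal_commutes[OF e(1) clopen_cylinder, symmetric])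
    show ?thesis
    proof (rule subprojection_near_scalar)
      show "(e \<otimes> ?p x) \<otimes> ?p x = e \<otimes> ?p x" by (simp add: m_assoc pp)
      show pe: "?p x \<otimes> (e \<otimes> ?p x) = e \<otimes> ?p x" by (simp add: com pp m_assoc flip: m_assoc[of "?p x" e])
      have "(e \<otimes> ?p x) \<otimes> (e \<otimes> ?p x) = e \<otimes> (?p x \<otimes> (e \<otimes> ?p x))" by (simp add: m_assoc)
      also have "\<dots> = (e \<otimes> e) \<otimes> ?p x" unfolding pe by (simp add: m_assoc)
      finally show "(e \<otimes> ?p x) \<otimes> (e \<otimes> ?p x) = e \<otimes> ?p x" by (simp add: e(3))
      have "e \<otimes> ?p x \<ominus> c \<odot> ?p x = (e \<ominus> d) \<otimes> ?p x"
        by (simp add: a_minus_def l_distr l_minus c)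
      also have "nrm \<AA> \<dots> \<le> nrm \<AA> (e \<ominus> d) * nrm \<AA> (?p x)" by (rule nrm_mult) simp_all
      also have "\<dots> \<le> nrm \<AA> (e \<ominus> d) * 1"
        by (intro mult_left_mono projection_nrm_le nrm_nonneg) (simp_all add: proj_star pp)
      also have "\<dots> < 1 / 2" using d(2) nrm_minus_commute[of e d] by simp
      finally show "nrm \<AA> (e \<otimes> ?p x \<ominus> c \<odot> ?p x) < 1 / 2" .
    qed (simp_all add: pp)
  qed
  define U where "U = {x \<in> X. e \<otimes> ?p x = ?p x}"
  have det: "determined A n U"
    unfolding determined_def
  proof (intro conjI ballI impI)
    fix x y assume "x \<in> U" "y \<in> X" "\<forall>i<n. x i = y i"
    moreover from this have "cylinder A y n = cylinder A x n" by (auto simp: cylinder_def)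
    ultimately show "y \<in> U" by (simp add: U_def)
  qed (auto simp: U_def)
  then have cl: "clopen A U" by (auto simp: clopen_def)
  have "e \<ominus> proj U = \<zero>"
  proof (rule zero_if_zero_on_cylinders)
    fix x assume x: "x \<in> X"
    have "e \<otimes> ?p x = proj U \<otimes> ?p x"
    proof (cases "x \<in> U")
      case True
      then have "cylinder A x n \<subseteq> U" using det by (auto simp: determined_def cylinder_def)
      then show ?thesis using True by (simp add: U_def[symmetric] proj_mult cl clopen_cylinder Int_absorb1) (simp add: U_def)
    next
      case False
      have "U \<inter> cylinder A x n = {}" using False x determinedD[OF det, of _ x] by (auto simp: cylinder_def)
      then show ?thesis using False dich[OF x] x by (simp add: proj_mult cl clopen_cylinder proj_empty) (simp add: U_def)
    qed
    then show "(e \<ominus> proj U) \<otimes> ?p x = \<zero>" by (simp add: a_minus_def l_distr l_minus r_neg)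
  qed simp
  then have "e = proj U" by (simp add: minus_eq_zero_iff)
  with cl show thesis by (rule that)
qed

end


section \<open>Conjugacies induce isomorphisms of Cuntz--Krieger algebras\<close>

lemma closedin_shift_space: "closedin (product_topology (\<lambda>_. discrete_topology UNIV) UNIV) (shift_space A)"
proof -
  let ?T = "product_topology (\<lambda>_::nat. discrete_topology (UNIV :: 'a set)) UNIV"
  have "openin ?T (- shift_space A)"
    unfolding openin_subopen[of _ "- shift_space A"]
  proof
    fix x assume "x \<in> - shift_space A"
    then obtain n where n: "A $ x n $ x (Suc n) \<noteq> 1" by (auto simp: shift_space_def)
    let ?P = "PiE UNIV (\<lambda>i. if i < n + 2 then {x i} else UNIV)"
    have "openin ?T ?P"
      by (rule product_topology_basis) (auto intro: finite_subset[of _ "{..<n + 2}"])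
    moreover have "x \<in> ?P" by auto
    moreover have "?P \<subseteq> - shift_space A"
    proof
      fix y assume y: "y \<in> ?P"
      have "y i = x i" if "i < n + 2" for i using PiE_mem[OF y, of i] that by simp
      then have "A $ y n $ y (Suc n) \<noteq> 1" using n by simp
      then show "y \<in> - shift_space A" by (auto simp: shift_space_def)
    qed
    ultimately show "\<exists>P. openin ?T P \<and> x \<in> P \<and> P \<subseteq> - shift_space A" by blast
  qed
  then show ?thesis by (simp add: closedin_def Compl_eq_Diff_UNIV)
qed

lemma compact_shift_space: fixes A :: "int ^ 'n ^ 'n" shows "compact_space (shift_topology A)"
proof -
  have "compact_space (product_topology (\<lambda>_::nat. discrete_topology (UNIV :: 'n set)) UNIV)"
    by (simp add: compact_space_product_topology compact_space_discrete_topology)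
  then show ?thesis
    unfolding shift_topology_def
    by (intro compact_space_subtopology closedin_compact_space closedin_shift_space)
qed

lemma openin_clopen: assumes "clopen A U" shows "openin (shift_topology A) U"
  unfolding openin_subopen[of _ U]
proof
  fix x assume x: "x \<in> U"
  obtain n where n: "determined A n U" using assms by (auto simp: clopen_def)
  have "x \<in> cylinder A x n" using x clopen_subset[OF assms] by (auto simp: cylinder_def)
  moreover have "cylinder A x n \<subseteq> U" using x n by (auto simp: determined_def cylinder_def)
  ultimately show "\<exists>T. openin (shift_topology A) T \<and> x \<in> T \<and> T \<subseteq> U" using openin_cylinder by blast
qed

text \<open>Each point has a cylinder inside \<open>V\<close> or inside the complement. Finitely many of these cylinders cover
  the space, and the coordinates that they fix decide membership in \<open>V\<close>.\<close>

lemma clopen_if_openin: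
  assumes V: "openin (shift_topology A) V" and V': "openin (shift_topology A) (shift_space A - V)"
  shows "clopen A V"
proof -
  have "\<exists>m. cylinder A x m \<subseteq> V \<or> cylinder A x m \<subseteq> shift_space A - V" if "x \<in> shift_space A" for x
    using open_contains_cylinder[OF V, of x] open_contains_cylinder[OF V', of x] that by blast
  then obtain m where m: "\<And>x. x \<in> shift_space A \<Longrightarrow> cylinder A x (m x) \<subseteq> V \<or> cylinder A x (m x) \<subseteq> shift_space A - V"
    by metis
  let ?C = "(\<lambda>x. cylinder A x (m x)) ` shift_space A"
  have "shift_space A \<subseteq> \<Union>?C" by (auto simp: cylinder_def)
  moreover have "\<forall>C\<in>?C. openin (shift_topology A) C" by (auto simp: openin_cylinder)
  ultimately obtain \<F> where \<F>: "finite \<F>" "\<F> \<subseteq> ?C" "shift_space A \<subseteq> \<Union>\<F>"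
    using compact_shift_space[of A] unfolding compact_space_alt topspace_shift_topology by meson
  obtain F where F: "finite F" "F \<subseteq> shift_space A" "\<F> = (\<lambda>x. cylinder A x (m x)) ` F"
    using finite_subset_image[OF \<F>(1,2)] by blast
  have "determined A (sum m F) V"
    unfolding determined_def
  proof (intro conjI ballI impI)
    show "V \<subseteq> shift_space A" using openin_subset[OF V] by simp
    fix x y assume x: "x \<in> V" and y: "y \<in> shift_space A" and eq: "\<forall>i<sum m F. x i = y i"
    have xA: "x \<in> shift_space A" using x openin_subset[OF V] by auto
    then obtain z where z: "z \<in> F" "x \<in> cylinder A z (m z)" using \<F>(3) F(3) by auto
    have "m z \<le> sum m F" using member_le_sum[OF z(1), of m] F(1) by simp
    then have "y \<in> cylinder A z (m z)" using z(2) y eq by (auto simp: cylinder_def)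
    moreover have "cylinder A z (m z) \<subseteq> V" using m[of z] z F(2) x by blast
    ultimately show "y \<in> V" by blast
  qed
  then show ?thesis by (auto simp: clopen_def)
qed

lemma clopen_conjugate_image:
  assumes h: "one_sided_conjugacy A B h" and U: "clopen A U"
  shows "clopen B (h ` U)"
proof (rule clopen_if_openin)
  have open_h: "openin (shift_topology B) (h ` W)" if "openin (shift_topology A) W" for W
    using h that by (simp add: one_sided_conjugacy_def homeomorphic_eq_everything_map open_map_def)
  show "openin (shift_topology B) (h ` U)" by (rule open_h[OF openin_clopen[OF U]])
  have "shift_space B - h ` U = h ` (shift_space A - U)"
    using one_sided_conjugacy_bij[OF h] clopen_subset[OF U]
      inj_on_image_set_diff[of h "shift_space A" "shift_space A" U]
    by (simp add: bij_betw_def)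
  then show "openin (shift_topology B) (shift_space B - h ` U)"
    using open_h[OF openin_clopen[OF clopen_intros(5)[OF U]]] by simp
qed

locale conjugacy_pair = A: ck_rep \<AA> A t + B: ck_rep \<BB> B u
  for \<AA> :: "('a, 'x) cstar_scheme" and A :: "int ^ 'm ^ 'm" and t
    and \<BB> :: "('b, 'y) cstar_scheme" and B :: "int ^ 'n ^ 'n" and u +
  fixes h
  assumes h: "one_sided_conjugacy A B h"
begin

lemma h_inj: "inj_on h (shift_space A)"
  using one_sided_conjugacy_bij[OF h] by (simp add: bij_betw_def)

lemma h_space: "h ` shift_space A = shift_space B"
  using one_sided_conjugacy_bij[OF h] by (simp add: bij_betw_def)

lemma h_shift: "x \<in> shift_space A \<Longrightarrow> h (shift x) = shift (h x)"
  using h by (simp add: one_sided_conjugacy_def)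

abbreviation Z where "Z j \<equiv> h ` coord A 0 j"

lemma clopen_Z: "clopen B (Z j)"
  by (rule clopen_conjugate_image[OF h clopen_coord])

lemma inj_shift_Z: "inj_on shift (Z j)"
proof (rule inj_onI)
  fix y z assume "y \<in> Z j" "z \<in> Z j" and eq: "shift y = shift z"
  then obtain u v where uv: "u \<in> coord A 0 j" "v \<in> coord A 0 j" "y = h u" "z = h v" by blast
  then have X: "u \<in> shift_space A" "v \<in> shift_space A" by (auto simp: coord_def)
  then have "h (shift u) = h (shift v)" using eq uv by (simp add: h_shift)
  then have "shift u = shift v" using h_inj X by (simp add: inj_on_def shift_in_shift_space)
  then have "u = v" using uv prepend_shift[of u] prepend_shift[of v] by (simp add: coord_def)
  then show "y = z" using uv by simp
qed

lemma Z_disjoint: "i \<noteq> j \<Longrightarrow> Z i \<inter> Z j = {}"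
  using h_inj by (auto simp: coord_def inj_on_def)

lemma Z_UN: "(\<Union>j. Z j) = shift_space B"
proof -
  have "(\<Union>j. coord A 0 j) = shift_space A" by (auto simp: coord_def)
  then show ?thesis using h_space by (metis image_UN)
qed

lemma sum_proj_Z: "(\<Oplus>\<^bsub>\<BB>\<^esub>j\<in>S. B.proj (Z j)) = B.proj (\<Union>j\<in>S. Z j)"
  by (rule B.proj_UN[symmetric]) (simp_all add: clopen_Z Z_disjoint)

text \<open>This is where the generator \<open>j\<close> has to go: it equals \<open>proj (coord A 0 j) \<otimes> s\<close> (see \<open>proj_coord_s\<close>), and the
  homomorphism should send \<open>proj U\<close> to \<open>proj (h ` U)\<close> and \<open>s\<close> to \<open>s\<close>.\<close>

definition gen_image :: "'m \<Rightarrow> 'b" where "gen_image j = B.proj (Z j) \<otimes>\<^bsub>\<BB>\<^esub> B.s"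

lemma gen_image_in [simp]: "gen_image j \<in> carrier \<BB>"
  by (simp add: gen_image_def)

lemma gen_image_star: "star \<BB> (gen_image j) = star \<BB> B.s \<otimes>\<^bsub>\<BB>\<^esub> B.proj (Z j)"
  by (simp add: gen_image_def B.star_mult B.proj_star)

lemma gen_image_range: "gen_image j \<otimes>\<^bsub>\<BB>\<^esub> star \<BB> (gen_image j) = B.proj (Z j)"
  unfolding gen_image_star unfolding gen_image_def by (rule B.corner[OF clopen_Z inj_shift_Z])

lemma gen_image_source: "star \<BB> (gen_image i) \<otimes>\<^bsub>\<BB>\<^esub> gen_image i = B.proj (\<Union>j\<in>{j. A $ i $ j = 1}. Z j)"
proof -
  let ?p = "B.proj (Z i)"
  have "star \<BB> (gen_image i) \<otimes>\<^bsub>\<BB>\<^esub> gen_image i = star \<BB> B.s \<otimes>\<^bsub>\<BB>\<^esub> (?p \<otimes>\<^bsub>\<BB>\<^esub> ?p \<otimes>\<^bsub>\<BB>\<^esub> B.s)"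
    unfolding gen_image_star unfolding gen_image_def by (simp add: B.m_assoc)
  also have "\<dots> = B.proj (shift ` Z i)"
    by (simp add: B.proj_mult_self clopen_Z B.star_s_proj_s inj_shift_Z)
  also have "shift ` Z i = h ` shift ` coord A 0 i"
    unfolding image_image by (rule image_cong) (simp_all add: h_shift coord_def)
  also have "shift ` coord A 0 i = follow A i"
    by (force simp: shift_image_pull[of _ A] coord_def pull_def follow_def prepend_in_shift_space)
  also have "follow A i = (\<Union>j\<in>{j. A $ i $ j = 1}. coord A 0 j)" by (auto simp: follow_def coord_def)
  finally show ?thesis by (simp add: image_UN)
qed

text \<open>The range projection of \<open>gen_image j\<close> is \<open>proj (Z j)\<close>, because the shift is injective on \<open>Z j\<close>; the source projection
  is that of \<open>\<sigma> (Z i) = h (\<sigma> Z\<^sub>i)\<close>, where \<open>\<sigma> Z\<^sub>i\<close> consists of the points that may follow \<open>i\<close>.\<close>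

lemma ck_family_gen_image: "ck_family A \<BB> gen_image"
  unfolding ck_family_def partial_isometry_def
proof (intro conjI allI impI)
  fix i j
  show "gen_image i \<in> carrier \<BB>" by simp
  show "gen_image i \<otimes>\<^bsub>\<BB>\<^esub> star \<BB> (gen_image i) \<otimes>\<^bsub>\<BB>\<^esub> gen_image i = gen_image i"
    unfolding gen_image_range unfolding gen_image_def
    by (simp add: B.proj_mult_self clopen_Z flip: B.m_assoc)
  show "star \<BB> (gen_image i) \<otimes>\<^bsub>\<BB>\<^esub> gen_image j = \<zero>\<^bsub>\<BB>\<^esub>" if "i \<noteq> j"
  proof -
    have "star \<BB> (gen_image i) \<otimes>\<^bsub>\<BB>\<^esub> gen_image j =
        star \<BB> B.s \<otimes>\<^bsub>\<BB>\<^esub> (B.proj (Z i) \<otimes>\<^bsub>\<BB>\<^esub> B.proj (Z j)) \<otimes>\<^bsub>\<BB>\<^esub> B.s"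
      unfolding gen_image_star unfolding gen_image_def by (simp add: B.m_assoc)
    then show ?thesis using that by (simp add: B.proj_mult clopen_Z Z_disjoint B.proj_empty)
  qed
  have "(\<Oplus>\<^bsub>\<BB>\<^esub>j\<in>UNIV. of_int (A $ i $ j) \<odot>\<^bsub>\<BB>\<^esub> B.proj (Z j)) = (\<Oplus>\<^bsub>\<BB>\<^esub>j\<in>{j. A $ i $ j = 1}. B.proj (Z j))"
  proof (rule B.add.finprod_mono_neutral_cong_right)
    show "of_int (A $ i $ j) \<odot>\<^bsub>\<BB>\<^esub> B.proj (Z j) = \<zero>\<^bsub>\<BB>\<^esub>" if "j \<in> UNIV - {j. A $ i $ j = 1}" for j
    proof -
      have "A $ i $ j = 0" using A.matrix that unfolding ck_matrix_def by fastforce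
      then show ?thesis by (simp add: B.smult_0)
    qed
  qed (auto simp: B.smult_1)
  then show "star \<BB> (gen_image i) \<otimes>\<^bsub>\<BB>\<^esub> gen_image i =
      (\<Oplus>\<^bsub>\<BB>\<^esub>j\<in>UNIV. of_int (A $ i $ j) \<odot>\<^bsub>\<BB>\<^esub> (gen_image j \<otimes>\<^bsub>\<BB>\<^esub> star \<BB> (gen_image j)))"
    unfolding gen_image_source gen_image_range by (simp add: sum_proj_Z)
  show "(\<Oplus>\<^bsub>\<BB>\<^esub>j\<in>UNIV. gen_image j \<otimes>\<^bsub>\<BB>\<^esub> star \<BB> (gen_image j)) = \<one>\<^bsub>\<BB>\<^esub>"
    unfolding gen_image_range using sum_proj_Z[of UNIV] by (simp add: Z_UN B.proj_space)
qed

text \<open>Since \<open>h\<close> commutes with the shift, a point of \<open>Z j\<close> lies in \<open>h ` U\<close> exactly if its shift lies in \<open>h ` pull A j U\<close>.\<close>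

lemma image_decomposition:
  assumes "U \<subseteq> shift_space A"
  shows "h ` U = (\<Union>j. Z j \<inter> shift_vimage B (h ` pull A j U))"
proof (intro equalityI subsetI)
  fix y assume "y \<in> h ` U"
  then obtain x where x: "x \<in> U" "y = h x" "x \<in> shift_space A" using assms by blast
  have "shift x \<in> pull A (x 0) U" using x by (simp add: pull_def prepend_shift shift_in_shift_space)
  moreover have "h x \<in> shift_space B" using x(3) h_space by blast
  ultimately have "y \<in> shift_vimage B (h ` pull A (x 0) U)"
    using x h_shift[OF x(3)] imageI[of "shift x" "pull A (x 0) U" h] by (simp add: shift_vimage_def)
  moreover have "y \<in> Z (x 0)" using x by (auto simp: coord_def)
  ultimately show "y \<in> (\<Union>j. Z j \<inter> shift_vimage B (h ` pull A j U))" by blast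
next
  fix y assume "y \<in> (\<Union>j. Z j \<inter> shift_vimage B (h ` pull A j U))"
  then obtain j x z where x: "x \<in> shift_space A" "x 0 = j" "y = h x" and z: "z \<in> pull A j U" "shift y = h z"
    by (auto simp: coord_def shift_vimage_def)
  then have "h (shift x) = h z" using h_shift by simp
  then have "shift x = z" using h_inj x z by (auto simp: inj_on_def pull_def shift_in_shift_space)
  then have "x \<in> U" using z x prepend_shift[of x] by (auto simp: pull_def)
  then show "y \<in> h ` U" using x by blast
qed

end

locale conjugacy_hom = conjugacy_pair \<AA> A t \<BB> B u h + cstar_hom \<AA> \<BB> \<Psi>
  for \<AA> :: "('a, 'x) cstar_scheme" and A :: "int ^ 'm ^ 'm" and t
    and \<BB> :: "('b, 'y) cstar_scheme" and B :: "int ^ 'n ^ 'n" and u and h and \<Psi> +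
  assumes hom_gen: "\<Psi> (t j) = gen_image j"
begin

lemma hom_s: "\<Psi> A.s = B.s"
proof -
  have "\<Psi> A.s = (\<Oplus>\<^bsub>\<BB>\<^esub>j\<in>UNIV. B.proj (Z j) \<otimes>\<^bsub>\<BB>\<^esub> B.s)"
    unfolding A.s_def by (simp add: hom_sum hom_gen gen_image_def)
  also have "\<dots> = (\<Oplus>\<^bsub>\<BB>\<^esub>j\<in>UNIV. B.proj (Z j)) \<otimes>\<^bsub>\<BB>\<^esub> B.s"
    by (rule B.finsum_ldistr[symmetric]) auto
  also have "(\<Oplus>\<^bsub>\<BB>\<^esub>j\<in>UNIV. B.proj (Z j)) = \<one>\<^bsub>\<BB>\<^esub>"
    using sum_proj_Z[of UNIV] by (simp add: Z_UN B.proj_space)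
  finally show ?thesis by simp
qed

text \<open>Both sides obey the same recursion: with \<open>corner_tau\<close>, the image of \<open>t\<^sub>j (proj (pull A j U)) t\<^sub>j\<^sup>*\<close> is the projection of
  the piece of \<open>h ` U\<close> inside \<open>Z j\<close>.\<close>

lemma hom_coord_proj: "determined A (Suc n) U \<Longrightarrow> \<Psi> (A.coord_proj n U) = B.proj (h ` U)"
proof (induction n arbitrary: U)
  case 0
  have "\<Psi> (A.coord_proj 0 U) = (\<Oplus>\<^bsub>\<BB>\<^esub>j\<in>(\<lambda>x. x 0) ` U. B.proj (Z j))"
    by (simp add: hom_sum hom_mult hom_star hom_gen gen_image_range)
  also have "\<dots> = B.proj (\<Union>j\<in>(\<lambda>x. x 0) ` U. Z j)" by (rule sum_proj_Z)
  also have "(\<Union>j\<in>(\<lambda>x. x 0) ` U. Z j) = h ` U"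
  proof -
    have "(\<Union>j\<in>(\<lambda>x. x 0) ` U. coord A 0 j) = U"
      using determined_subset[OF 0] determinedD[OF 0] by (auto simp: coord_def)
    then show ?thesis by (metis image_UN)
  qed
  finally show ?case .
next
  case (Suc n)
  have d: "determined A (Suc n) (pull A j U)" for j by (rule determined_pull[OF Suc.prems])
  have cl: "clopen B (h ` pull A j U)" for j
    by (rule clopen_conjugate_image[OF h]) (use d in \<open>auto simp: clopen_def\<close>)
  let ?V = "\<lambda>j. Z j \<inter> shift_vimage B (h ` pull A j U)"
  have "\<Psi> (A.coord_proj (Suc n) U) =
      (\<Oplus>\<^bsub>\<BB>\<^esub>j\<in>UNIV. gen_image j \<otimes>\<^bsub>\<BB>\<^esub> B.proj (h ` pull A j U) \<otimes>\<^bsub>\<BB>\<^esub> star \<BB> (gen_image j))"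
    by (simp add: hom_sum hom_mult hom_star hom_gen Suc.IH[OF d])
  also have "\<dots> = (\<Oplus>\<^bsub>\<BB>\<^esub>j\<in>UNIV. B.proj (?V j))"
  proof (rule B.finsum_cong')
    fix j
    have "gen_image j \<otimes>\<^bsub>\<BB>\<^esub> B.proj (h ` pull A j U) \<otimes>\<^bsub>\<BB>\<^esub> star \<BB> (gen_image j) =
        B.proj (Z j) \<otimes>\<^bsub>\<BB>\<^esub> (B.s \<otimes>\<^bsub>\<BB>\<^esub> B.proj (h ` pull A j U) \<otimes>\<^bsub>\<BB>\<^esub> star \<BB> B.s) \<otimes>\<^bsub>\<BB>\<^esub> B.proj (Z j)"
      unfolding gen_image_star unfolding gen_image_def by (simp add: B.m_assoc)
    then show "gen_image j \<otimes>\<^bsub>\<BB>\<^esub> B.proj (h ` pull A j U) \<otimes>\<^bsub>\<BB>\<^esub> star \<BB> (gen_image j) = B.proj (?V j)"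
      by (simp add: B.corner_tau clopen_Z cl inj_shift_Z)
  qed auto
  also have "\<dots> = B.proj (\<Union>j. ?V j)"
    by (rule B.proj_UN[symmetric])
      (use Z_disjoint in \<open>auto intro!: clopen_intros clopen_shift_vimage cl clopen_Z\<close>)
  finally show ?case using image_decomposition[OF determined_subset[OF Suc.prems]] by simp
qed

lemma hom_proj: assumes "clopen A U" shows "\<Psi> (A.proj U) = B.proj (h ` U)"
proof -
  obtain n where "determined A (Suc n) U" using clopenE[OF assms] .
  then show ?thesis using A.proj_eq hom_coord_proj by metis
qed

lemma hom_diagonal: "\<Psi> ` A.diagonal \<subseteq> B.diagonal"
proof -
  have "A.diagonal \<subseteq> {x \<in> carrier \<AA>. \<Psi> x \<in> B.diagonal}"
    by (rule A.diagonal_least[OF subalgebra_preimage[OF B.diagonal_subalgebra]])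
      (simp add: hom_proj B.proj_in_diagonal)
  then show ?thesis by blast
qed

end

lemma (in ck_rep) proj_coord_s: "proj (coord A 0 i) \<otimes> s = t i"
proof -
  have "proj (coord A 0 i) \<otimes> s = t i \<otimes> (star \<AA> (t i) \<otimes> s)"
    by (simp add: m_assoc flip: t_star_t_proj)
  also have "star \<AA> (t i) \<otimes> s = star \<AA> (t i) \<otimes> t i"
    using star_t_sum[of "\<lambda>_. \<one>" UNIV i] by (simp add: s_def)
  finally show ?thesis by (simp add: t_star_t)
qed

lemma ck_rep_CK: "ck_matrix A \<Longrightarrow> ck_rep (CK_algebra A) A (ck_gen A)"
  by (simp add: ck_rep_def ck_rep_axioms_def CK_cstar_algebra CK_gen_family)

lemma conjugacy_hom_exists:
  assumes "ck_matrix A" "ck_matrix B" "one_sided_conjugacy A B h"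
  shows "\<exists>\<Psi>. conjugacy_hom (CK_algebra A) A (ck_gen A) (CK_algebra B) B (ck_gen B) h \<Psi>"
proof -
  interpret conjugacy_pair "CK_algebra A" A "ck_gen A" "CK_algebra B" B "ck_gen B" h
    using assms by (simp add: conjugacy_pair_def conjugacy_pair_axioms_def ck_rep_CK)
  obtain \<Psi> where "star_hom (CK_algebra A) (CK_algebra B) \<Psi>" "\<And>i. \<Psi> (ck_gen A i) = gen_image i"
    using B.CK_universal[OF ck_family_gen_image] by blast
  then have "conjugacy_hom (CK_algebra A) A (ck_gen A) (CK_algebra B) B (ck_gen B) h \<Psi>"
    by unfold_locales
  then show ?thesis by blast
qed

lemma CK_diagonal_eq: "CK_diagonal A = ck_rep.diagonal (CK_algebra A) A (ck_gen A)" if "ck_matrix A"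
proof -
  interpret ck_rep "CK_algebra A" A "ck_gen A" by (rule ck_rep_CK[OF that])
  show ?thesis by (simp add: CK_diagonal_def diagonal_def word_elem_def ck_word_def)
qed

lemma ck_sum_eq: "ck_sum A = ck_rep.s (CK_algebra A) (ck_gen A)" if "ck_matrix A"
proof -
  interpret ck_rep "CK_algebra A" A "ck_gen A" by (rule ck_rep_CK[OF that])
  show ?thesis by (simp add: ck_sum_def s_def)
qed

lemma conjugacy_homs_inverse:
  assumes "conjugacy_hom (CK_algebra A) A (ck_gen A) (CK_algebra B) B (ck_gen B) h \<Psi>"
    and "conjugacy_hom (CK_algebra B) B (ck_gen B) (CK_algebra A) A (ck_gen A) h' \<Psi>'"
    and inv: "\<And>x. x \<in> shift_space A \<Longrightarrow> h' (h x) = x" and x: "x \<in> carrier (CK_algebra A)"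
  shows "\<Psi>' (\<Psi> x) = x"
proof -
  interpret F: conjugacy_hom "CK_algebra A" A "ck_gen A" "CK_algebra B" B "ck_gen B" h \<Psi> by fact
  interpret G: conjugacy_hom "CK_algebra B" B "ck_gen B" "CK_algebra A" A "ck_gen A" h' \<Psi>' by fact
  have gen: "\<Psi>' (\<Psi> (ck_gen A i)) = ck_gen A i" for i
  proof -
    have "h' ` h ` coord A 0 i = coord A 0 i" using inv by (force simp: coord_def image_iff)
    then show ?thesis
      by (simp add: F.hom_gen F.gen_image_def G.hom_mult G.hom_proj F.clopen_Z G.hom_s F.A.proj_coord_s)
  qed
  show ?thesis
  proof (rule star_homs_agree)
    show "star_hom (CK_algebra A) (CK_algebra A) (\<lambda>x. \<Psi>' (\<Psi> x))"
      by (rule star_hom_comp[OF F.star_hom G.star_hom])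
    show "star_hom (CK_algebra A) (CK_algebra A) (\<lambda>x. x)" by (rule F.A.star_hom_id)
    show "\<Psi>' (\<Psi> y) = y" if "y \<in> range (ck_gen A)" for y using that gen by auto
    show "x \<in> cstar_generated (CK_algebra A) (range (ck_gen A))" using x by (simp add: CK_generated)
  qed (auto simp: CK_cstar_algebra)
qed

theorem algebra_iso_if_conjugacy:
  assumes A: "ck_matrix A" and B: "ck_matrix B" and h: "one_sided_conjugacy A B h"
  shows "\<exists>\<Psi>. star_iso (CK_algebra A) (CK_algebra B) \<Psi> \<and> \<Psi> ` CK_diagonal A = CK_diagonal B \<and>
    (\<forall>y\<in>carrier (CK_algebra A). \<Psi> (CK_tau A y) = CK_tau B (\<Psi> y))"
proof -
  obtain h' where h': "one_sided_conjugacy B A h'"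
    and inv: "\<And>x. x \<in> shift_space A \<Longrightarrow> h' (h x) = x" "\<And>y. y \<in> shift_space B \<Longrightarrow> h (h' y) = y"
    using one_sided_conjugacy_inverse[OF h] by blast
  obtain \<Psi> where \<Psi>: "conjugacy_hom (CK_algebra A) A (ck_gen A) (CK_algebra B) B (ck_gen B) h \<Psi>"
    using conjugacy_hom_exists[OF A B h] by blast
  obtain \<Psi>' where \<Psi>': "conjugacy_hom (CK_algebra B) B (ck_gen B) (CK_algebra A) A (ck_gen A) h' \<Psi>'"
    using conjugacy_hom_exists[OF B A h'] by blast
  interpret F: conjugacy_hom "CK_algebra A" A "ck_gen A" "CK_algebra B" B "ck_gen B" h \<Psi> by (rule \<Psi>)
  interpret G: conjugacy_hom "CK_algebra B" B "ck_gen B" "CK_algebra A" A "ck_gen A" h' \<Psi>' by (rule \<Psi>')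
  note GF = conjugacy_homs_inverse[OF \<Psi> \<Psi>' inv(1)]
  note FG = conjugacy_homs_inverse[OF \<Psi>' \<Psi> inv(2)]
  have "bij_betw \<Psi> (carrier (CK_algebra A)) (carrier (CK_algebra B))"
    by (rule bij_betw_byWitness[where f' = \<Psi>']) (use GF FG in auto)
  then have "star_iso (CK_algebra A) (CK_algebra B) \<Psi>" by (simp add: star_iso_def F.star_hom)
  moreover have "\<Psi> ` CK_diagonal A = CK_diagonal B"
  proof
    show "\<Psi> ` CK_diagonal A \<subseteq> CK_diagonal B" using F.hom_diagonal by (simp add: CK_diagonal_eq A B)
    show "CK_diagonal B \<subseteq> \<Psi> ` CK_diagonal A"
    proof
      fix y assume y: "y \<in> CK_diagonal B"
      then have "\<Psi>' y \<in> CK_diagonal A" using G.hom_diagonal by (auto simp: CK_diagonal_eq A B)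
      moreover have "y \<in> carrier (CK_algebra B)"
        using y cstar_subalgebraD(1)[OF F.B.diagonal_subalgebra] by (auto simp: CK_diagonal_eq B)
      ultimately show "y \<in> \<Psi> ` CK_diagonal A" using FG by (metis image_eqI)
    qed
  qed
  moreover have "\<Psi> (CK_tau A y) = CK_tau B (\<Psi> y)" if "y \<in> carrier (CK_algebra A)" for y
    using that by (simp add: CK_tau_def ck_sum_eq A B F.hom_mult F.hom_star F.hom_s)
  ultimately show ?thesis by blast
qed


section \<open>A representation on finitely supported functions\<close>

text \<open>The norm of the Cuntz--Krieger algebra is the largest C*-seminorm that kills the relators, so one
  seminorm that does not kill a word shows that the word is not zero. It is the operator norm of the representation
  that sends the generator \<open>i\<close> to the operator \<open>\<delta>\<^sub>x \<mapsto> \<delta>\<^bsub>ix\<^esub>\<close> (or \<open>0\<close> if \<open>ix\<close> is not a point). These operators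
  act on the finitely supported functions, and their norms there are already a C*-seminorm.\<close>

fun letter_op :: "int ^ 'n ^ 'n \<Rightarrow> 'n letter \<Rightarrow> ((nat \<Rightarrow> 'n) \<Rightarrow> complex) \<Rightarrow> (nat \<Rightarrow> 'n) \<Rightarrow> complex" where
  "letter_op A (Gen i) v = (\<lambda>x. if x \<in> shift_space A \<and> x 0 = i then v (shift x) else 0)"
| "letter_op A (Adj i) v = (\<lambda>x. if x \<in> shift_space A \<and> A $ i $ x 0 = 1 then v (prepend i x) else 0)"

definition word_op :: "int ^ 'n ^ 'n \<Rightarrow> 'n letter list \<Rightarrow> ((nat \<Rightarrow> 'n) \<Rightarrow> complex) \<Rightarrow> (nat \<Rightarrow> 'n) \<Rightarrow> complex" where
  "word_op A ls v = foldr (letter_op A) ls v"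

definition free_op :: "int ^ 'n ^ 'n \<Rightarrow> 'n free_alg \<Rightarrow> ((nat \<Rightarrow> 'n) \<Rightarrow> complex) \<Rightarrow> (nat \<Rightarrow> 'n) \<Rightarrow> complex" where
  "free_op A a v = (\<lambda>x. \<Sum>w\<in>Poly_Mapping.keys a. Poly_Mapping.lookup a w * word_op A (letters w) v x)"

definition supp :: "('b \<Rightarrow> complex) \<Rightarrow> 'b set" where
  "supp v = {x. v x \<noteq> 0}"

definition vectors :: "int ^ 'n ^ 'n \<Rightarrow> ((nat \<Rightarrow> 'n) \<Rightarrow> complex) set" where
  "vectors A = {v. finite (supp v) \<and> supp v \<subseteq> shift_space A}"

definition ip :: "('b \<Rightarrow> complex) \<Rightarrow> ('b \<Rightarrow> complex) \<Rightarrow> complex" where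
  "ip v w = (\<Sum>x\<in>supp v. cnj (v x) * w x)"

definition vnorm :: "('b \<Rightarrow> complex) \<Rightarrow> real" where
  "vnorm v = L2_set (\<lambda>x. cmod (v x)) (supp v)"

lemma ip_superset: "finite S \<Longrightarrow> supp v \<subseteq> S \<Longrightarrow> ip v w = (\<Sum>x\<in>S. cnj (v x) * w x)"
  unfolding ip_def by (rule sum.mono_neutral_left) (auto simp: supp_def)

lemma vnorm_superset: "finite S \<Longrightarrow> supp v \<subseteq> S \<Longrightarrow> vnorm v = L2_set (\<lambda>x. cmod (v x)) S"
  unfolding vnorm_def L2_set_def
  by (rule arg_cong[where f = sqrt], rule sum.mono_neutral_left) (auto simp: supp_def)

lemma vnorm_nonneg: "0 \<le> vnorm v"
  by (simp add: vnorm_def)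

lemma ip_self: "ip v v = complex_of_real ((vnorm v)\<^sup>2)"
proof -
  have "cnj (v x) * v x = complex_of_real ((cmod (v x))\<^sup>2)" for x
    by (metis complex_norm_square mult.commute)
  then have "ip v v = complex_of_real (\<Sum>x\<in>supp v. (cmod (v x))\<^sup>2)" by (simp add: ip_def)
  then show ?thesis by (simp add: vnorm_def L2_set_def sum_nonneg)
qed

lemma ip_cnj: "finite (supp v) \<Longrightarrow> finite (supp w) \<Longrightarrow> ip w v = cnj (ip v w)"
proof -
  assume f: "finite (supp v)" "finite (supp w)"
  then show ?thesis
    using ip_superset[of "supp v \<union> supp w" v w] ip_superset[of "supp v \<union> supp w" w v]
    by (simp add: mult.commute)
qed

lemma Cauchy_Schwarz:
  assumes "finite (supp v)" "finite (supp w)" shows "cmod (ip v w) \<le> vnorm v * vnorm w"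
proof -
  let ?S = "supp v \<union> supp w"
  have "cmod (ip v w) \<le> (\<Sum>x\<in>?S. cmod (cnj (v x) * w x))"
    unfolding ip_superset[of ?S v, OF finite_UnI[OF assms] Un_upper1] by (rule norm_sum)
  also have "\<dots> = (\<Sum>x\<in>?S. \<bar>cmod (v x)\<bar> * \<bar>cmod (w x)\<bar>)" by (simp add: norm_mult)
  also have "\<dots> \<le> L2_set (\<lambda>x. cmod (v x)) ?S * L2_set (\<lambda>x. cmod (w x)) ?S" by (rule L2_set_mult_ineq)
  also have "\<dots> = vnorm v * vnorm w"
    using vnorm_superset[of ?S v] vnorm_superset[of ?S w] assms by simp
  finally show ?thesis .
qed

lemma vnorm_add:
  assumes "finite (supp v)" "finite (supp w)" shows "vnorm (\<lambda>x. v x + w x) \<le> vnorm v + vnorm w"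
proof -
  let ?S = "supp v \<union> supp w"
  have "vnorm (\<lambda>x. v x + w x) = L2_set (\<lambda>x. cmod (v x + w x)) ?S"
    by (rule vnorm_superset) (use assms in \<open>auto simp: supp_def\<close>)
  also have "\<dots> \<le> L2_set (\<lambda>x. cmod (v x) + cmod (w x)) ?S"
    by (rule L2_set_mono) (simp_all add: norm_triangle_ineq)
  also have "\<dots> \<le> L2_set (\<lambda>x. cmod (v x)) ?S + L2_set (\<lambda>x. cmod (w x)) ?S" by (rule L2_set_triangle_ineq)
  also have "\<dots> = vnorm v + vnorm w"
    using vnorm_superset[of ?S v] vnorm_superset[of ?S w] assms by simp
  finally show ?thesis .
qed

lemma vnorm_scale: "vnorm (\<lambda>x. c * v x) = cmod c * vnorm v"
proof (cases "c = 0")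
  case False
  then have "supp (\<lambda>x. c * v x) = supp v" by (simp add: supp_def)
  then show ?thesis by (simp add: vnorm_def norm_mult L2_set_right_distrib)
qed (simp add: vnorm_def supp_def)

lemma vnorm_zero: "vnorm (\<lambda>x. 0) = 0"
  by (simp add: vnorm_def supp_def)

lemma vectors_zero [simp]: "(\<lambda>x. 0) \<in> vectors A"
  by (simp add: vectors_def supp_def)

lemma vectors_finite: "v \<in> vectors A \<Longrightarrow> finite (supp v)"
  by (simp add: vectors_def)

lemma vectors_outside: "v \<in> vectors A \<Longrightarrow> x \<notin> shift_space A \<Longrightarrow> v x = 0"
  by (auto simp: vectors_def supp_def)

lemma vectorsI: "supp v \<subseteq> S \<Longrightarrow> supp v \<subseteq> shift_space A \<Longrightarrow> finite S \<Longrightarrow> v \<in> vectors A"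
  using finite_subset by (simp add: vectors_def)

lemma vectors_add: "v \<in> vectors A \<Longrightarrow> w \<in> vectors A \<Longrightarrow> (\<lambda>x. v x + w x) \<in> vectors A"
proof -
  assume *: "v \<in> vectors A" "w \<in> vectors A"
  have "supp (\<lambda>x. v x + w x) \<subseteq> supp v \<union> supp w" by (auto simp: supp_def)
  then show ?thesis using * by (intro vectorsI[of _ "supp v \<union> supp w"]) (auto simp: vectors_def)
qed

lemma vectors_scale: "v \<in> vectors A \<Longrightarrow> (\<lambda>x. c * v x) \<in> vectors A"
proof -
  assume *: "v \<in> vectors A"
  have "supp (\<lambda>x. c * v x) \<subseteq> supp v" by (auto simp: supp_def)
  then show ?thesis using * by (intro vectorsI[of _ "supp v"]) (auto simp: vectors_def)
qed

lemma letter_op_vectors: assumes "v \<in> vectors A" shows "letter_op A l v \<in> vectors A"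
proof (cases l)
  case (Gen i)
  have "supp (letter_op A l v) \<subseteq> prepend i ` supp v"
  proof
    fix x assume "x \<in> supp (letter_op A l v)"
    then have "shift x \<in> supp v" "x = prepend i (shift x)"
      using prepend_shift[of x] by (auto simp: Gen supp_def split: if_splits)
    then show "x \<in> prepend i ` supp v" by blast
  qed
  moreover have "supp (letter_op A l v) \<subseteq> shift_space A" by (auto simp: Gen supp_def)
  ultimately show ?thesis by (rule vectorsI) (simp add: vectors_finite[OF assms])
next
  case (Adj i)
  have "supp (letter_op A l v) \<subseteq> shift ` supp v"
  proof
    fix x assume "x \<in> supp (letter_op A l v)"
    then have "prepend i x \<in> supp v" by (auto simp: Adj supp_def split: if_splits)
    then have "shift (prepend i x) \<in> shift ` supp v" by blast
    then show "x \<in> shift ` supp v" by simp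
  qed
  moreover have "supp (letter_op A l v) \<subseteq> shift_space A" by (auto simp: Adj supp_def)
  ultimately show ?thesis by (rule vectorsI) (simp add: vectors_finite[OF assms])
qed

lemma word_op_vectors: "v \<in> vectors A \<Longrightarrow> word_op A ls v \<in> vectors A"
  by (induction ls) (simp_all add: word_op_def letter_op_vectors)

text \<open>The sums are matched by the bijection \<open>y \<mapsto> iy\<close> from the points that may follow \<open>i\<close> to those that start with \<open>i\<close>.\<close>

lemma ip_Gen:
  assumes v: "v \<in> vectors A" and w: "w \<in> vectors A"
  shows "ip (letter_op A (Gen i) v) w = ip v (letter_op A (Adj i) w)"
proof -
  let ?L = "supp (letter_op A (Gen i) v)" and ?R = "{y \<in> supp v. A $ i $ y 0 = 1}"
  have "ip (letter_op A (Gen i) v) w = (\<Sum>x\<in>?L. cnj (v (shift x)) * w x)"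
    unfolding ip_def by (rule sum.cong) (auto simp: supp_def)
  also have "\<dots> = (\<Sum>y\<in>?R. cnj (v y) * w (prepend i y))"
  proof (rule sum.reindex_bij_witness[of _ "prepend i" shift])
    fix x assume "x \<in> ?L"
    then have x: "x \<in> shift_space A" "x 0 = i" "v (shift x) \<noteq> 0" by (auto simp: supp_def split: if_splits)
    then show "prepend i (shift x) = x" "shift x \<in> ?R" "cnj (v (shift x)) * w (prepend i (shift x)) = cnj (v (shift x)) * w x"
      using prepend_shift[of x] by (auto simp: supp_def shift_space_def shift_def)
  next
    fix y assume y: "y \<in> ?R"
    then have "y \<in> shift_space A" using v by (auto simp: vectors_def)
    then show "prepend i y \<in> ?L" using y by (simp add: supp_def prepend_in_shift_space)
  qed simp
  also have "\<dots> = (\<Sum>y\<in>?R. cnj (v y) * letter_op A (Adj i) w y)"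
    by (rule sum.cong) (use v in \<open>auto simp: vectors_def\<close>)
  also have "\<dots> = ip v (letter_op A (Adj i) w)"
    unfolding ip_def by (rule sum.mono_neutral_left) (use v in \<open>auto simp: vectors_def\<close>)
  finally show ?thesis .
qed

lemma ip_letter:
  assumes v: "v \<in> vectors A" and w: "w \<in> vectors A"
  shows "ip (letter_op A l v) w = ip v (letter_op A (letter_star l) w)"
proof (cases l)
  case (Gen i) then show ?thesis using ip_Gen[OF v w] by simp
next
  case (Adj i)
  have "ip (letter_op A (Adj i) v) w = cnj (ip w (letter_op A (Adj i) v))"
    using ip_cnj vectors_finite letter_op_vectors[OF v] w by metis
  also have "\<dots> = cnj (ip (letter_op A (Gen i) w) v)" by (simp only: ip_Gen[OF w v])
  also have "\<dots> = ip v (letter_op A (Gen i) w)"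
    using ip_cnj vectors_finite letter_op_vectors[OF w] v by metis
  finally show ?thesis by (simp only: Adj letter_star.simps)
qed

lemma vnorm_Gen: assumes v: "v \<in> vectors A" shows "vnorm (letter_op A (Gen i) v) \<le> vnorm v"
proof -
  let ?u = "letter_op A (Gen i) v"
  have u: "?u \<in> vectors A" by (rule letter_op_vectors[OF v])
  have "ip ?u ?u = ip v (letter_op A (Adj i) ?u)" by (rule ip_Gen[OF v u])
  also have "\<dots> = (\<Sum>y\<in>supp v. if A $ i $ y 0 = 1 then cnj (v y) * v y else 0)"
    unfolding ip_def
    by (rule sum.cong) (use v in \<open>auto simp: vectors_def prepend_in_shift_space\<close>)
  also have "\<dots> = complex_of_real (\<Sum>y\<in>supp v. if A $ i $ y 0 = 1 then (cmod (v y))\<^sup>2 else 0)"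
    unfolding of_real_sum by (rule sum.cong) (simp_all add: complex_norm_square mult.commute del: of_real_power)
  finally have "(vnorm ?u)\<^sup>2 = (\<Sum>y\<in>supp v. if A $ i $ y 0 = 1 then (cmod (v y))\<^sup>2 else 0)"
    unfolding ip_self of_real_eq_iff .
  also have "\<dots> \<le> (\<Sum>y\<in>supp v. (cmod (v y))\<^sup>2)" by (rule sum_mono) simp
  also have "\<dots> = (vnorm v)\<^sup>2" by (simp add: vnorm_def L2_set_def sum_nonneg)
  finally show ?thesis by (rule power2_le_imp_le) (rule vnorm_nonneg)
qed

lemma square_le_mult_imp_le: "(x::real)\<^sup>2 \<le> x * y \<Longrightarrow> 0 \<le> x \<Longrightarrow> 0 \<le> y \<Longrightarrow> x \<le> y"
  by (cases "x = 0") (auto simp: power2_eq_square)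

lemma vnorm_letter: assumes v: "v \<in> vectors A" shows "vnorm (letter_op A l v) \<le> vnorm v"
proof (cases l)
  case (Gen i) then show ?thesis using vnorm_Gen[OF v] by simp
next
  case (Adj i)
  let ?u = "letter_op A (Adj i) v"
  have u: "?u \<in> vectors A" by (rule letter_op_vectors[OF v])
  have g: "letter_op A (Gen i) ?u \<in> vectors A" by (rule letter_op_vectors[OF u])
  have "ip (letter_op A (Gen i) ?u) v = ip ?u ?u" by (rule ip_Gen[OF u v])
  then have "(vnorm ?u)\<^sup>2 = cmod (ip (letter_op A (Gen i) ?u) v)" by (simp add: ip_self norm_power vnorm_nonneg del: letter_op.simps)
  also have "\<dots> \<le> vnorm (letter_op A (Gen i) ?u) * vnorm v"
    by (rule Cauchy_Schwarz[OF vectors_finite[OF g] vectors_finite[OF v]])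
  also have "\<dots> \<le> vnorm ?u * vnorm v" by (intro mult_right_mono vnorm_Gen u vnorm_nonneg)
  finally show ?thesis unfolding Adj by (rule square_le_mult_imp_le) (rule vnorm_nonneg)+
qed

lemma vnorm_word: "v \<in> vectors A \<Longrightarrow> vnorm (word_op A ls v) \<le> vnorm v"
proof (induction ls)
  case (Cons l ls)
  have "vnorm (word_op A (l # ls) v) \<le> vnorm (word_op A ls v)"
    using vnorm_letter[OF word_op_vectors[OF Cons.prems], of l ls] by (simp add: word_op_def)
  with Cons show ?case by simp
qed (simp add: word_op_def)

lemma letter_op_linear:
  "letter_op A l (\<lambda>x. v x + w x) = (\<lambda>x. letter_op A l v x + letter_op A l w x)"
  "letter_op A l (\<lambda>x. c * v x) = (\<lambda>x. c * letter_op A l v x)"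
  by (cases l; auto)+

lemma word_op_linear:
  "word_op A ls (\<lambda>x. v x + w x) = (\<lambda>x. word_op A ls v x + word_op A ls w x)"
  "word_op A ls (\<lambda>x. c * v x) = (\<lambda>x. c * word_op A ls v x)"
  by (induction ls) (simp_all add: word_op_def letter_op_linear)

lemma free_op_superset:
  assumes "finite S" "Poly_Mapping.keys a \<subseteq> S"
  shows "free_op A a v x = (\<Sum>w\<in>S. Poly_Mapping.lookup a w * word_op A (letters w) v x)"
  unfolding free_op_def by (rule sum.mono_neutral_left) (use assms in \<open>auto simp: in_keys_iff\<close>)

lemma free_op_add: "free_op A (a + b) v = (\<lambda>x. free_op A a v x + free_op A b v x)"
proof
  fix x
  let ?S = "Poly_Mapping.keys a \<union> Poly_Mapping.keys b"
  have "free_op A (a + b) v x = (\<Sum>w\<in>?S. Poly_Mapping.lookup (a + b) w * word_op A (letters w) v x)"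
    by (rule free_op_superset) (auto simp: Poly_Mapping.keys_add)
  then show "free_op A (a + b) v x = free_op A a v x + free_op A b v x"
    by (simp add: free_op_superset[of ?S] lookup_add distrib_right sum.distrib)
qed

lemma free_op_0: "free_op A 0 v = (\<lambda>x. 0)"
  by (simp add: free_op_def)

lemma free_op_single: "free_op A (Poly_Mapping.single w k) v = (\<lambda>x. k * word_op A (letters w) v x)"
  by (rule ext, subst free_op_superset[of "{w}"]) auto

lemma free_op_vectors: "v \<in> vectors A \<Longrightarrow> free_op A a v \<in> vectors A"
  by (induction a rule: poly_mapping_add_induct)
    (simp_all add: free_op_0 free_op_add free_op_single vectors_add vectors_scale word_op_vectors)

lemma free_op_linear:
  "free_op A a (\<lambda>x. v x + w x) = (\<lambda>x. free_op A a v x + free_op A a w x)"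
  "free_op A a (\<lambda>x. c * v x) = (\<lambda>x. c * free_op A a v x)"
  by (simp_all add: free_op_def word_op_linear distrib_left sum.distrib sum_distrib_left mult.left_commute)

lemma free_op_mult: "free_op A (a * b) v = free_op A a (free_op A b v)"
proof (induction a rule: poly_mapping_add_induct)
  case zero show ?case by (simp add: free_op_0)
next
  case (add x y) then show ?case by (simp add: free_op_add distrib_right)
next
  case (single w k)
  show ?case
  proof (induction b rule: poly_mapping_add_induct)
    case zero show ?case using free_op_linear(2)[of A _ 0 "\<lambda>x. 0"] by (simp add: free_op_0)
  next
    case (add x y) then show ?case by (simp add: free_op_add distrib_left free_op_linear)
  next
    case (single u l) show ?case
      by (simp add: mult_single free_op_single plus_monomial_def word_op_linear word_op_def mult.assoc)
  qed
qed

lemma free_op_scale: "free_op A (free_scale c a) v = (\<lambda>x. c * free_op A a v x)"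
  unfolding free_scale_def free_op_mult free_op_single by (simp add: zero_monomial_def word_op_def)

lemma free_op_uminus: "free_op A (- a) v = (\<lambda>x. - free_op A a v x)"
  using free_op_scale[of A "-1" a v] by (simp add: free_scale_minus1)

lemma free_op_diff: "free_op A (a - b) v = (\<lambda>x. free_op A a v x - free_op A b v x)"
  using free_op_add[of A a "- b" v] by (simp add: free_op_uminus)

lemma free_op_sum: "finite S \<Longrightarrow> free_op A (\<Sum>i\<in>S. f i) v = (\<lambda>x. \<Sum>i\<in>S. free_op A (f i) v x)"
  by (induction S rule: finite_induct) (simp_all add: free_op_0 free_op_add)

lemma free_op_1: fixes A :: "int ^ 'n ^ 'n" shows "free_op A 1 v = v"
proof -
  have "letters (0 :: 'n monomial) = []" by (simp add: zero_monomial_def)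
  then show ?thesis using free_op_single[of A 0 1 v] by (simp add: word_op_def)
qed

lemma free_op_gen: "free_op A (free_gen i) v = letter_op A (Gen i) v"
  "free_op A (free_star (free_gen i)) v = letter_op A (Adj i) v"
  by (simp_all add: free_gen_def free_star_single monomial_star_def free_op_single word_op_def)

lemma ip_add_left: "finite (supp u) \<Longrightarrow> finite (supp v) \<Longrightarrow> ip (\<lambda>x. u x + v x) w = ip u w + ip v w"
proof -
  assume f: "finite (supp u)" "finite (supp v)"
  let ?S = "supp u \<union> supp v"
  have "ip (\<lambda>x. u x + v x) w = (\<Sum>x\<in>?S. cnj (u x + v x) * w x)"
    by (rule ip_superset) (use f in \<open>auto simp: supp_def\<close>)
  then show ?thesis using f by (simp add: ip_superset[of ?S u] ip_superset[of ?S v] distrib_right sum.distrib)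
qed

lemma ip_add_right: "ip u (\<lambda>x. v x + w x) = ip u v + ip u w"
  by (simp add: ip_def distrib_left sum.distrib)

lemma ip_scale_right: "ip u (\<lambda>x. c * v x) = c * ip u v"
  by (simp add: ip_def sum_distrib_left mult.left_commute)

lemma ip_scale_left: "ip (\<lambda>x. c * u x) v = cnj c * ip u v"
proof (cases "c = 0")
  case False
  then have "supp (\<lambda>x. c * u x) = supp u" by (simp add: supp_def)
  then show ?thesis by (simp add: ip_def sum_distrib_left mult.assoc)
qed (simp add: ip_def supp_def)

lemma ip_word:
  "v \<in> vectors A \<Longrightarrow> w \<in> vectors A \<Longrightarrow> ip (word_op A ls v) w = ip v (word_op A (rev (map letter_star ls)) w)"
proof (induction ls arbitrary: w)
  case (Cons l ls)
  have "ip (word_op A (l # ls) v) w = ip (word_op A ls v) (letter_op A (letter_star l) w)"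
    using ip_letter[OF word_op_vectors[OF Cons.prems(1)] Cons.prems(2)] by (simp add: word_op_def)
  also have "\<dots> = ip v (word_op A (rev (map letter_star ls)) (letter_op A (letter_star l) w))"
    by (intro Cons.IH Cons.prems letter_op_vectors)
  finally show ?case by (simp add: word_op_def)
qed (simp add: word_op_def)

lemma ip_free_op:
  "v \<in> vectors A \<Longrightarrow> w \<in> vectors A \<Longrightarrow> ip (free_op A a v) w = ip v (free_op A (free_star a) w)"
proof (induction a rule: poly_mapping_add_induct)
  case zero
  then show ?case by (simp add: free_op_0 ip_def supp_def)
next
  case (single u k)
  then show ?case
    by (simp add: free_star_single free_op_single ip_scale_left ip_scale_right ip_word monomial_star_def)
next
  case (add a b)
  then show ?case
    using ip_add_left[OF vectors_finite[OF free_op_vectors[OF add.prems(1)]] vectors_finite[OF free_op_vectors[OF add.prems(1)]], of a b w]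
    by (simp add: free_star_add free_op_add ip_add_right)
qed

lemma free_op_bounded: "\<exists>K. \<forall>v\<in>vectors A. vnorm (free_op A a v) \<le> K * vnorm v"
proof (induction a rule: poly_mapping_add_induct)
  case zero
  show ?case by (intro exI[of _ 0]) (simp add: free_op_0 vnorm_zero)
next
  case (single w k)
  show ?case
    by (intro exI[of _ "cmod k"]) (simp add: free_op_single vnorm_scale mult_left_mono vnorm_word)
next
  case (add a b)
  then obtain K L where KL: "\<And>v. v \<in> vectors A \<Longrightarrow> vnorm (free_op A a v) \<le> K * vnorm v"
    "\<And>v. v \<in> vectors A \<Longrightarrow> vnorm (free_op A b v) \<le> L * vnorm v" by blast
  have "vnorm (free_op A (a + b) v) \<le> (K + L) * vnorm v" if "v \<in> vectors A" for v
    using vnorm_add[OF vectors_finite[OF free_op_vectors[OF that]] vectors_finite[OF free_op_vectors[OF that]], of a b]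
      KL[OF that] by (simp add: free_op_add distrib_right)
  then show ?case by blast
qed

definition op_norm :: "int ^ 'n ^ 'n \<Rightarrow> 'n free_alg \<Rightarrow> real" where
  "op_norm A a = (SUP v\<in>{v \<in> vectors A. vnorm v \<le> 1}. vnorm (free_op A a v))"

lemma op_norm_least:
  assumes "\<And>v. v \<in> vectors A \<Longrightarrow> vnorm v \<le> 1 \<Longrightarrow> vnorm (free_op A a v) \<le> K"
  shows "op_norm A a \<le> K"
proof -
  have "(\<lambda>x. 0) \<in> {v \<in> vectors A. vnorm v \<le> 1}" by (simp add: vnorm_zero)
  then have "{v \<in> vectors A. vnorm v \<le> 1} \<noteq> {}" by blast
  then show ?thesis unfolding op_norm_def by (rule cSUP_least) (use assms in simp)
qed

lemma op_norm_upper_unit: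
  assumes v: "v \<in> vectors A" "vnorm v \<le> 1" shows "vnorm (free_op A a v) \<le> op_norm A a"
proof -
  obtain K where K: "\<And>v. v \<in> vectors A \<Longrightarrow> vnorm (free_op A a v) \<le> K * vnorm v"
    using free_op_bounded by blast
  have "vnorm (free_op A a w) \<le> \<bar>K\<bar>" if "w \<in> vectors A" "vnorm w \<le> 1" for w
  proof -
    have "K * vnorm w \<le> \<bar>K\<bar> * 1" by (intro mult_mono that vnorm_nonneg) auto
    then show ?thesis using K[OF that(1)] by simp
  qed
  then have "bdd_above ((\<lambda>v. vnorm (free_op A a v)) ` {v \<in> vectors A. vnorm v \<le> 1})"
    by (intro bdd_aboveI2) auto
  then show ?thesis unfolding op_norm_def using v by (intro cSUP_upper) simp_all
qed

lemma op_norm_nonneg: "0 \<le> op_norm A a"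
  using op_norm_upper_unit[of "\<lambda>x. 0" A a] vnorm_nonneg[of "free_op A a (\<lambda>x. 0)"] by (simp add: vnorm_zero)

lemma vnorm_eq_0: "finite (supp v) \<Longrightarrow> vnorm v = 0 \<Longrightarrow> v = (\<lambda>x. 0)"
  by (auto simp: vnorm_def L2_set_eq_0_iff supp_def)

lemma op_norm_upper: assumes v: "v \<in> vectors A" shows "vnorm (free_op A a v) \<le> op_norm A a * vnorm v"
proof (cases "vnorm v = 0")
  case True
  then have "v = (\<lambda>x. 0 * v x)" using vnorm_eq_0[OF vectors_finite[OF v]] by simp
  then have "free_op A a v = (\<lambda>x. 0 * free_op A a v x)" using free_op_linear(2)[of A a 0 v] by simp
  then have "vnorm (free_op A a v) = 0" using vnorm_scale[of 0] by (metis mult_zero_left norm_zero)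
  then show ?thesis by (simp add: True)
next
  case False
  define c where "c = complex_of_real (1 / vnorm v)"
  have pos: "0 < vnorm v" using False vnorm_nonneg[of v] by simp
  then have c: "cmod c = 1 / vnorm v" by (simp add: c_def norm_divide)
  have "vnorm (free_op A a (\<lambda>x. c * v x)) \<le> op_norm A a"
    by (rule op_norm_upper_unit[OF vectors_scale[OF v]]) (use pos c in \<open>simp add: vnorm_scale\<close>)
  then have "vnorm (free_op A a v) / vnorm v \<le> op_norm A a"
    by (simp only: free_op_linear vnorm_scale c) simp
  then show ?thesis using pos by (simp add: field_simps)
qed

lemma op_norm_star_le: "op_norm A (free_star a) \<le> op_norm A a"
proof (rule op_norm_least)
  fix v assume v: "v \<in> vectors A" "vnorm v \<le> 1"
  let ?u = "free_op A (free_star a) v"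
  note u = free_op_vectors[OF v(1), of "free_star a"]
  have "(vnorm ?u)\<^sup>2 = cmod (ip ?u ?u)" by (simp add: ip_self norm_power vnorm_nonneg)
  also have "ip ?u ?u = ip v (free_op A a ?u)" using ip_free_op[OF v(1) u, of "free_star a"] by simp
  also have "cmod \<dots> \<le> vnorm v * vnorm (free_op A a ?u)"
    by (rule Cauchy_Schwarz[OF vectors_finite[OF v(1)] vectors_finite[OF free_op_vectors[OF u]]])
  also have "\<dots> \<le> 1 * (op_norm A a * vnorm ?u)"
    by (intro mult_mono v op_norm_upper u vnorm_nonneg) simp
  finally have "(vnorm ?u)\<^sup>2 \<le> vnorm ?u * op_norm A a" by (simp add: mult.commute)
  then show "vnorm ?u \<le> op_norm A a" by (rule square_le_mult_imp_le) (rule vnorm_nonneg op_norm_nonneg)+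
qed

lemma op_norm_mult: "op_norm A (a * b) \<le> op_norm A a * op_norm A b"
proof (rule op_norm_least)
  fix v assume v: "v \<in> vectors A" "vnorm v \<le> 1"
  have "vnorm (free_op A (a * b) v) \<le> op_norm A a * vnorm (free_op A b v)"
    unfolding free_op_mult by (rule op_norm_upper[OF free_op_vectors[OF v(1)]])
  also have "\<dots> \<le> op_norm A a * op_norm A b"
    by (intro mult_left_mono op_norm_upper_unit v op_norm_nonneg)
  finally show "vnorm (free_op A (a * b) v) \<le> op_norm A a * op_norm A b" .
qed

lemma cstar_seminorm_op_norm: "cstar_seminorm (op_norm A)"
  unfolding cstar_seminorm_def
proof (intro conjI allI)
  fix a b :: "'a free_alg" and k
  show "op_norm A (a + b) \<le> op_norm A a + op_norm A b"
  proof (rule op_norm_least)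
    fix v assume v: "v \<in> vectors A" "vnorm v \<le> 1"
    show "vnorm (free_op A (a + b) v) \<le> op_norm A a + op_norm A b"
      using vnorm_add[OF vectors_finite[OF free_op_vectors[OF v(1)]] vectors_finite[OF free_op_vectors[OF v(1)]], of a b]
        op_norm_upper_unit[OF v, of a] op_norm_upper_unit[OF v, of b] by (simp add: free_op_add)
  qed
  have le: "op_norm A (free_scale k a) \<le> cmod k * op_norm A a" for k a
    by (rule op_norm_least) (simp add: free_op_scale vnorm_scale mult_left_mono op_norm_upper_unit)
  show "op_norm A (free_scale k a) = cmod k * op_norm A a"
  proof (cases "k = 0")
    case True then show ?thesis
      using le[of k a] op_norm_nonneg[of A "free_scale k a"] by simp
  next
    case False
    have "cmod k * op_norm A a \<le> cmod k * (cmod (inverse k) * op_norm A (free_scale k a))"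
      using le[of "inverse k" "free_scale k a"] False
      by (intro mult_left_mono) (auto simp: free_scale_scale)
    also have "\<dots> = op_norm A (free_scale k a)"
      using False by (simp add: norm_inverse)
    finally show ?thesis using le[of k a] by simp
  qed
  show "op_norm A (a * b) \<le> op_norm A a * op_norm A b" by (rule op_norm_mult)
  show "op_norm A (free_star a * a) = (op_norm A a)\<^sup>2"
  proof (rule antisym)
    have "op_norm A (free_star a * a) \<le> op_norm A (free_star a) * op_norm A a" by (rule op_norm_mult)
    also have "\<dots> \<le> op_norm A a * op_norm A a" by (intro mult_right_mono op_norm_star_le op_norm_nonneg)
    finally show "op_norm A (free_star a * a) \<le> (op_norm A a)\<^sup>2" by (simp add: power2_eq_square)
    have "op_norm A a \<le> sqrt (op_norm A (free_star a * a))"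
    proof (rule op_norm_least, rule real_le_rsqrt)
      fix v assume v: "v \<in> vectors A" "vnorm v \<le> 1"
      let ?u = "free_op A a v"
      note u = free_op_vectors[OF v(1), of a]
      have "(vnorm ?u)\<^sup>2 = cmod (ip ?u ?u)" by (simp add: ip_self norm_power vnorm_nonneg)
      also have "ip ?u ?u = ip v (free_op A (free_star a * a) v)"
        using ip_free_op[OF v(1) u, of a] by (simp add: free_op_mult)
      also have "cmod \<dots> \<le> vnorm v * vnorm (free_op A (free_star a * a) v)"
        by (rule Cauchy_Schwarz[OF vectors_finite[OF v(1)] vectors_finite[OF free_op_vectors[OF v(1)]]])
      also have "\<dots> \<le> 1 * op_norm A (free_star a * a)"
        by (intro mult_mono v op_norm_upper_unit vnorm_nonneg) simp
      finally show "(vnorm ?u)\<^sup>2 \<le> op_norm A (free_star a * a)" by simp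
    qed
    then show "(op_norm A a)\<^sup>2 \<le> op_norm A (free_star a * a)"
      using op_norm_nonneg by (metis power_mono real_sqrt_pow2)
  qed
qed

lemma op_norm_relators: fixes A :: "int ^ 'n ^ 'n" assumes "ck_matrix A" "a \<in> ck_relators A" shows "op_norm A a = 0"
proof -
  have "free_op A a v x = 0" if v: "v \<in> vectors A" for v x
  proof -
    note out = vectors_outside[OF v]
    have step: "A $ x 0 $ shift x 0 = 1" if "x \<in> shift_space A"
      using that by (simp add: shift_space_def shift_def)
    consider (partial_isometry) i where "a = free_gen i * free_star (free_gen i) * free_gen i - free_gen i"
      | (orthogonal) i j where "i \<noteq> j" "a = free_star (free_gen i) * free_gen j"
      | (source) i where "a = free_star (free_gen i) * free_gen i -
          (\<Sum>j\<in>UNIV. free_scale (of_int (A $ i $ j)) (free_gen j * free_star (free_gen j)))"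
      | (unit) "a = (\<Sum>i\<in>UNIV. free_gen i * free_star (free_gen i)) - 1"
      using assms(2) unfolding ck_relators_def Un_iff mem_Collect_eq singleton_iff by fast
    then show ?thesis
    proof cases
      case partial_isometry
      then show ?thesis
        using step by (auto simp: free_op_diff free_op_mult free_op_gen prepend_in_shift_space shift_in_shift_space prepend_shift)
    next
      case orthogonal
      then show ?thesis by (simp add: free_op_mult free_op_gen)
    next
      case source
      have "free_op A (\<Sum>j\<in>UNIV. free_scale (of_int (A $ i $ j)) (free_gen j * free_star (free_gen j))) v x =
          (\<Sum>j\<in>UNIV. if j = x 0 then of_int (A $ i $ j) * v x else 0)"
        unfolding free_op_sum[OF finite]
      proof (rule sum.cong[OF refl])
        fix j
        show "free_op A (free_scale (of_int (A $ i $ j)) (free_gen j * free_star (free_gen j))) v x =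
            (if j = x 0 then of_int (A $ i $ j) * v x else 0)"
          using step out[of x]
          by (auto simp: free_op_scale free_op_mult free_op_gen shift_in_shift_space prepend_shift)
      qed
      also have "\<dots> = of_int (A $ i $ x 0) * v x" by simp
      moreover have "A $ i $ x 0 \<in> {0, 1}" using assms(1) by (simp add: ck_matrix_def)
      ultimately show ?thesis
        using source out by (auto simp: free_op_diff free_op_mult free_op_gen prepend_in_shift_space)
    next
      case unit
      have "free_op A (\<Sum>j\<in>UNIV. free_gen j * free_star (free_gen j)) v x =
          (\<Sum>j\<in>UNIV. if j = x 0 then v x else 0)"
        unfolding free_op_sum[OF finite]
      proof (rule sum.cong[OF refl])
        fix j
        show "free_op A (free_gen j * free_star (free_gen j)) v x = (if j = x 0 then v x else 0)"
          using step out[of x]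
          by (auto simp: free_op_mult free_op_gen shift_in_shift_space prepend_shift)
      qed
      then show ?thesis by (simp add: unit free_op_diff free_op_1)
    qed
  qed
  then have "free_op A a v = (\<lambda>x. 0)" if "v \<in> vectors A" for v using that by blast
  then have "op_norm A a \<le> 0" by (intro op_norm_least) (simp add: vnorm_zero)
  then show ?thesis using op_norm_nonneg[of A a] by simp
qed

lemma op_norm_in_ck_seminorms: "ck_matrix A \<Longrightarrow> op_norm A \<in> ck_seminorms A"
  by (simp add: ck_seminorms_def cstar_seminorm_op_norm op_norm_relators)

lemma word_op_delta:
  assumes "x \<in> shift_space A"
  shows "word_op A (map Gen (map x [0..<n])) (\<lambda>z. if z = (shift ^^ n) x then 1 else 0) = (\<lambda>z. if z = x then 1 else 0)"
  using assms
proof (induction n arbitrary: x)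
  case 0 show ?case by (simp add: word_op_def)
next
  case (Suc n)
  have "map x [0..<Suc n] = x 0 # map (shift x) [0..<n]"
    by (simp add: shift_def upt_conv_Cons map_Suc_upt[symmetric] del: upt_Suc)
  then have "word_op A (map Gen (map x [0..<Suc n])) (\<lambda>z. if z = (shift ^^ Suc n) x then 1 else 0) =
      letter_op A (Gen (x 0)) (\<lambda>z. if z = shift x then 1 else 0)"
    using Suc.IH[OF shift_in_shift_space[OF Suc.prems]] by (simp add: word_op_def funpow_swap1)
  also have "\<dots> = (\<lambda>z. if z = x then 1 else 0)"
  proof (rule ext)
    fix z
    have "z \<in> shift_space A \<and> z 0 = x 0 \<and> shift z = shift x \<longleftrightarrow> z = x"
      using Suc.prems prepend_shift[of z] prepend_shift[of x] by metis
    then show "letter_op A (Gen (x 0)) (\<lambda>z. if z = shift x then 1 else 0) z = (if z = x then 1 else 0)"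
      by (simp only: letter_op.simps) (simp split: if_splits, blast)
  qed
  finally show ?case .
qed

lemma ck_word_class: "ck_word A \<alpha> = ck_class A (\<lambda>_. Poly_Mapping.single (Monomial (map Gen \<alpha>)) 1)"
proof (induction \<alpha>)
  case Nil show ?case by (simp add: ck_word_def CK_one flip: zero_monomial_def)
next
  case (Cons i \<alpha>)
  have "ck_word A (i # \<alpha>) = ck_gen A i \<otimes>\<^bsub>CK_algebra A\<^esub> ck_word A \<alpha>" by (simp add: ck_word_def)
  then show ?case by (simp add: Cons ck_gen_def CK_mult free_gen_def mult_single plus_monomial_def)
qed

text \<open>The word of the first \<open>n\<close> letters of \<open>x\<close> maps the unit vector at \<open>\<sigma>\<^sup>n x\<close> to the unit vector at \<open>x\<close>.\<close>

lemma ck_word_nrm: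
  assumes A: "ck_matrix A" and x: "x \<in> shift_space A"
  shows "1 \<le> nrm (CK_algebra A) (ck_word A (map x [0..<n]))"
proof -
  let ?w = "Poly_Mapping.single (Monomial (map Gen (map x [0..<n]))) 1 :: 'a free_alg"
  define d :: "(nat \<Rightarrow> 'a) \<Rightarrow> (nat \<Rightarrow> 'a) \<Rightarrow> complex" where "d y = (\<lambda>z. if z = y then 1 else 0)" for y
  have sd: "supp (d y) = {y}" for y by (auto simp: supp_def d_def)
  have vd: "vnorm (d y) = 1" for y by (simp add: vnorm_def sd L2_set_def) (simp add: d_def)
  have y: "(shift ^^ n) x \<in> shift_space A" using x by (simp add: shift_funpow shift_space_def)
  have "free_op A ?w (d ((shift ^^ n) x)) = d x"
    using word_op_delta[OF x, of n] by (simp add: free_op_single d_def)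
  then have "1 = vnorm (free_op A ?w (d ((shift ^^ n) x)))" by (simp add: vd)
  also have "\<dots> \<le> op_norm A ?w" by (rule op_norm_upper_unit) (simp_all add: vectors_def sd vd y)
  also have "\<dots> \<le> ck_norm A ?w" by (rule ck_norm_upper[OF op_norm_in_ck_seminorms[OF A]])
  also have "\<dots> = nrm (CK_algebra A) (ck_word A (map x [0..<n]))" by (simp add: ck_word_class CK_nrm_const)
  finally show ?thesis .
qed


section \<open>From the algebra back to the shift\<close>

lemma (in ck_rep) proj_cylinder: "proj (cylinder A x n) = word_elem (map x [0..<n]) \<otimes> star \<AA> (word_elem (map x [0..<n]))"
proof -
  have "{z \<in> X. \<forall>i<length (map x [0..<n]). z i = map x [0..<n] ! i} = cylinder A x n"
    by (auto simp: cylinder_def)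
  then show ?thesis using proj_word[of "map x [0..<n]"] by simp
qed

text \<open>A nonempty set contains a cylinder, and the projection of a cylinder is \<open>w w\<^sup>*\<close> for a word \<open>w\<close> of norm at least \<open>1\<close>.\<close>

lemma CK_proj_nonzero:
  assumes A: "ck_matrix A" and U: "clopen A U" and zero: "ck_rep.proj (CK_algebra A) A (ck_gen A) U = \<zero>\<^bsub>CK_algebra A\<^esub>"
  shows "U = {}"
proof (rule ccontr)
  interpret ck_rep "CK_algebra A" A "ck_gen A" by (rule ck_rep_CK[OF A])
  assume "U \<noteq> {}"
  then obtain x where x: "x \<in> U" "x \<in> X" using clopen_subset[OF U] by blast
  obtain n where n: "determined A n U" using U by (auto simp: clopen_def)
  have "cylinder A x n \<subseteq> U" using x n by (auto simp: determined_def cylinder_def)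
  then have "proj (cylinder A x n) = proj U \<otimes>\<^bsub>CK_algebra A\<^esub> proj (cylinder A x n)"
    by (simp add: proj_mult U clopen_cylinder Int_absorb1)
  then have z: "proj (cylinder A x n) = \<zero>\<^bsub>CK_algebra A\<^esub>" using zero by simp
  let ?w = "word_elem (map x [0..<n])"
  have "?w = ck_word A (map x [0..<n])" by (simp add: word_elem_def ck_word_def)
  then have "1 \<le> nrm (CK_algebra A) ?w" using ck_word_nrm[OF A x(2)] by simp
  moreover have "(nrm (CK_algebra A) (star (CK_algebra A) ?w))\<^sup>2 = nrm (CK_algebra A) (proj (cylinder A x n))"
    using cstar_identity[of "star (CK_algebra A) ?w"] by (simp add: star_star proj_cylinder)
  ultimately show False by (simp add: z nrm_zero nrm_star)
qed

text \<open>Stone duality in the form needed here: a relation that matches the clopen sets of the two shift spaces and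
  respects the Boolean operations comes from a map of points. The image of \<open>x\<close> is read off coordinate by
  coordinate: its \<open>n\<close>-th letter is the one whose coordinate set is matched with a set containing \<open>x\<close>.\<close>

lemma stone_map:
  fixes A :: "int ^ 'm ^ 'm" and B :: "int ^ 'n ^ 'n"
  assumes left: "\<And>U V. R U V \<Longrightarrow> clopen A U"
    and total: "\<And>V. clopen B V \<Longrightarrow> \<exists>U. R U V"
    and Int: "\<And>U V U' V'. R U V \<Longrightarrow> R U' V' \<Longrightarrow> R (U \<inter> U') (V \<inter> V')"
    and compl: "\<And>U V. R U V \<Longrightarrow> R (shift_space A - U) (shift_space B - V)"
    and empty: "\<And>U. R U {} \<Longrightarrow> U = {}"
  obtains h where "\<And>x. x \<in> shift_space A \<Longrightarrow> h x \<in> shift_space B"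
    "\<And>U V x. R U V \<Longrightarrow> clopen B V \<Longrightarrow> x \<in> shift_space A \<Longrightarrow> x \<in> U \<longleftrightarrow> h x \<in> V"
proof -
  let ?X = "shift_space A" and ?Y = "shift_space B"
  have mono: "U \<subseteq> U'" if "R U V" "R U' V'" "V \<subseteq> V'" for U U' V V'
  proof -
    have "R (U \<inter> (?X - U')) (V \<inter> (?Y - V'))" using that Int compl by blast
    moreover have "V \<inter> (?Y - V') = {}" using that(3) by blast
    ultimately have "U \<inter> (?X - U') = {}" using empty by simp
    then show ?thesis using clopen_subset[OF left[OF that(1)]] by blast
  qed
  have R_empty: "R {} {}" using total[OF clopen_intros(1)] empty by blast
  then have R_space: "R ?X ?Y" using compl by fastforce
  have Un: "R (U \<union> U') (V \<union> V')" if "R U V" "R U' V'" "V \<subseteq> ?Y" "V' \<subseteq> ?Y" for U U' V V'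
  proof -
    have "R (?X - (?X - U) \<inter> (?X - U')) (?Y - (?Y - V) \<inter> (?Y - V'))"
      using that Int compl by blast
    moreover have "?X - (?X - U) \<inter> (?X - U') = U \<union> U'"
      using clopen_subset[OF left[OF that(1)]] clopen_subset[OF left[OF that(2)]] by blast
    moreover have "?Y - (?Y - V) \<inter> (?Y - V') = V \<union> V'" using that by blast
    ultimately show ?thesis by simp
  qed
  obtain \<eta> where \<eta>: "\<And>V. clopen B V \<Longrightarrow> R (\<eta> V) V" using total by metis
  have UN: "R (\<Union>j\<in>S. \<eta> (coord B n j)) (\<Union>j\<in>S. coord B n j)" if "finite S" for S n
    using that
  proof (induction S rule: finite_induct)
    case (insert j S)
    have "R (\<eta> (coord B n j) \<union> (\<Union>j\<in>S. \<eta> (coord B n j))) (coord B n j \<union> (\<Union>j\<in>S. coord B n j))"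
      by (rule Un[OF \<eta>[OF clopen_coord] insert.IH]) (auto simp: coord_def)
    then show ?case by simp
  qed (simp add: R_empty)
  have "\<exists>j. x \<in> \<eta> (coord B n j)" if "x \<in> ?X" for x n
  proof -
    have "(\<Union>j. coord B n j) = ?Y" by (auto simp: coord_def)
    then have "?X \<subseteq> (\<Union>j. \<eta> (coord B n j))" using mono[OF R_space UN[of UNIV n]] by simp
    then show ?thesis using that by blast
  qed
  then have "\<exists>f. \<forall>x\<in>?X. \<forall>n. x \<in> \<eta> (coord B n (f x n))" by metis
  then obtain h where h: "\<And>x n. x \<in> ?X \<Longrightarrow> x \<in> \<eta> (coord B n (h x n))" by blast
  have hY: "h x \<in> ?Y" if x: "x \<in> ?X" for x
  proof -
    have "B $ h x n $ h x (Suc n) = 1" for n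
    proof (rule ccontr)
      assume "B $ h x n $ h x (Suc n) \<noteq> 1"
      then have "coord B n (h x n) \<inter> coord B (Suc n) (h x (Suc n)) = {}"
        by (auto simp: coord_def shift_space_def) metis
      moreover have "R (\<eta> (coord B n (h x n)) \<inter> \<eta> (coord B (Suc n) (h x (Suc n))))
          (coord B n (h x n) \<inter> coord B (Suc n) (h x (Suc n)))"
        by (intro Int \<eta> clopen_coord)
      ultimately show False using empty h[OF x] by fastforce
    qed
    then show ?thesis by (simp add: shift_space_def)
  qed
  have cyl: "\<exists>U. R U (cylinder B (h x) n) \<and> x \<in> U" if x: "x \<in> ?X" for x n
  proof (induction n)
    case 0
    have "cylinder B (h x) 0 = ?Y" by (simp add: cylinder_def)
    then show ?case using R_space x by auto
  next
    case (Suc n)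
    then obtain U where U: "R U (cylinder B (h x) n)" "x \<in> U" by blast
    have "cylinder B (h x) (Suc n) = cylinder B (h x) n \<inter> coord B n (h x n)"
      by (auto simp: cylinder_def coord_def less_Suc_eq)
    then have "R (U \<inter> \<eta> (coord B n (h x n))) (cylinder B (h x) (Suc n))"
      using Int[OF U(1) \<eta>[OF clopen_coord]] by simp
    then show ?case using U(2) h[OF x, of n] by blast
  qed
  have imp: "x \<in> U" if R: "R U V" and V: "clopen B V" and x: "x \<in> ?X" "h x \<in> V" for U V x
  proof -
    obtain n where n: "determined B n V" using V by (auto simp: clopen_def)
    have sub: "cylinder B (h x) n \<subseteq> V" using x(2) n by (auto simp: determined_def cylinder_def)
    obtain U' where "R U' (cylinder B (h x) n)" "x \<in> U'" using cyl[OF x(1)] by blast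
    then show ?thesis using mono[OF _ R sub] by blast
  qed
  have "x \<in> U \<longleftrightarrow> h x \<in> V" if "R U V" "clopen B V" "x \<in> ?X" for U V x
  proof
    assume "x \<in> U"
    show "h x \<in> V"
    proof (rule ccontr)
      assume "h x \<notin> V"
      then have "x \<in> ?X - U"
        using imp[OF compl[OF that(1)] clopen_intros(5)[OF that(2)] that(3)] hY[OF that(3)] by blast
      then show False using \<open>x \<in> U\<close> by blast
    qed
  qed (rule imp[OF that])
  with hY show thesis by (rule that)
qed

lemma eq_if_same_clopen:
  assumes "x \<in> shift_space A" "y \<in> shift_space A" "\<And>U. clopen A U \<Longrightarrow> x \<in> U \<Longrightarrow> y \<in> U"
  shows "x = y"
proof
  fix n show "x n = y n" using assms(3)[OF clopen_coord, of n "x n"] assms(1) by (simp add: coord_def)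
qed

lemma continuous_map_if_clopen_preimages:
  assumes h: "\<And>x. x \<in> shift_space A \<Longrightarrow> h x \<in> shift_space B"
    and pre: "\<And>V. clopen B V \<Longrightarrow> \<exists>U. clopen A U \<and> (\<forall>x\<in>shift_space A. x \<in> U \<longleftrightarrow> h x \<in> V)"
  shows "continuous_map (shift_topology A) (shift_topology B) h"
  unfolding continuous_map_def
proof (intro conjI allI impI)
  show "h \<in> topspace (shift_topology A) \<rightarrow> topspace (shift_topology B)" using h by simp
  fix W assume W: "openin (shift_topology B) W"
  let ?P = "{x \<in> topspace (shift_topology A). h x \<in> W}"
  show "openin (shift_topology A) ?P"
    unfolding openin_subopen[of _ ?P]
  proof
    fix x assume "x \<in> ?P"
    then have x: "x \<in> shift_space A" "h x \<in> W" by simp_all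
    obtain m where m: "cylinder B (h x) m \<subseteq> W" using open_contains_cylinder[OF W x(2)] by blast
    obtain U where U: "clopen A U" "\<forall>x'\<in>shift_space A. x' \<in> U \<longleftrightarrow> h x' \<in> cylinder B (h x) m"
      using pre[OF clopen_cylinder] by blast
    have "x \<in> U" using U(2) x(1) h[OF x(1)] by (simp add: cylinder_def)
    moreover have "U \<subseteq> ?P" using U(2) clopen_subset[OF U(1)] m by auto
    ultimately show "\<exists>T. openin (shift_topology A) T \<and> x \<in> T \<and> T \<subseteq> ?P"
      using openin_clopen[OF U(1)] by blast
  qed
qed

text \<open>The relation \<open>R U V\<close> says that \<open>\<Psi>\<close> sends \<open>proj U\<close> to \<open>proj V\<close>. Every clopen set of either space has a
  partner because the diagonals have no other projections, and only the empty set is the partner of the empty set.\<close>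

theorem conjugacy_if_algebra_iso:
  fixes A :: "int ^ 'm ^ 'm" and B :: "int ^ 'n ^ 'n"
  assumes A: "ck_matrix A" and B: "ck_matrix B"
    and iso: "star_iso (CK_algebra A) (CK_algebra B) \<Psi>"
    and diag: "\<Psi> ` CK_diagonal A = CK_diagonal B"
    and tau: "\<forall>y\<in>carrier (CK_algebra A). \<Psi> (CK_tau A y) = CK_tau B (\<Psi> y)"
  shows "\<exists>h. one_sided_conjugacy A B h"
proof -
  let ?OA = "CK_algebra A" and ?OB = "CK_algebra B"
  interpret A: ck_rep ?OA A "ck_gen A" by (rule ck_rep_CK[OF A])
  interpret B: ck_rep ?OB B "ck_gen B" by (rule ck_rep_CK[OF B])
  interpret cstar_hom ?OA ?OB \<Psi>
    using iso by unfold_locales (simp add: star_iso_def)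
  have inj: "inj_on \<Psi> (carrier ?OA)" using iso by (simp add: star_iso_def bij_betw_def)
  have diag': "\<Psi> ` A.diagonal = B.diagonal" using diag by (simp add: CK_diagonal_eq A B)
  define R where "R U V \<longleftrightarrow> clopen A U \<and> clopen B V \<and> \<Psi> (A.proj U) = B.proj V" for U V
  have R_right: "\<exists>V. R U V" if U: "clopen A U" for U
  proof -
    have "\<Psi> (A.proj U) \<in> B.diagonal" using diag' A.proj_in_diagonal by blast
    moreover have "star ?OB (\<Psi> (A.proj U)) = \<Psi> (A.proj U)"
      using hom_star[of "A.proj U"] by (simp add: A.proj_star)
    moreover have "\<Psi> (A.proj U) \<otimes>\<^bsub>?OB\<^esub> \<Psi> (A.proj U) = \<Psi> (A.proj U)"
      using hom_mult[of "A.proj U" "A.proj U"] by (simp add: A.proj_mult_self U)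
    ultimately obtain V where "clopen B V" "\<Psi> (A.proj U) = B.proj V" by (rule B.diagonal_projection)
    then show ?thesis using U by (auto simp: R_def)
  qed
  have R_left: "\<exists>U. R U V" if V: "clopen B V" for V
  proof -
    obtain e where e: "e \<in> A.diagonal" "\<Psi> e = B.proj V" using diag' B.proj_in_diagonal by (metis imageE)
    have ec: "e \<in> carrier ?OA" using e cstar_subalgebraD(1)[OF A.diagonal_subalgebra] by blast
    have "star ?OA e = e"
      by (rule inj_onD[OF inj]) (simp_all add: hom_star ec e B.proj_star)
    moreover have "e \<otimes>\<^bsub>?OA\<^esub> e = e"
      by (rule inj_onD[OF inj]) (simp_all add: hom_mult ec e B.proj_mult_self V)
    ultimately obtain U where "clopen A U" "e = A.proj U" using e(1) by (metis A.diagonal_projection)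
    then show ?thesis using V e(2) by (auto simp: R_def)
  qed
  have R_Int: "R (U \<inter> U') (V \<inter> V')" if "R U V" "R U' V'" for U V U' V'
    using that hom_mult[of "A.proj U" "A.proj U'"] A.proj_mult[of U U'] B.proj_mult[of V V']
    by (simp add: R_def clopen_intros)
  have R_compl: "R (shift_space A - U) (shift_space B - V)" if R: "R U V" for U V
    using R by (simp add: R_def clopen_intros A.proj_compl B.proj_compl hom_minus hom_one)
  have R_empty_left: "U = {}" if "R U {}" for U
  proof -
    have "\<Psi> (A.proj U) = \<Psi> \<zero>\<^bsub>?OA\<^esub>" using that by (simp add: R_def hom_zero B.proj_empty)
    then have "A.proj U = \<zero>\<^bsub>?OA\<^esub>" by (rule inj_onD[OF inj]) simp_all
    then show ?thesis using that CK_proj_nonzero[OF A] by (simp add: R_def)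
  qed
  have R_empty_right: "V = {}" if "R {} V" for V
  proof -
    have "B.proj V = \<zero>\<^bsub>?OB\<^esub>" using that by (simp add: R_def hom_zero A.proj_empty)
    then show ?thesis using that CK_proj_nonzero[OF B] by (simp add: R_def)
  qed
  have R_clopen: "clopen A U" "clopen B V" if "R U V" for U V using that by (simp_all add: R_def)
  obtain h where h: "\<And>x. x \<in> shift_space A \<Longrightarrow> h x \<in> shift_space B"
    and h_clopen: "\<And>U V x. R U V \<Longrightarrow> clopen B V \<Longrightarrow> x \<in> shift_space A \<Longrightarrow> x \<in> U \<longleftrightarrow> h x \<in> V"
    by (rule stone_map[OF R_clopen(1) R_left R_Int R_compl R_empty_left]) (assumption+, rule that)
  have hR: "x \<in> U \<longleftrightarrow> h x \<in> V" if "R U V" "x \<in> shift_space A" for U V x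
    by (rule h_clopen[OF that(1) R_clopen(2)[OF that(1)] that(2)])
  obtain g where g: "\<And>y. y \<in> shift_space B \<Longrightarrow> g y \<in> shift_space A"
    and g_clopen: "\<And>V U y. R U V \<Longrightarrow> clopen A U \<Longrightarrow> y \<in> shift_space B \<Longrightarrow> y \<in> V \<longleftrightarrow> g y \<in> U"
    by (rule stone_map[where R = "\<lambda>V U. R U V", OF R_clopen(2) R_right R_Int R_compl R_empty_right])
      (assumption+, rule that)
  have gR: "y \<in> V \<longleftrightarrow> g y \<in> U" if "R U V" "y \<in> shift_space B" for U V y
    by (rule g_clopen[OF that(1) R_clopen(1)[OF that(1)] that(2)])
  have gh: "g (h x) = x" if x: "x \<in> shift_space A" for x
  proof (rule eq_if_same_clopen[symmetric, OF x g[OF h[OF x]]])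
    fix U assume U: "clopen A U" "x \<in> U"
    then obtain V where "R U V" using R_right by blast
    then show "g (h x) \<in> U" using hR gR h[OF x] x U(2) by blast
  qed
  have hg: "h (g y) = y" if y: "y \<in> shift_space B" for y
  proof (rule eq_if_same_clopen[symmetric, OF y h[OF g[OF y]]])
    fix V assume V: "clopen B V" "y \<in> V"
    then obtain U where "R U V" using R_left by blast
    then show "h (g y) \<in> V" using hR gR g[OF y] y V(2) by blast
  qed
  have cont_h: "continuous_map (shift_topology A) (shift_topology B) h"
  proof (rule continuous_map_if_clopen_preimages[OF h])
    fix V assume "clopen B V"
    then obtain U where U: "R U V" using R_left by blast
    have "\<forall>x\<in>shift_space A. x \<in> U \<longleftrightarrow> h x \<in> V" using hR[OF U] by simp
    with R_clopen(1)[OF U] show "\<exists>U. clopen A U \<and> (\<forall>x\<in>shift_space A. x \<in> U \<longleftrightarrow> h x \<in> V)" by blast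
  qed
  have cont_g: "continuous_map (shift_topology B) (shift_topology A) g"
  proof (rule continuous_map_if_clopen_preimages[OF g])
    fix U assume "clopen A U"
    then obtain V where V: "R U V" using R_right by blast
    have "\<forall>y\<in>shift_space B. y \<in> V \<longleftrightarrow> g y \<in> U" using gR[OF V] by simp
    with R_clopen(2)[OF V] show "\<exists>V. clopen B V \<and> (\<forall>y\<in>shift_space B. y \<in> V \<longleftrightarrow> g y \<in> U)" by blast
  qed
  have inj_coord: "inj_on shift (U \<inter> coord C 0 j)" for U j and C :: "int ^ 'k ^ 'k"
    by (rule inj_onI) (metis (mono_tags) Int_iff coord_def mem_Collect_eq prepend_shift)
  have "h (shift x) = shift (h x)" if x: "x \<in> shift_space A" for x
  proof -
    note sx = shift_in_shift_space[OF x] and shx = shift_in_shift_space[OF h[OF x]]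
    obtain V0 where V0: "R (coord A 0 (x 0)) V0" using R_right[OF clopen_coord] by blast
    obtain U0 where U0: "R U0 (coord B 0 (h x 0))" using R_left[OF clopen_coord] by blast
    \<comment> \<open>A neighbourhood of \<open>x\<close> such that the shift is injective on it and on its partner.\<close>
    let ?U = "U0 \<inter> coord A 0 (x 0)" and ?V = "V0 \<inter> coord B 0 (h x 0)"
    have UV: "R ?U ?V" using R_Int[OF V0 U0] by (simp add: Int_commute)
    have xU: "x \<in> ?U" using hR[OF U0 x] h[OF x] x by (simp add: coord_def)
    have "h (shift x) \<in> V \<longleftrightarrow> shift (h x) \<in> V" if V: "clopen B V" for V
    proof -
      obtain W where W: "R W V" using R_left[OF V] by blast
      have cl: "clopen A W" "clopen A ?U" "clopen B ?V" using W UV by (auto simp: R_def)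
      have pW: "\<Psi> (A.proj W) = B.proj V" "\<Psi> (A.proj ?U) = B.proj ?V" using W UV by (auto simp: R_def)
      have t: "\<Psi> (A.s \<otimes>\<^bsub>?OA\<^esub> A.proj W \<otimes>\<^bsub>?OA\<^esub> star ?OA A.s) = B.s \<otimes>\<^bsub>?OB\<^esub> B.proj V \<otimes>\<^bsub>?OB\<^esub> star ?OB B.s"
        using tau pW(1) by (simp add: CK_tau_def ck_sum_eq A B)
      have "\<Psi> (A.proj (?U \<inter> shift_vimage A W)) = B.proj (?V \<inter> shift_vimage B V)"
        using A.corner_tau[OF cl(2,1) inj_coord] B.corner_tau[OF cl(3) V inj_coord]
          hom_mult[of "A.proj ?U \<otimes>\<^bsub>?OA\<^esub> (A.s \<otimes>\<^bsub>?OA\<^esub> A.proj W \<otimes>\<^bsub>?OA\<^esub> star ?OA A.s)" "A.proj ?U"]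
          hom_mult[of "A.proj ?U" "A.s \<otimes>\<^bsub>?OA\<^esub> A.proj W \<otimes>\<^bsub>?OA\<^esub> star ?OA A.s"] t pW(2) by simp
      then have "R (?U \<inter> shift_vimage A W) (?V \<inter> shift_vimage B V)"
        using cl V by (simp add: R_def clopen_intros(3) clopen_shift_vimage)
      from hR[OF this x] have "x \<in> shift_vimage A W \<longleftrightarrow> h x \<in> shift_vimage B V"
        using xU hR[OF UV x] by blast
      then have "shift x \<in> W \<longleftrightarrow> shift (h x) \<in> V" using x h[OF x] by (simp add: shift_vimage_def)
      then show ?thesis using hR[OF W sx] by simp
    qed
    then show ?thesis using eq_if_same_clopen[OF h[OF sx] shx] by blast
  qed
  moreover have "homeomorphic_maps (shift_topology A) (shift_topology B) h g"
    using cont_h cont_g gh hg by (simp add: homeomorphic_maps_def)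
  ultimately have "one_sided_conjugacy A B h" by (auto simp: one_sided_conjugacy_def homeomorphic_map_maps)
  then show ?thesis by blast
qed

theorem corollary3p5:
  fixes A :: "int ^ 'm ^ 'm" and B :: "int ^ 'n ^ 'n"
  assumes "ck_matrix A" and "ck_matrix B"
  shows
    "((\<exists>h. one_sided_conjugacy A B h) \<longleftrightarrow>
      (\<exists>\<Phi>. top_groupoid_iso (shift_groupoid A) (shift_groupoid B) \<Phi> \<and>
            (\<forall>g\<in>arrows (shift_groupoid A). \<Phi> (eps g) = eps (\<Phi> g)))) \<and>
     ((\<exists>\<Phi>. top_groupoid_iso (shift_groupoid A) (shift_groupoid B) \<Phi> \<and>
            (\<forall>g\<in>arrows (shift_groupoid A). \<Phi> (eps g) = eps (\<Phi> g))) \<longleftrightarrow>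
      (\<exists>\<Psi>. star_iso (CK_algebra A) (CK_algebra B) \<Psi> \<and>
            \<Psi> ` CK_diagonal A = CK_diagonal B \<and>
            (\<forall>y\<in>carrier (CK_algebra A). \<Psi> (CK_tau A y) = CK_tau B (\<Psi> y))))"
    (is "(?conj \<longleftrightarrow> ?grpd) \<and> (?grpd \<longleftrightarrow> ?alg)")
proof -
  have "?conj \<Longrightarrow> ?grpd" using groupoid_iso_if_conjugacy[of A B] by blast
  moreover have "?grpd \<Longrightarrow> ?conj" using conjugacy_if_groupoid_iso[of A B] by blast
  moreover have "?conj \<Longrightarrow> ?alg" using algebra_iso_if_conjugacy[OF assms] by blast
  moreover have "?alg \<Longrightarrow> ?conj" using conjugacy_if_algebra_iso[OF assms] by blast
  ultimately show ?thesis by blast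
qed

end
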